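(* Let $h$ be a real-valued function on $[0,+\infty)$ satisfying the following conditions. (1) For some $\gamma\in\mathbb{R}$, $\alpha>0$, $\delta>0$ the series $\sum_{k\in\mathbb{Z}}(1+|k|^\alpha\delta\gamma)h(|k|^\alpha\delta)e^{ikt}$ is the Fourier series of some function $g_{\alpha,\delta,\gamma}\in L_1$. (2) The function $t\mapsto(1+\gamma|t|^\alpha)h(|t|^\alpha)$ is positive definite and continuous on $\mathbb{R}$, and $h(0)\le1$. Let $p=1$ or $p=\infty$, and let $G_{\alpha,\delta,\gamma}$ be the operator $G_{\alpha,\delta,\gamma}(f)(x)=\frac1{2\pi}\int_{-\pi}^{\pi}f(x-t)g_{\alpha,\delta,\gamma}(t)\,dt$. Then: (a) If $\beta$ is an odd integer and either $r=1$ or $r\ge2$, then $$E(\mathbf{W}^{r,\beta}_{p,1};G_{\alpha,\delta,\gamma})_p=\frac{4}{\pi}\sum_{k=0}^{\infty}\frac{1-(1+(2k+1)^\alpha\delta\gamma)\,h((2k+1)^\alpha\delta)}{(2k+1)^{r+1}} .$$ (b) If $\beta$ is an even integer and either $r=2$ or $r\ge3$, then $$E(\mathbf{W}^{r,\beta}_{p,1};G_{\alpha,\delta,\gamma})_p=\frac{4}{\pi}\sum_{k=0}^{\infty}\frac{1-(1+(2k+1)^\alpha\delta\gamma)\,h((2k+1)^\alpha\delta)}{(2k+1)^{r+1}}(-1)^k .$$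
   Context: $L_p$, $1\le p\le\infty$, is the space of $2\pi$-periodic real-valued measurable functions with finite norm $\|f\|_p=(\int_{-\pi}^{\pi}|f(t)|^p\,dt)^{1/p}$ for $p<\infty$ and $\|f\|_\infty=\operatorname{ess\,sup}_{[-\pi,\pi]}|f|$. Fourier coefficients: $\widehat{\varphi}(k)=\frac1{2\pi}\int_{-\pi}^{\pi}\varphi(t)e^{-ikt}\,dt$; the Fourier series of $\varphi$ is $\sum_{k\in\mathbb{Z}}\widehat\varphi(k)e^{ikt}$. $H_p^1=\{\varphi\in L_p:\|\varphi\|_p\le1,\ \widehat\varphi(0)=0\}$. For $r>0$ and $\beta\in\mathbb{R}$ put $$\psi_{r,\beta}(t)=\sum_{k\ne0}\frac{e^{-i\beta\pi\operatorname{sign}(k)/2}}{|k|^r}e^{ikt}=\sum_{k=1}^\infty\frac{2\cos(kt-\beta\pi/2)}{k^r};$$ this function belongs to $L_1$ and the series is its Fourier series. $\mathbf{W}^{r,\beta}_{p,1}$ is the class of all functions $f(x)=\frac1{2\pi}\int_{-\pi}^{\pi}\varphi(x-t)\psi_{r,\beta}(t)\,dt$ with $\varphi\in H_p^1$. For an operator $G$, $E(\mathbf{W}^{r,\beta}_{p,1};G)_p=\sup\{\|f-G(f)\|_p: f\in\mathbf{W}^{r,\beta}_{p,1}\}$. A function $f:\mathbb{R}\to\mathbb{C}$ is positive definite on $\mathbb{R}$ if $\sum_{k,j=1}^{n}c_k\overline{c_j}f(x_k-x_j)\ge0$ for all $n\in\mathbb{N}$, $x_1,\dots,x_n\in\mathbb{R}$,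 $c_1,\dots,c_n\in\mathbb{C}$. *)

theory Defs
  imports "HOL-Probability.Essential_Supremum"
begin

abbreviation period_measure :: "real measure" where
  "period_measure \<equiv> lebesgue_on {-pi..pi}"

(* Extended-real valued, so that functions of infinite norm are not assigned a finite junk value.
   Only meant for 1 <= p <= infinity. The integral is not normalised by 1 / (2 * pi). *)
definition Lp_norm :: "ereal \<Rightarrow> (real \<Rightarrow> real) \<Rightarrow> ereal" where
  "Lp_norm p f =
     (if p = \<infinity> then esssup period_measure (\<lambda>t. ereal \<bar>f t\<bar>)
      else (let I = (\<integral>\<^sup>+ t. ennreal (\<bar>f t\<bar> powr real_of_ereal p) \<partial>period_measure)
            in if I = \<infinity> then \<infinity> else ereal (enn2real I powr (1 / real_of_ereal p))))"

definition Lp_space :: "ereal \<Rightarrow> (real \<Rightarrow> real) set" where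
  "Lp_space p = {f. f \<in> borel_measurable lebesgue \<and> (\<forall>x. f (x + 2 * pi) = f x) \<and> Lp_norm p f < \<infinity>}"

definition fourier_coeff :: "(real \<Rightarrow> real) \<Rightarrow> int \<Rightarrow> complex" where
  "fourier_coeff f k =
     1 / (2 * of_real pi) *
     (LINT t|period_measure. of_real (f t) * exp (- (\<i> * of_int k * of_real t)))"

(* The series sum_{k in Z} c k * e^(i k t) is the Fourier series of f. *)
definition is_fourier_series_of :: "(int \<Rightarrow> complex) \<Rightarrow> (real \<Rightarrow> real) \<Rightarrow> bool" where
  "is_fourier_series_of c f \<longleftrightarrow> (\<forall>k. fourier_coeff f k = c k)"

definition convolution :: "(real \<Rightarrow> real) \<Rightarrow> (real \<Rightarrow> real) \<Rightarrow> real \<Rightarrow> real" where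
  "convolution f g x = 1 / (2 * pi) * (LINT t|period_measure. f (x - t) * g t)"

definition H1_class :: "ereal \<Rightarrow> (real \<Rightarrow> real) set" where
  "H1_class p = {\<phi> \<in> Lp_space p. Lp_norm p \<phi> \<le> 1 \<and> fourier_coeff \<phi> 0 = 0}"

(* The series converges (conditionally if r <= 1) for every r > 0 and every t that is not a
   multiple of 2 * pi, so the value of suminf matters only up to a null set. *)
definition psi :: "real \<Rightarrow> real \<Rightarrow> real \<Rightarrow> real" where
  "psi r \<beta> t = (\<Sum>k. 2 * cos (real (Suc k) * t - \<beta> * pi / 2) / real (Suc k) powr r)"

definition W_class :: "real \<Rightarrow> real \<Rightarrow> ereal \<Rightarrow> (real \<Rightarrow> real) set" where
  "W_class r \<beta> p = {convolution \<phi> (psi r \<beta>) | \<phi>. \<phi> \<in> H1_class p}"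

definition approx_error ::
  "(real \<Rightarrow> real) set \<Rightarrow> ((real \<Rightarrow> real) \<Rightarrow> real \<Rightarrow> real) \<Rightarrow> ereal \<Rightarrow> ereal" where
  "approx_error W G p = (SUP f\<in>W. Lp_norm p (\<lambda>x. f x - G f x))"

(* Membership in the nonnegative reals includes the claim that the complex sum is real. *)
definition positive_definite_on_reals :: "(real \<Rightarrow> complex) \<Rightarrow> bool" where
  "positive_definite_on_reals f \<longleftrightarrow>
     (\<forall>(n::nat) (x :: nat \<Rightarrow> real) (c :: nat \<Rightarrow> complex).
        (\<Sum>k<n. \<Sum>j<n. c k * cnj (c j) * f (x k - x j)) \<in> \<real>\<^sub>\<ge>\<^sub>0)"

end

theory Submission
  imports Defs
begin

text \<open>Put $\Phi(k) = (1 + k^\alpha\delta\gamma)\,h(k^\alpha\delta)$, the $k$-th Fourier coefficient of $g$.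
  Then $f - G(f) = \varphi * K$, where $K = \psi - \psi * g$ has the Fourier series of $\psi$ with
  coefficients multiplied by $1 - \Phi(k)$. If $K - c$ has the sign pattern of
  a square wave $v$ (the sign of sine or of cosine, up to a global sign), then the supremum of
  $\|\varphi * K\|_p$ is $\frac{1}{2\pi}\|K - c\|_1 = \frac{1}{2\pi}\int K v$: the upper bound uses that
  $\varphi$ has mean zero, the lower bound takes $\varphi = v(-\cdot)$ for $p = \infty$ and an approximation of
  half the difference of the point masses at $0$ and $\pi$ for $p = 1$. Expanding $v$ in odd
  harmonics gives the series of the theorem.

  The sign pattern comes from positive definiteness without Bochner's theorem: the Toeplitz sums
  $\sum_{k,j<N} \Phi(|k-j|)\cos((k-j)s)$ are nonnegative, and integrating them against a nonnegative
  function $\sum_k b_k(1 - \cos ks)$ yields $\sum_k b_k(1 - \Phi(k)) \ge 0$. For $b_k = 2\sin(kt)/k^r$ with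
  $r \ge 2$ the required nonnegativity says $2S(t) \ge S(t+s) + S(t-s)$ for the odd function
  $S = \sum_k 2\sin(kt)/k^r$, which is concave on $[0,\pi]$. The sawtooth ($r = 1$) is also concave there, but
  its series is only conditionally convergent, so the argument is run for its integral.\<close>

section \<open>Integration over a period\<close>

text \<open>Concavity of a sine series with exponent r >= 2 is available because k^(-r) is k^(-2),
  which two derivatives consume, times the nonincreasing convex weight k^(2-r). In the even case the
  kernel has to be monotone on [0, pi], and differentiating a cosine series of exponent r leads to a
  sine series of exponent r - 1; the ranges r = 2 and r >= 3 are those of the odd case moved by one.
  The constant c is 0 for the odd kernels and the value at pi/2 for the even ones. Positive
  definiteness controls only the Fejer means of the cosine series of \<Phi>, not its partial sums,
  so the decisive inequality is proved for averages and then passed to the limit. It reads sum b_k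
  \<Phi>(k) <= \<Phi>(0) sum b_k, and \<Phi>(0) = h(0) <= 1 finishes whenever sum b_k >= 0. The
  exponent r = 1 shapes the technical frame: its kernel is discontinuous and its series is not
  absolutely convergent, so limits and integrals are interchanged under a uniform bound on partial
  sums, which for the sawtooth comes from an explicit remainder estimate.\<close>

interpretation period: finite_measure period_measure
  by (rule finite_measure_lebesgue_on) auto

interpretation period_pair: pair_sigma_finite period_measure period_measure ..

lemma borel_measurable_period:
  fixes f :: "real \<Rightarrow> real"
  assumes "f \<in> borel_measurable borel"
  shows "f \<in> borel_measurable period_measure"
proof -
  have "f \<in> borel_measurable lebesgue"
    using assms by (simp add: measurable_completion)
  then show ?thesis by (rule measurable_restrict_space1)
qed

lemma borel_measurable_lebesgue_period:
  fixes f :: "real \<Rightarrow> real"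
  assumes "f \<in> borel_measurable lebesgue"
  shows "f \<in> borel_measurable period_measure"
  using assms by (rule measurable_restrict_space1)

lemma integrable_period_bounded:
  fixes v :: "real \<Rightarrow> real"
  assumes "v \<in> borel_measurable period_measure" "\<And>t. \<bar>v t\<bar> \<le> B"
  shows "integrable period_measure v"
  using assms by (intro period.integrable_const_bound[where B=B]) auto

lemma integrable_period_mult_bounded:
  fixes u v :: "real \<Rightarrow> real"
  assumes u: "integrable period_measure u" and v: "v \<in> borel_measurable period_measure"
    and B: "\<And>t. \<bar>v t\<bar> \<le> B"
  shows "integrable period_measure (\<lambda>t. u t * v t)"
proof (rule Bochner_Integration.integrable_bound)
  show "integrable period_measure (\<lambda>t. B * u t)" using u by simp
  show "(\<lambda>t. u t * v t) \<in> borel_measurable period_measure"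
    using u v by measurable
  have "\<bar>u t * v t\<bar> \<le> \<bar>B * u t\<bar>" for t
    using mult_right_mono[OF order_trans[OF B abs_ge_self], of "\<bar>u t\<bar>"] by (simp add: abs_mult mult.commute)
  then show "AE t in period_measure. norm (u t * v t) \<le> norm (B * u t)" by simp
qed

text \<open>The dominating function is \<bar>B * u\<bar>. The fixed factor \<open>u\<close> may be
  as irregular as \<open>g\<close>, while the factors \<open>v n\<close> are typically partial sums
  of trigonometric series, for which a uniform bound is all that is known when r = 1.\<close>

lemma bounded_convergence_period:
  fixes u w :: "real \<Rightarrow> real" and v :: "nat \<Rightarrow> real \<Rightarrow> real"
  assumes u: "integrable period_measure u" and v: "\<And>n. v n \<in> borel_measurable period_measure"
    and w: "w \<in> borel_measurable period_measure"
    and B: "\<And>n t. \<bar>v n t\<bar> \<le> B"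
    and lim: "AE t in period_measure. (\<lambda>n. v n t) \<longlonglongrightarrow> w t"
  shows "(\<lambda>n. LINT t|period_measure. u t * v n t) \<longlonglongrightarrow> (LINT t|period_measure. u t * w t)"
proof (rule integral_dominated_convergence)
  show "integrable period_measure (\<lambda>t. \<bar>B * u t\<bar>)" using u by simp
  show "(\<lambda>t. u t * w t) \<in> borel_measurable period_measure"
    "(\<lambda>t. u t * v n t) \<in> borel_measurable period_measure" for n
    using u v w by measurable
  show "AE t in period_measure. (\<lambda>n. u t * v n t) \<longlonglongrightarrow> u t * w t"
    using lim by eventually_elim (intro tendsto_intros)
  have "\<bar>u t * v n t\<bar> \<le> \<bar>B * u t\<bar>" for n t
    using mult_right_mono[OF order_trans[OF B abs_ge_self], of "\<bar>u t\<bar>"] by (simp add: abs_mult mult.commute)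
  then show "AE t in period_measure. norm (u t * v n t) \<le> \<bar>B * u t\<bar>" for n by simp
qed

lemma periodic_add_int:
  fixes f :: "real \<Rightarrow> 'a"
  assumes "\<And>x. f (x + 2 * pi) = f x"
  shows "f (x + 2 * pi * of_int n) = f x"
proof (induction n arbitrary: x rule: int_induct[where k=0])
  case base then show ?case by simp
next
  case (step1 i)
  have "f (x + 2 * pi * of_int (i + 1)) = f ((x + 2 * pi * of_int i) + 2 * pi)"
    by (simp add: algebra_simps)
  then show ?case using assms step1 by metis
next
  case (step2 i)
  have "f (x + 2 * pi * of_int i) = f ((x + 2 * pi * of_int (i - 1)) + 2 * pi)"
    by (simp add: algebra_simps)
  then show ?case using assms step2 by metis
qed

lemma has_bochner_integral_period_iff:
  fixes f :: "real \<Rightarrow> real"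
  assumes "a \<le> b"
  shows "has_bochner_integral (lebesgue_on {a..b}) f I \<longleftrightarrow> f absolutely_integrable_on {a..b} \<and> (f has_integral I) {a..b}"
proof -
  have "integrable (lebesgue_on {a..b}) f \<longleftrightarrow> f absolutely_integrable_on {a..b}"
    by (simp add: set_integrable_def integrable_restrict_space)
  then show ?thesis
    using has_integral_integral_lebesgue_on[of "{a..b}" f]
    by (auto simp: has_bochner_integral_iff dest: has_integral_unique)
qed

lemma absolutely_integrable_shift:
  fixes f :: "real \<Rightarrow> real"
  assumes "f absolutely_integrable_on {a..b}"
  shows "(\<lambda>x. f (x + c)) absolutely_integrable_on {a - c..b - c}"
  using assms integrable_shift_real_ivl[of f a b c] integrable_shift_real_ivl[of "\<lambda>x. norm (f x)" a b c]
  by (auto simp: absolutely_integrable_on_def)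

text \<open>After the shift is reduced to [0, 2 pi], the shifted interval exceeds the period on the
  right by exactly the length it misses on the left, and periodicity matches these two pieces.
  \<open>has_bochner_integral\<close> delivers integrability of the translate together with its
  value.\<close>

lemma period_integral_translate:
  fixes f :: "real \<Rightarrow> real"
  assumes per: "\<And>x. f (x + 2 * pi) = f x" and int: "integrable period_measure f"
  shows "has_bochner_integral period_measure (\<lambda>t. f (t + x)) (LINT t|period_measure. f t)"
proof -
  define n where "n = \<lfloor>x / (2 * pi)\<rfloor>"
  define y where "y = x - 2 * pi * of_int n"
  have y: "0 \<le> y" "y \<le> 2 * pi"
    using floor_divide_lower[of "2 * pi" x] floor_divide_upper[of "2 * pi" x]
    by (auto simp: y_def n_def algebra_simps)
  have fy: "f (t + x) = f (t + y)" for t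
    using periodic_add_int[of f "t + y" n] per by (simp add: y_def algebra_simps)
  define I where "I = (LINT t|period_measure. f t)"
  have "has_bochner_integral period_measure f I"
    using int by (simp add: has_bochner_integral_iff I_def)
  then have a1: "f absolutely_integrable_on {- pi..pi}" and i1: "(f has_integral I) {- pi..pi}"
    by (auto simp: has_bochner_integral_period_iff)
  have a2: "f absolutely_integrable_on {pi..3 * pi}"
    using absolutely_integrable_shift[OF a1, of "- 2 * pi"] periodic_add_int[of f _ "-1"] per by simp
  have "f absolutely_integrable_on {- pi..pi} \<union> {pi..3 * pi}"
    using a1 a2 by (rule absolutely_integrable_Un)
  then have a3: "f absolutely_integrable_on {- pi..3 * pi}"
    by (simp add: ivl_disj_un)
  have a4: "f absolutely_integrable_on {- pi + y..pi + y}"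
    using a3 y by (elim absolutely_integrable_on_subinterval) auto
  have a5: "f integrable_on {c..d}" if "- pi \<le> c" "d \<le> 3 * pi" for c d
    using a3 that unfolding absolutely_integrable_on_def by (auto elim: integrable_subinterval_real)
  have e1: "integral {- pi..- pi + y} f = integral {pi..pi + y} f"
    using integral_shift_real_ivl[of pi "2 * pi" "pi + y" f] per by simp
  have e2: "integral {- pi..- pi + y} f + integral {- pi + y..pi + y} f = integral {- pi..pi + y} f"
    using y by (intro Henstock_Kurzweil_Integration.integral_combine a5) auto
  have e3: "integral {- pi..pi} f + integral {pi..pi + y} f = integral {- pi..pi + y} f"
    using y by (intro Henstock_Kurzweil_Integration.integral_combine a5) auto
  have "integral {- pi + y..pi + y} f = I"
    using e1 e2 e3 i1 by (simp add: integral_unique)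
  then have "(f has_integral I) {- pi + y..pi + y}"
    using a4 unfolding absolutely_integrable_on_def by (metis has_integral_integral)
  then have "((\<lambda>t. f (t + y)) has_integral I) {- pi..pi}"
    using has_integral_shift_real_ivl[of f I "- pi + y" "pi + y" y] by simp
  moreover have "(\<lambda>t. f (t + y)) absolutely_integrable_on {- pi..pi}"
    using absolutely_integrable_shift[OF a4, of y] by simp
  ultimately show ?thesis
    using fy by (simp add: has_bochner_integral_period_iff I_def)
qed

lemma period_integral_reflect:
  fixes f :: "real \<Rightarrow> real"
  assumes per: "\<And>x. f (x + 2 * pi) = f x" and int: "integrable period_measure f"
  shows "has_bochner_integral period_measure (\<lambda>t. f (x - t)) (LINT t|period_measure. f t)"
  using has_bochner_integral_reflect_real_lemma[OF period_integral_translate[OF assms, of x]]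
  by (simp add: add.commute[of _ x])

lemma period_integral_antiperiodic:
  fixes v :: "real \<Rightarrow> real"
  assumes anti: "\<And>x. v (x + pi) = - v x" and int: "integrable period_measure v"
  shows "(LINT t|period_measure. v t) = 0"
proof -
  have "v (x + 2 * pi) = v x" for x
    using anti[of "x + pi"] anti[of x] by (simp add: algebra_simps)
  from period_integral_translate[OF this int, of pi]
  show ?thesis by (simp add: anti has_bochner_integral_iff)
qed

text \<open>The definition of \<open>convolution\<close> shifts the first factor. Shifting the
  kernel instead puts the supremum over \<phi> into a form where the kernel can be estimated
  independently of \<phi>.\<close>

lemma convolution_eq:
  assumes per: "\<And>x. \<phi> (x + 2 * pi) = \<phi> x" "\<And>x. Q (x + 2 * pi) = Q x"
    and "integrable period_measure (\<lambda>y. \<phi> y * Q (x - y))"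
  shows "convolution \<phi> Q x = 1 / (2 * pi) * (LINT y|period_measure. \<phi> y * Q (x - y))"
proof -
  have "Q (z - 2 * pi) = Q z" for z using per(2)[of "z - 2 * pi"] by simp
  then have "\<phi> (y + 2 * pi) * Q (x - (y + 2 * pi)) = \<phi> y * Q (x - y)" for y
    by (metis per(1) diff_diff_eq)
  from period_integral_reflect[OF this assms(3), of x]
  show ?thesis unfolding convolution_def by (simp add: has_bochner_integral_iff)
qed

text \<open>The factors carry the Lebesgue sets of the period, so the projections have to be
  composed with the identity into the Borel sets. With these rules a Borel function of a linear
  combination of both coordinates is measurable on the product.\<close>

lemma borel_measurable_period_fst [measurable]: "fst \<in> borel_measurable (period_measure \<Otimes>\<^sub>M period_measure)"
  and borel_measurable_period_snd [measurable]: "snd \<in> borel_measurable (period_measure \<Otimes>\<^sub>M period_measure)"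
proof -
  have id: "(\<lambda>x. x) \<in> borel_measurable period_measure" by (rule borel_measurable_period) simp
  show "fst \<in> borel_measurable (period_measure \<Otimes>\<^sub>M period_measure)"
    by (rule measurable_compose[OF measurable_fst id])
  show "snd \<in> borel_measurable (period_measure \<Otimes>\<^sub>M period_measure)"
    by (rule measurable_compose[OF measurable_snd id])
qed

text \<open>The parameters cover both arguments that occur: x - y with \<open>z = 0\<close>,
  \<open>c = 1\<close>, and x - t - y with \<open>c = - 1\<close>. Kernels are taken Borel
  measurable because composition with a difference of coordinates then stays measurable on the
  product.\<close>

lemma integrable_period_pair:
  fixes u w :: "real \<Rightarrow> real" and Q :: "real \<Rightarrow> real"
  assumes u: "integrable period_measure u" and w: "integrable period_measure w"
    and [measurable]: "Q \<in> borel_measurable borel" and B: "\<And>t. \<bar>Q t\<bar> \<le> B"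
  shows "integrable (period_measure \<Otimes>\<^sub>M period_measure) (\<lambda>(x, y). u x * w y * Q (z + c * x - y))"
proof (rule Bochner_Integration.integrable_bound)
  have [measurable]: "u \<in> borel_measurable period_measure" "w \<in> borel_measurable period_measure"
    using u w by auto
  show "integrable (period_measure \<Otimes>\<^sub>M period_measure) (\<lambda>(x, y). B * (u x * w y))"
  proof (rule period_pair.Fubini_integrable)
    show "(\<lambda>(x, y). B * (u x * w y)) \<in> borel_measurable (period_measure \<Otimes>\<^sub>M period_measure)" by measurable
    have "(\<lambda>x. LINT y|period_measure. norm (B * (u x * w y)))
       = (\<lambda>x. \<bar>B\<bar> * (\<bar>u x\<bar> * (LINT y|period_measure. \<bar>w y\<bar>)))"
      by (simp add: abs_mult)
    then show "integrable period_measure (\<lambda>x. LINT y|period_measure. norm (case (x, y) of (x, y) \<Rightarrow> B * (u x * w y)))"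
      using u by simp
    show "AE x in period_measure. integrable period_measure (\<lambda>y. case (x, y) of (x, y) \<Rightarrow> B * (u x * w y))"
      using w by simp
  qed
  show "(\<lambda>(x, y). u x * w y * Q (z + c * x - y)) \<in> borel_measurable (period_measure \<Otimes>\<^sub>M period_measure)"
    by (simp add: case_prod_beta)
  have "\<bar>u x * w y * Q (z + c * x - y)\<bar> \<le> \<bar>B * (u x * w y)\<bar>" for x y
    using mult_right_mono[OF order_trans[OF B[of "z + c * x - y"] abs_ge_self], of "\<bar>u x * w y\<bar>"]
    by (simp add: abs_mult mult_ac)
  then show "AE p in period_measure \<Otimes>\<^sub>M period_measure. norm (case p of (x, y) \<Rightarrow> u x * w y * Q (z + c * x - y))
     \<le> norm (case p of (x, y) \<Rightarrow> B * (u x * w y))"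
    by (simp add: case_prod_beta)
qed

lemma period_integral_swap:
  fixes u w :: "real \<Rightarrow> real" and Q :: "real \<Rightarrow> real"
  assumes "integrable period_measure u" "integrable period_measure w"
    "Q \<in> borel_measurable borel" "\<And>t. \<bar>Q t\<bar> \<le> B"
  shows "(LINT x|period_measure. u x * (LINT y|period_measure. w y * Q (z + c * x - y)))
       = (LINT y|period_measure. w y * (LINT x|period_measure. u x * Q (z + c * x - y)))"
proof -
  have "(LINT x|period_measure. u x * (LINT y|period_measure. w y * Q (z + c * x - y)))
      = (LINT x|period_measure. LINT y|period_measure. u x * w y * Q (z + c * x - y))"
    by (simp add: mult.assoc)
  also have "\<dots> = (LINT y|period_measure. LINT x|period_measure. u x * w y * Q (z + c * x - y))"
    by (rule period_pair.Fubini_integral[OF integrable_period_pair[OF assms, of z c], symmetric])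
  also have "\<dots> = (LINT y|period_measure. w y * (LINT x|period_measure. u x * Q (z + c * x - y)))"
    by (simp add: mult.assoc mult.left_commute[of "u _"])
  finally show ?thesis .
qed

lemma borel_measurable_period_conv:
  fixes w :: "real \<Rightarrow> real" and Q :: "real \<Rightarrow> real"
  assumes w: "integrable period_measure w" and Q: "Q \<in> borel_measurable borel" "\<And>t. \<bar>Q t\<bar> \<le> B"
  shows "(\<lambda>x. LINT y|period_measure. w y * Q (x - y)) \<in> borel_measurable period_measure"
  using period_pair.integrable_fst[OF integrable_period_pair[OF integrable_period_bounded[of "\<lambda>_. 1" 1] w Q, of 0 1]]
  by simp

text \<open>Convolution with an integrable function smooths out countably many discontinuities: for
  a fixed limit point x they are hit only by a countable, hence null, set of t, where
  \<open>c \<noteq> 0\<close> allows solving for t. Elsewhere the integrands converge, and they are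
  dominated.\<close>

lemma continuous_period_conv:
  fixes u :: "real \<Rightarrow> real" and v :: "real \<Rightarrow> real"
  assumes u: "integrable period_measure u" and v: "v \<in> borel_measurable borel" "\<And>t. \<bar>v t\<bar> \<le> B"
    and C: "countable {t. \<not> isCont v t}" and c: "c \<noteq> 0"
  shows "isCont (\<lambda>x. LINT t|period_measure. u t * v (x + c * t)) x"
proof (rule continuous_at_sequentiallyI)
  fix s :: "nat \<Rightarrow> real" assume s: "s \<longlonglongrightarrow> x"
  show "(\<lambda>n. LINT t|period_measure. u t * v (s n + c * t)) \<longlonglongrightarrow> (LINT t|period_measure. u t * v (x + c * t))"
  proof (rule bounded_convergence_period[OF u, where B=B])
    have "(\<lambda>t. v (z + c * t)) \<in> borel_measurable borel" for z
      using v(1) by measurable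
    then show "(\<lambda>t. v (s n + c * t)) \<in> borel_measurable period_measure"
      "(\<lambda>t. v (x + c * t)) \<in> borel_measurable period_measure" for n
      by (blast intro: borel_measurable_period)+
    show "\<bar>v (s n + c * t)\<bar> \<le> B" for n t by (rule v)
    define N where "N = (\<lambda>t. (t - x) / c) ` {t. \<not> isCont v t}"
    have "N \<in> null_sets lebesgue"
      using C by (auto simp: N_def countable_imp_null_set_lborel intro!: null_sets_completionI)
    then have "AE t in lebesgue. t \<notin> N" by (rule AE_not_in)
    then have "AE t in period_measure. t \<notin> N" by (auto simp: AE_restrict_space_iff)
    then show "AE t in period_measure. (\<lambda>n. v (s n + c * t)) \<longlonglongrightarrow> v (x + c * t)"
    proof eventually_elim
      case (elim t)
      have "isCont v (x + c * t)"
      proof (rule ccontr)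
        assume "\<not> isCont v (x + c * t)"
        then have "(x + c * t - x) / c \<in> N" unfolding N_def by blast
        then show False using c elim by simp
      qed
      moreover have "(\<lambda>n. s n + c * t) \<longlonglongrightarrow> x + c * t" by (intro tendsto_intros s)
      ultimately show ?case by (metis isCont_tendsto_compose)
    qed
  qed
qed

section \<open>Kernels with the sign of a square wave\<close>

text \<open>Every neighbourhood of 0 meets the period in positive measure. This converts
  almost-everywhere information into a point close to 0, where continuity gives a
  contradiction.\<close>

lemma AE_period_near_0:
  assumes "AE x in period_measure. P x" "0 < d"
  shows "\<exists>x. \<bar>x\<bar> < d \<and> P x"
proof (rule ccontr)
  assume no: "\<not> (\<exists>x. \<bar>x\<bar> < d \<and> P x)"
  define e where "e = min d pi"
  have e: "0 < e" "e \<le> d" "e \<le> pi" using assms(2) by (auto simp: e_def)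
  have "AE x in lebesgue. x \<in> {-pi..pi} \<longrightarrow> P x"
    using assms(1) by (simp add: AE_restrict_space_iff)
  then have "AE x in lebesgue. x \<notin> {-e<..<e}"
    by eventually_elim (use no e in \<open>auto simp: abs_less_iff\<close>)
  then have "{-e<..<e} \<in> null_sets lebesgue"
    by (subst (asm) AE_iff_null_sets[symmetric]) auto
  then have "emeasure lebesgue {-e<..<e} = 0" by auto
  then show False using e by simp
qed

section \<open>Norms and the class of admissible functions\<close>

lemma Lp_norm_1_integrable:
  assumes "integrable period_measure w"
  shows "Lp_norm 1 w = ereal (LINT t|period_measure. \<bar>w t\<bar>)"
proof -
  have "(\<integral>\<^sup>+ t. ennreal \<bar>w t\<bar> \<partial>period_measure) = ennreal (LINT t|period_measure. \<bar>w t\<bar>)"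
    using assms by (intro nn_integral_eq_integral) auto
  moreover have "0 \<le> (LINT t|period_measure. \<bar>w t\<bar>)" by (intro Bochner_Integration.integral_nonneg) auto
  ultimately show ?thesis by (simp add: Lp_norm_def Let_def)
qed

lemma Lp_space_1_integrable:
  assumes "w \<in> Lp_space 1"
  shows "integrable period_measure w"
proof (rule integrableI_bounded)
  show "w \<in> borel_measurable period_measure"
    using assms by (auto simp: Lp_space_def intro: borel_measurable_lebesgue_period)
  have "Lp_norm 1 w < \<infinity>" using assms by (simp add: Lp_space_def)
  then show "(\<integral>\<^sup>+ t. ennreal (norm (w t)) \<partial>period_measure) < \<infinity>"
    by (auto simp: Lp_norm_def Let_def less_top split: if_splits)
qed

lemma Lp_norm_infinity_AE: "Lp_norm \<infinity> w \<le> ereal c \<Longrightarrow> AE t in period_measure. \<bar>w t\<bar> \<le> c"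
proof -
  assume "Lp_norm \<infinity> w \<le> ereal c"
  then have le: "esssup period_measure (\<lambda>t. ereal \<bar>w t\<bar>) \<le> ereal c" by (simp add: Lp_norm_def)
  have "AE t in period_measure. ereal \<bar>w t\<bar> \<le> esssup period_measure (\<lambda>t. ereal \<bar>w t\<bar>)"
    by (rule esssup_AE)
  then show ?thesis
    by eventually_elim (use le order_trans in fastforce)
qed

lemma Lp_norm_infinity_le:
  "w \<in> borel_measurable period_measure \<Longrightarrow> AE t in period_measure. \<bar>w t\<bar> \<le> c \<Longrightarrow> Lp_norm \<infinity> w \<le> ereal c"
  by (auto simp: Lp_norm_def intro!: esssup_I)

lemma fourier_coeff_0: "fourier_coeff \<phi> 0 = 1 / (2 * of_real pi) * of_real (LINT t|period_measure. \<phi> t)"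
  by (simp add: fourier_coeff_def)

lemma H1_classD:
  assumes "\<phi> \<in> H1_class p" "p = 1 \<or> p = \<infinity>"
  shows "integrable period_measure \<phi>" "\<phi> (x + 2 * pi) = \<phi> x" "(LINT t|period_measure. \<phi> t) = 0"
    "p = 1 \<Longrightarrow> (LINT t|period_measure. \<bar>\<phi> t\<bar>) \<le> 1"
    "p = \<infinity> \<Longrightarrow> AE t in period_measure. \<bar>\<phi> t\<bar> \<le> 1"
proof -
  have mem: "\<phi> \<in> Lp_space p" "Lp_norm p \<phi> \<le> 1" "fourier_coeff \<phi> 0 = 0"
    using assms(1) by (auto simp: H1_class_def)
  show inf: "AE t in period_measure. \<bar>\<phi> t\<bar> \<le> 1" if "p = \<infinity>"
    using mem(2) that by (intro Lp_norm_infinity_AE) (simp add: one_ereal_def)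
  show int: "integrable period_measure \<phi>"
  proof (cases "p = 1")
    case True then show ?thesis using mem by (simp add: Lp_space_1_integrable)
  next
    case False
    then have "AE t in period_measure. \<bar>\<phi> t\<bar> \<le> 1" using inf assms(2) by simp
    moreover have "\<phi> \<in> borel_measurable period_measure"
      using mem by (auto simp: Lp_space_def intro: borel_measurable_lebesgue_period)
    ultimately show ?thesis by (intro period.integrable_const_bound[where B=1]) auto
  qed
  show "\<phi> (x + 2 * pi) = \<phi> x" using mem by (simp add: Lp_space_def)
  show "(LINT t|period_measure. \<phi> t) = 0" using mem(3) by (simp add: fourier_coeff_0)
  show "(LINT t|period_measure. \<bar>\<phi> t\<bar>) \<le> 1" if "p = 1"
    using mem(2) that Lp_norm_1_integrable[OF int] by simp
qed

text \<open>Antiperiodicity with shift pi supplies periodicity and mean zero at once. The bound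
  \<open>B\<close> gives integrability, and for p = \<infinity> also the norm estimate.\<close>

lemma H1_classI_bounded:
  assumes meas: "\<phi> \<in> borel_measurable borel" and B: "\<And>t. \<bar>\<phi> t\<bar> \<le> B"
    and anti: "\<And>t. \<phi> (t + pi) = - \<phi> t"
    and p: "p = 1 \<and> (LINT t|period_measure. \<bar>\<phi> t\<bar>) \<le> 1 \<or> p = \<infinity> \<and> B \<le> 1"
  shows "\<phi> \<in> H1_class p"
proof -
  have m: "\<phi> \<in> borel_measurable period_measure" using meas by (rule borel_measurable_period)
  have int: "integrable period_measure \<phi>" using m B by (rule integrable_period_bounded)
  have "\<phi> (t + 2 * pi) = \<phi> t" for t using anti[of "t + pi"] anti[of t] by (simp add: algebra_simps)
  moreover have "\<phi> \<in> borel_measurable lebesgue" using meas by (simp add: measurable_completion)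
  moreover have "Lp_norm p \<phi> \<le> 1"
    using p
  proof (elim disjE conjE)
    assume "p = 1" "(LINT t|period_measure. \<bar>\<phi> t\<bar>) \<le> 1"
    then show ?thesis using Lp_norm_1_integrable[OF int] by simp
  next
    assume "p = \<infinity>" "B \<le> 1"
    moreover have "AE t in period_measure. \<bar>\<phi> t\<bar> \<le> 1" using B \<open>B \<le> 1\<close> order_trans by blast
    ultimately show ?thesis using Lp_norm_infinity_le[OF m, of 1] by (simp add: one_ereal_def)
  qed
  moreover from this have "Lp_norm p \<phi> < \<infinity>" by (metis ereal_infty_less(1) ereal_less_eq(1) linorder_not_less one_ereal_def order_trans PInfty_neq_ereal(1))
  moreover have "fourier_coeff \<phi> 0 = 0"
    using period_integral_antiperiodic[OF anti int] by (simp add: fourier_coeff_0)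
  ultimately show ?thesis by (simp add: H1_class_def Lp_space_def)
qed

section \<open>Upper and lower bounds for convolution with an extremal kernel\<close>

context
  fixes K v :: "real \<Rightarrow> real" and c B E :: real
  assumes K: "K \<in> borel_measurable borel" "\<And>t. \<bar>K t\<bar> \<le> B" "\<And>t. K (t + 2 * pi) = K t"
    and v: "v \<in> borel_measurable borel" "\<And>t. \<bar>v t\<bar> \<le> 1" "\<And>t. v (t + pi) = - v t"
      "countable {t. \<not> isCont v t}"
    and sign: "AE t in period_measure. \<bar>K t - c\<bar> = v t * (K t - c)"
    and E: "(LINT t|period_measure. K t * v t) = 2 * pi * E"
begin

lemma extremal_kernel_period: "v (t + 2 * pi) = v t"
  using v(3)[of "t + pi"] v(3)[of t] by (simp add: algebra_simps)

lemma extremal_kernel_integrable: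
  "integrable period_measure v" "integrable period_measure K"
  "integrable period_measure (\<lambda>t. K (x - t))" "integrable period_measure (\<lambda>t. K (t - x))"
  "integrable period_measure (\<lambda>t. K t - c)"
proof -
  show "integrable period_measure v"
    by (rule integrable_period_bounded[OF borel_measurable_period[OF v(1)] v(2)])
  have K_int: "integrable period_measure (\<lambda>t. K (f t))" if "f \<in> borel_measurable borel" for f
    by (rule integrable_period_bounded[OF borel_measurable_period K(2)])
       (rule measurable_compose[OF that K(1)])
  show "integrable period_measure K" using K_int[of "\<lambda>t. t"] by simp
  then show "integrable period_measure (\<lambda>t. K t - c)"
    by (intro Bochner_Integration.integrable_diff period.integrable_const)
  show "integrable period_measure (\<lambda>t. K (x - t))" "integrable period_measure (\<lambda>t. K (t - x))"
    by (rule K_int; measurable)+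
qed

text \<open>The sign pattern turns the modulus into \<open>v t * (K t - c)\<close>, and the
  antiperiodic \<open>v\<close> has mean zero, so \<open>c\<close> disappears. Only the upper bound
  rests on this; the lower bounds work with the integral of K v itself.\<close>

lemma extremal_kernel_abs: "(LINT t|period_measure. \<bar>K t - c\<bar>) = 2 * pi * E"
proof -
  have "(LINT t|period_measure. \<bar>K t - c\<bar>) = (LINT t|period_measure. K t * v t - c * v t)"
    using K(1) v(1) sign
    by (intro integral_cong_AE) (auto intro!: borel_measurable_period elim!: eventually_mono simp: algebra_simps)
  also have "\<dots> = (LINT t|period_measure. K t * v t) - (LINT t|period_measure. c * v t)"
    by (intro Bochner_Integration.integral_diff integrable_period_mult_bounded[OF _ _ v(2)])
       (auto intro: extremal_kernel_integrable borel_measurable_period v)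
  finally show ?thesis
    using E period_integral_antiperiodic[OF v(3) extremal_kernel_integrable(1)] by simp
qed

lemma extremal_kernel_abs_shift:
  "(LINT t|period_measure. \<bar>K (x - t) - c\<bar>) = 2 * pi * E"
  "(LINT t|period_measure. \<bar>K (t - x) - c\<bar>) = 2 * pi * E"
proof -
  have int: "integrable period_measure (\<lambda>t. \<bar>K t - c\<bar>)"
    using extremal_kernel_integrable(5) by simp
  show "(LINT t|period_measure. \<bar>K (x - t) - c\<bar>) = 2 * pi * E"
    using period_integral_reflect[OF _ int, of x] K(3) extremal_kernel_abs
    by (simp add: has_bochner_integral_iff)
  show "(LINT t|period_measure. \<bar>K (t - x) - c\<bar>) = 2 * pi * E"
    using period_integral_translate[OF _ int, of "- x"] K(3) extremal_kernel_abs
    by (simp add: has_bochner_integral_iff)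
qed

lemma extremal_conv_const:
  assumes "integrable period_measure \<phi>" "(LINT t|period_measure. \<phi> t) = 0"
  shows "(LINT y|period_measure. \<phi> y * (K (x - y) - c)) = (LINT y|period_measure. \<phi> y * K (x - y))"
proof -
  have "integrable period_measure (\<lambda>y. \<phi> y * K (x - y))"
    using assms(1) K by (intro integrable_period_mult_bounded[where B=B]) (auto intro!: borel_measurable_period)
  then show ?thesis using assms by (simp add: right_diff_distrib)
qed

text \<open>Since \<phi> has mean zero, \<open>c\<close> is subtracted from the kernel before
  absolute values are taken; otherwise the norm of K instead of that of K - c would appear. For p =
  \<infinity> the bound is then pointwise in x.\<close>

lemma extremal_upper:
  assumes \<phi>: "\<phi> \<in> H1_class p" and p: "p = 1 \<or> p = \<infinity>"
  shows "Lp_norm p (\<lambda>x. 1 / (2 * pi) * (LINT y|period_measure. \<phi> y * K (x - y))) \<le> ereal E"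
proof -
  note H = H1_classD[OF \<phi> p]
  define w where "w x = 1 / (2 * pi) * (LINT y|period_measure. \<phi> y * K (x - y))" for x
  have w_meas: "w \<in> borel_measurable period_measure"
    unfolding w_def using borel_measurable_period_conv[OF H(1) K(1,2)] by simp
  have w_c: "w x = 1 / (2 * pi) * (LINT y|period_measure. \<phi> y * (K (x - y) - c))" for x
    using extremal_conv_const[OF H(1,3)] by (simp add: w_def)
  have Kc: "(\<lambda>t. K t - c) \<in> borel_measurable borel" "\<bar>K t - c\<bar> \<le> B + \<bar>c\<bar>" for t
    using K(1) K(2)[of t] by auto
  have int: "integrable period_measure (\<lambda>y. \<phi> y * (K (x - y) - c))" for x
    using H(1) K(1) Kc(2) by (intro integrable_period_mult_bounded[where B="B + \<bar>c\<bar>"]) (auto intro!: borel_measurable_period)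
  from p have "Lp_norm p w \<le> ereal E"
  proof
    assume "p = \<infinity>"
    have "\<bar>w x\<bar> \<le> E" for x
    proof -
      have "\<bar>LINT y|period_measure. \<phi> y * (K (x - y) - c)\<bar> \<le> (LINT y|period_measure. \<bar>\<phi> y * (K (x - y) - c)\<bar>)"
        by (rule integral_abs_bound)
      also have "\<dots> \<le> (LINT y|period_measure. \<bar>K (x - y) - c\<bar>)"
      proof (rule integral_mono_AE)
        show "integrable period_measure (\<lambda>y. \<bar>\<phi> y * (K (x - y) - c)\<bar>)" using int by simp
        show "integrable period_measure (\<lambda>y. \<bar>K (x - y) - c\<bar>)" using extremal_kernel_integrable(3) by simp
        show "AE y in period_measure. \<bar>\<phi> y * (K (x - y) - c)\<bar> \<le> \<bar>K (x - y) - c\<bar>"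
          using H(5)[OF \<open>p = \<infinity>\<close>] by eventually_elim (simp add: abs_mult mult_left_le_one_le)
      qed
      finally show ?thesis using extremal_kernel_abs_shift(1)[of x] by (simp add: w_c abs_mult field_simps)
    qed
    then show ?thesis using \<open>p = \<infinity>\<close> by (auto intro!: Lp_norm_infinity_le w_meas)
  next
    assume "p = 1"
    have "\<bar>w x\<bar> \<le> 1 / (2 * pi) * (\<bar>B\<bar> * (LINT y|period_measure. \<bar>\<phi> y\<bar>))" for x
    proof -
      have "\<bar>LINT y|period_measure. \<phi> y * K (x - y)\<bar> \<le> (LINT y|period_measure. \<bar>\<phi> y * K (x - y)\<bar>)"
        by (rule integral_abs_bound)
      also have "\<dots> \<le> (LINT y|period_measure. \<bar>B\<bar> * \<bar>\<phi> y\<bar>)"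
      proof (rule integral_mono)
        show "integrable period_measure (\<lambda>y. \<bar>\<phi> y * K (x - y)\<bar>)"
          using H(1) K by (intro integrable_abs integrable_period_mult_bounded[where B=B]) (auto intro!: borel_measurable_period)
        show "integrable period_measure (\<lambda>y. \<bar>B\<bar> * \<bar>\<phi> y\<bar>)" using H(1) by simp
        show "\<bar>\<phi> y * K (x - y)\<bar> \<le> \<bar>B\<bar> * \<bar>\<phi> y\<bar>" for y
          using mult_right_mono[OF order_trans[OF K(2)[of "x - y"] abs_ge_self], of "\<bar>\<phi> y\<bar>"]
          by (simp add: abs_mult mult.commute)
      qed
      finally show ?thesis unfolding w_def by (simp add: abs_mult divide_right_mono)
    qed
    then have w_int: "integrable period_measure w" by (rule integrable_period_bounded[OF w_meas])
    \<comment> \<open>Duality for p = 1: testing \<open>w\<close> with its own sign makes the norm a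
      double integral, and after Fubini the inner integral in x is at most 2 pi E for every
      y.\<close>
    define s where "s x = sgn (w x)" for x
    have s_meas: "s \<in> borel_measurable period_measure" unfolding s_def using w_meas by measurable
    have s1: "\<bar>s x\<bar> \<le> 1" for x by (simp add: s_def sgn_real_def)
    have s_int: "integrable period_measure s" by (rule integrable_period_bounded[OF s_meas s1])
    have "(LINT x|period_measure. \<bar>w x\<bar>) = (LINT x|period_measure. s x * w x)"
      by (simp add: s_def abs_sgn mult.commute)
    also have "\<dots> = 1 / (2 * pi) * (LINT x|period_measure. s x * (LINT y|period_measure. \<phi> y * (K (x - y) - c)))"
      by (simp add: w_c)
    also have "(LINT x|period_measure. s x * (LINT y|period_measure. \<phi> y * (K (x - y) - c)))
        = (LINT y|period_measure. \<phi> y * (LINT x|period_measure. s x * (K (x - y) - c)))"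
      using period_integral_swap[OF s_int H(1) Kc, of 0 1] by simp
    also have "\<dots> \<le> (LINT y|period_measure. \<bar>\<phi> y\<bar> * (2 * pi * E))"
    proof (rule integral_mono')
      show "integrable period_measure (\<lambda>y. \<bar>\<phi> y\<bar> * (2 * pi * E))" using H(1) by simp
      have E0: "0 \<le> 2 * pi * E" unfolding extremal_kernel_abs[symmetric] by (rule Bochner_Integration.integral_nonneg) simp
      show "0 \<le> \<bar>\<phi> y\<bar> * (2 * pi * E)" for y using E0 by simp
      fix y
      have "\<bar>LINT x|period_measure. s x * (K (x - y) - c)\<bar> \<le> (LINT x|period_measure. \<bar>s x * (K (x - y) - c)\<bar>)"
        by (rule integral_abs_bound)
      also have "\<dots> \<le> (LINT x|period_measure. \<bar>K (x - y) - c\<bar>)"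
      proof (rule integral_mono)
        show "integrable period_measure (\<lambda>x. \<bar>s x * (K (x - y) - c)\<bar>)"
          using s_int K(1) Kc(2) by (intro integrable_abs integrable_period_mult_bounded[where B="B + \<bar>c\<bar>"]) (auto intro!: borel_measurable_period)
        show "integrable period_measure (\<lambda>x. \<bar>K (x - y) - c\<bar>)" using extremal_kernel_integrable(4) by simp
        show "\<bar>s x * (K (x - y) - c)\<bar> \<le> \<bar>K (x - y) - c\<bar>" for x
          using s1[of x] by (simp add: abs_mult mult_left_le_one_le)
      qed
      finally have "\<bar>LINT x|period_measure. s x * (K (x - y) - c)\<bar> \<le> 2 * pi * E"
        by (simp add: extremal_kernel_abs_shift)
      then have "\<bar>\<phi> y * (LINT x|period_measure. s x * (K (x - y) - c))\<bar> \<le> \<bar>\<phi> y\<bar> * (2 * pi * E)"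
        unfolding abs_mult by (rule mult_left_mono) simp
      then show "\<phi> y * (LINT x|period_measure. s x * (K (x - y) - c)) \<le> \<bar>\<phi> y\<bar> * (2 * pi * E)" by linarith
    qed
    also have "\<dots> = 2 * pi * E * (LINT y|period_measure. \<bar>\<phi> y\<bar>)" by simp
    also have "\<dots> \<le> 2 * pi * E * 1"
    proof (intro mult_left_mono H(4) \<open>p = 1\<close>)
      show "0 \<le> 2 * pi * E" unfolding extremal_kernel_abs[symmetric] by (rule Bochner_Integration.integral_nonneg) simp
    qed
    finally show ?thesis
      using \<open>p = 1\<close> by (simp add: Lp_norm_1_integrable[OF w_int] field_simps)
  qed
  then show ?thesis unfolding w_def .
qed

lemma extremal_conv_continuous:
  "isCont (\<lambda>y. LINT t|period_measure. K t * v (y + t)) y"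
  using continuous_period_conv[OF extremal_kernel_integrable(2) v(1,2,4), of 1] by simp

lemma extremal_kernel_mult_integrable: "integrable period_measure (\<lambda>t. K t * v (y + t))"
  by (rule integrable_period_mult_bounded[OF extremal_kernel_integrable(2) borel_measurable_period v(2)])
     (use v(1) in measurable)

text \<open>The convolution of v(-t) with K takes the value E at the single point 0. An essential
  supremum does not see one point, so continuity at 0 is used to find nearby values close to E on a
  set of positive measure.\<close>

lemma extremal_lower_infinity:
  "\<exists>\<phi>\<in>H1_class \<infinity>. ereal E \<le> Lp_norm \<infinity> (\<lambda>x. 1 / (2 * pi) * (LINT y|period_measure. \<phi> y * K (x - y)))"
proof
  have anti: "v (- (t + pi)) = - v (- t)" for t using v(3)[of "- t - pi"] by simp
  show \<phi>: "(\<lambda>t. v (- t)) \<in> H1_class \<infinity>"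
    by (rule H1_classI_bounded[where B=1]) (use v anti in auto)
  define V where "V y = (LINT t|period_measure. K t * v (y + t))" for y
  define w where "w x = 1 / (2 * pi) * (LINT y|period_measure. v (- y) * K (x - y))" for x
  have w: "w x = 1 / (2 * pi) * V (- x)" for x
  proof -
    have "K (t + 2 * pi) * v (- x + (t + 2 * pi)) = K t * v (- x + t)" for t
      using K(3) extremal_kernel_period[of "- x + t"] by (simp add: algebra_simps)
    from period_integral_reflect[OF this extremal_kernel_mult_integrable, of x]
    show ?thesis by (simp add: w_def V_def has_bochner_integral_iff mult.commute)
  qed
  have "isCont V (- 0)" using extremal_conv_continuous[of "- 0"] unfolding V_def .
  from isCont_o2[OF isCont_minus[OF continuous_ident] this] have "isCont (\<lambda>x. V (- x)) 0" .
  then have "isCont (\<lambda>x. 1 / (2 * pi) * V (- x)) 0" by (intro continuous_intros)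
  then have "isCont w 0" using w by presburger
  moreover have "w 0 = E" using E by (simp add: w V_def)
  ultimately have lim: "((\<lambda>x. ereal \<bar>w x\<bar>) \<longlongrightarrow> ereal \<bar>E\<bar>) (at 0)"
    by (intro tendsto_intros) (auto simp: isCont_def)
  have "ereal E \<le> Lp_norm \<infinity> w"
  proof (rule ccontr)
    assume "\<not> ?thesis"
    then have less: "esssup period_measure (\<lambda>t. ereal \<bar>w t\<bar>) < ereal \<bar>E\<bar>"
      by (simp add: Lp_norm_def not_le) (meson abs_ge_self ereal_less_eq(3) less_le_trans)
    from order_tendstoD(1)[OF lim this]
    obtain d where d: "0 < d" "\<And>x. x \<noteq> 0 \<Longrightarrow> \<bar>x\<bar> < d \<Longrightarrow> esssup period_measure (\<lambda>t. ereal \<bar>w t\<bar>) < ereal \<bar>w x\<bar>"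
      by (auto simp: eventually_at dist_real_def)
    have "AE x in period_measure. ereal \<bar>w x\<bar> \<le> esssup period_measure (\<lambda>t. ereal \<bar>w t\<bar>)"
      by (rule esssup_AE)
    from AE_period_near_0[OF this d(1)] obtain x where "\<bar>x\<bar> < d"
      "ereal \<bar>w x\<bar> \<le> esssup period_measure (\<lambda>t. ereal \<bar>w t\<bar>)" by blast
    moreover have "esssup period_measure (\<lambda>t. ereal \<bar>w t\<bar>) < ereal \<bar>w x\<bar>"
      using d(2)[of x] less \<open>\<bar>x\<bar> < d\<close> \<open>w 0 = E\<close> by (cases "x = 0") auto
    ultimately show False by simp
  qed
  then show "ereal E \<le> Lp_norm \<infinity> (\<lambda>x. 1 / (2 * pi) * (LINT y|period_measure. v (- y) * K (x - y)))"
    unfolding w_def .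
qed

text \<open>Tested against \<open>v\<close>, the norm of the convolution is bounded below through
  the integral of \<phi> V, where V(y) is the integral of K(t) v(y + t). Since V(0) = 2 pi E and V(y
  + pi) = - V(y), mass of opposite signs near 0 and near pi contributes in the same direction, while
  the mean stays zero.\<close>

lemma extremal_lower_1:
  assumes "0 < \<tau>"
  shows "\<exists>\<phi>\<in>H1_class 1. ereal (E - \<tau>) \<le> Lp_norm 1 (\<lambda>x. 1 / (2 * pi) * (LINT y|period_measure. \<phi> y * K (x - y)))"
proof -
  define V where "V y = (LINT t|period_measure. K t * v (y + t))" for y
  have V0: "V 0 = 2 * pi * E" using E by (simp add: V_def)
  have V_anti: "V (y + pi) = - V y" for y
  proof -
    have "v (y + pi + t) = - v (y + t)" for t using v(3)[of "y + t"] by (simp add: algebra_simps)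
    then show ?thesis by (simp add: V_def)
  qed
  then have V_per: "V (y + 2 * pi) = V y" for y
    using V_anti[of "y + pi"] V_anti[of y] by (simp add: algebra_simps)
  have "isCont V 0" using extremal_conv_continuous[of 0] unfolding V_def .
  then have "eventually (\<lambda>y. V 0 - 2 * pi * \<tau> < V y) (nhds 0)"
    using assms by (intro order_tendstoD(1)[where y="V 0"]) (auto simp: isCont_def tendsto_at_iff_tendsto_nhds)
  then obtain d0 where d0: "0 < d0" "\<And>y. \<bar>y\<bar> < d0 \<Longrightarrow> V 0 - 2 * pi * \<tau> < V y"
    by (auto simp: eventually_nhds_metric dist_real_def)
  \<comment> \<open>The cap pi / 4 keeps d below pi / 2, where sine is increasing, so that
    comparisons of sines give comparisons of arguments.\<close>
  define d where "d = min d0 (pi / 4)"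
  have d: "0 < d" "d < pi / 2" "\<And>y. \<bar>y\<bar> < d \<Longrightarrow> V 0 - 2 * pi * \<tau> < V y"
    using d0 pi_gt_zero unfolding d_def by (auto, linarith)
  \<comment> \<open>bumps of opposite sign near $0$ and near $\pi$\<close>
  define \<phi>0 where "\<phi>0 y = (if \<bar>sin y\<bar> < sin d then sgn (cos y) else 0)" for y
  have \<phi>0_meas: "\<phi>0 \<in> borel_measurable borel" unfolding \<phi>0_def by measurable
  have \<phi>0_1: "\<bar>\<phi>0 y\<bar> \<le> 1" for y by (simp add: \<phi>0_def sgn_real_def)
  have \<phi>0_anti: "\<phi>0 (y + pi) = - \<phi>0 y" for y by (simp add: \<phi>0_def sgn_minus)
  \<comment> \<open>The two conditions say that y lies within d of a multiple of 2 pi; the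
    representative near 0 is the arcsine of sin y. Describing the bump by sine and cosine makes its
    antiperiodicity immediate.\<close>
  have pos: "V 0 - 2 * pi * \<tau> \<le> V y" if "\<bar>sin y\<bar> < sin d" "0 < cos y" for y
  proof -
    define y' where "y' = arcsin (sin y)"
    have y': "- (pi / 2) \<le> y'" "y' \<le> pi / 2" "sin y' = sin y"
        unfolding y'_def using arcsin[of "sin y"] by simp_all
    have "sin y' < sin d" "sin (- d) < sin y'" using that y' by auto
    then have "y' < d" "- d < y'"
      using sin_mono_less_eq[of y' d] sin_mono_less_eq[of "- d" y'] y' d by auto
    have "cos y' = cos y"
    proof -
      have "0 \<le> cos y'" using y' by (intro cos_ge_zero) auto
      moreover have "(cos y')\<^sup>2 = (cos y)\<^sup>2" using y' by (simp add: cos_squared_eq)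
      ultimately show ?thesis using that by (simp add: power2_eq_iff_nonneg)
    qed
    with y'(3) obtain n where "y = y' + 2 * pi * of_int n"
      using sin_cos_eq_iff[of y y'] by auto
    then have "V y = V y'" using periodic_add_int[of V y' n] V_per by simp
    then show ?thesis using d(3)[of y'] \<open>y' < d\<close> \<open>- d < y'\<close> by (simp add: abs_less_iff)
  qed
  have \<phi>0_V: "\<bar>\<phi>0 y\<bar> * (V 0 - 2 * pi * \<tau>) \<le> \<phi>0 y * V y" for y
  proof (cases "\<bar>sin y\<bar> < sin d")
    case True
    consider "0 < cos y" | "cos y < 0" | "cos y = 0" by linarith
    then show ?thesis
    proof cases
      case 1 then show ?thesis using pos[OF True] True by (simp add: \<phi>0_def)
    next
      case 2
      then have "V 0 - 2 * pi * \<tau> \<le> V (y + pi)" using True by (intro pos) auto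
      then show ?thesis using True 2 V_anti[of y] by (simp add: \<phi>0_def)
    qed (simp add: \<phi>0_def)
  qed (simp add: \<phi>0_def)
  have \<phi>0_int: "integrable period_measure \<phi>0"
    by (rule integrable_period_bounded[OF borel_measurable_period[OF \<phi>0_meas] \<phi>0_1])
  define D where "D = (LINT y|period_measure. \<bar>\<phi>0 y\<bar>)"
  have "0 < D"
  proof -
    have "0 \<le> D" unfolding D_def by (intro Bochner_Integration.integral_nonneg) auto
    moreover have "D \<noteq> 0"
    proof
      assume "D = 0"
      then have "AE y in period_measure. \<phi>0 y = 0"
        using \<phi>0_int unfolding D_def by (subst (asm) integral_nonneg_eq_0_iff_AE) auto
      from AE_period_near_0[OF this d(1)] obtain y where y: "\<bar>y\<bar> < d" "\<phi>0 y = 0" by blast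
      have "sin y < sin d" "sin (- d) < sin y"
        using sin_monotone_2pi[of y d] sin_monotone_2pi[of "- d" y] y d by (auto simp: abs_less_iff)
      moreover have "0 < cos y" using y d by (intro cos_gt_zero_pi) auto
      ultimately show False using y(2) by (auto simp: \<phi>0_def abs_less_iff)
    qed
    ultimately show ?thesis by simp
  qed
  define \<phi> where "\<phi> y = \<phi>0 y / D" for y
  have \<phi>_H: "\<phi> \<in> H1_class 1"
  proof (rule H1_classI_bounded[where B="1 / D"])
    show "\<phi> \<in> borel_measurable borel" unfolding \<phi>_def using \<phi>0_meas by measurable
    show "\<bar>\<phi> t\<bar> \<le> 1 / D" for t using \<phi>0_1[of t] \<open>0 < D\<close> by (simp add: \<phi>_def abs_divide divide_right_mono)
    show "\<phi> (t + pi) = - \<phi> t" for t by (simp add: \<phi>_def \<phi>0_anti)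
    show "(1::ereal) = 1 \<and> (LINT t|period_measure. \<bar>\<phi> t\<bar>) \<le> 1 \<or> (1::ereal) = \<infinity> \<and> 1 / D \<le> 1"
      using \<open>0 < D\<close> by (simp add: \<phi>_def D_def abs_divide)
  qed
  have \<phi>_int: "integrable period_measure \<phi>" using \<phi>0_int unfolding \<phi>_def by simp
  define w where "w x = 1 / (2 * pi) * (LINT y|period_measure. \<phi> y * K (x - y))" for x
  have "\<bar>w x\<bar> \<le> 1 / (2 * pi) * (\<bar>B\<bar> * (LINT y|period_measure. \<bar>\<phi> y\<bar>))" for x
  proof -
    have "\<bar>LINT y|period_measure. \<phi> y * K (x - y)\<bar> \<le> (LINT y|period_measure. \<bar>\<phi> y * K (x - y)\<bar>)"
      by (rule integral_abs_bound)
    also have "\<dots> \<le> (LINT y|period_measure. \<bar>B\<bar> * \<bar>\<phi> y\<bar>)"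
    proof (rule integral_mono)
      show "integrable period_measure (\<lambda>y. \<bar>\<phi> y * K (x - y)\<bar>)"
        using \<phi>_int K by (intro integrable_abs integrable_period_mult_bounded[where B=B]) (auto intro!: borel_measurable_period)
      show "integrable period_measure (\<lambda>y. \<bar>B\<bar> * \<bar>\<phi> y\<bar>)" using \<phi>_int by simp
      show "\<bar>\<phi> y * K (x - y)\<bar> \<le> \<bar>B\<bar> * \<bar>\<phi> y\<bar>" for y
        using mult_right_mono[OF order_trans[OF K(2)[of "x - y"] abs_ge_self], of "\<bar>\<phi> y\<bar>"]
        by (simp add: abs_mult mult.commute)
    qed
    finally show ?thesis unfolding w_def by (simp add: abs_mult divide_right_mono)
  qed
  moreover have w_meas: "w \<in> borel_measurable period_measure"
    unfolding w_def using borel_measurable_period_conv[OF \<phi>_int K(1,2)] by simp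
  ultimately have w_int: "integrable period_measure w" by (intro integrable_period_bounded)
  have V_eq: "(LINT x|period_measure. v x * K (x - y)) = V y" for y
  proof -
    have "K (t + 2 * pi) * v (y + (t + 2 * pi)) = K t * v (y + t)" for t
      using K(3) extremal_kernel_period[of "y + t"] by (simp add: algebra_simps)
    from period_integral_translate[OF this extremal_kernel_mult_integrable, of "- y"]
    show ?thesis by (simp add: V_def has_bochner_integral_iff mult.commute)
  qed
  have "(LINT y|period_measure. \<bar>\<phi> y\<bar>) = 1"
    using \<open>0 < D\<close> by (simp add: \<phi>_def D_def[symmetric] abs_divide)
  then have "2 * pi * (E - \<tau>) = (LINT y|period_measure. \<bar>\<phi> y\<bar> * (V 0 - 2 * pi * \<tau>))"
    by (simp add: V0 right_diff_distrib[of "2 * pi" E])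
  also have "\<dots> \<le> (LINT y|period_measure. \<phi> y * V y)"
  proof (rule integral_mono)
    show "integrable period_measure (\<lambda>y. \<bar>\<phi> y\<bar> * (V 0 - 2 * pi * \<tau>))" using \<phi>_int by simp
    have "\<bar>V y\<bar> \<le> (LINT t|period_measure. \<bar>K t\<bar>)" for y
    proof -
      have "\<bar>V y\<bar> \<le> (LINT t|period_measure. \<bar>K t * v (y + t)\<bar>)"
        unfolding V_def by (rule integral_abs_bound)
      also have "\<dots> \<le> (LINT t|period_measure. \<bar>K t\<bar>)"
        using v(2) by (intro integral_mono integrable_abs extremal_kernel_mult_integrable extremal_kernel_integrable(2))
          (simp add: abs_mult mult_left_le)
      finally show ?thesis .
    qed
    moreover have "V \<in> borel_measurable borel"
      using extremal_conv_continuous unfolding V_def by (intro borel_measurable_continuous_onI continuous_at_imp_continuous_on) blast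
    ultimately show "integrable period_measure (\<lambda>y. \<phi> y * V y)"
      by (intro integrable_period_mult_bounded \<phi>_int borel_measurable_period)
    show "\<bar>\<phi> y\<bar> * (V 0 - 2 * pi * \<tau>) \<le> \<phi> y * V y" for y
      using \<phi>0_V[of y] \<open>0 < D\<close> by (simp add: \<phi>_def abs_divide divide_right_mono)
  qed
  also have "\<dots> = (LINT x|period_measure. v x * (LINT y|period_measure. \<phi> y * K (x - y)))"
    using period_integral_swap[OF extremal_kernel_integrable(1) \<phi>_int K(1,2), of 0 1] V_eq by simp
  also have "\<dots> = 2 * pi * (LINT x|period_measure. v x * w x)" by (simp add: w_def)
  also have "\<dots> \<le> 2 * pi * (LINT x|period_measure. \<bar>w x\<bar>)"
  proof (intro mult_left_mono integral_mono)
    show "integrable period_measure (\<lambda>x. v x * w x)"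
      using integrable_period_mult_bounded[OF w_int borel_measurable_period[OF v(1)] v(2)] by (simp add: mult.commute)
    show "integrable period_measure (\<lambda>x. \<bar>w x\<bar>)" using w_int by simp
    fix x
    have "\<bar>v x * w x\<bar> \<le> \<bar>w x\<bar>" using v(2)[of x] by (simp add: abs_mult mult_left_le_one_le)
    then show "v x * w x \<le> \<bar>w x\<bar>" by linarith
  qed simp
  finally have "E - \<tau> \<le> (LINT x|period_measure. \<bar>w x\<bar>)" by simp
  then have "ereal (E - \<tau>) \<le> Lp_norm 1 w" by (simp add: Lp_norm_1_integrable[OF w_int])
  then show ?thesis using \<phi>_H unfolding w_def by blast
qed

lemma extremal_SUP:
  assumes p: "p = 1 \<or> p = \<infinity>"
  shows "(SUP \<phi>\<in>H1_class p. Lp_norm p (\<lambda>x. 1 / (2 * pi) * (LINT y|period_measure. \<phi> y * K (x - y)))) = ereal E"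
    (is "?S = _")
proof (rule antisym)
  show "?S \<le> ereal E" using extremal_upper p by (intro SUP_least)
  from p show "ereal E \<le> ?S"
  proof
    assume "p = \<infinity>"
    then show ?thesis using extremal_lower_infinity by (auto intro: SUP_upper2)
  next
    assume "p = 1"
    show ?thesis
    proof (rule ereal_le_epsilon2)
      fix e :: real assume "0 < e"
      from extremal_lower_1[OF this] have "ereal (E - e) \<le> ?S"
        using \<open>p = 1\<close> by (auto intro: SUP_upper2)
      then have "ereal (E - e) + ereal e \<le> ?S + ereal e" by (rule add_right_mono)
      then show "ereal E \<le> ?S + ereal e" by simp
    qed
  qed
qed

end

section \<open>The kernel of the approximation error\<close>

lemma fourier_coeff_real:
  assumes g: "integrable period_measure g" and c: "fourier_coeff g (int k) = of_real c"
  shows "(LINT t|period_measure. g t * cos (real k * t)) = 2 * pi * c"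
    and "(LINT t|period_measure. g t * sin (real k * t)) = 0"
proof -
  have ic: "integrable period_measure (\<lambda>t. g t * cos (real k * t))"
    and isn: "integrable period_measure (\<lambda>t. g t * sin (real k * t))"
    by (auto intro!: integrable_period_mult_bounded[OF g, where B=1] borel_measurable_period)
  have "(\<lambda>t. of_real (g t) * exp (- (\<i> * of_int (int k) * of_real t)))
      = (\<lambda>t. complex_of_real (g t * cos (real k * t)) - \<i> * complex_of_real (g t * sin (real k * t)))"
  proof
    fix t
    have "- (\<i> * of_int (int k) * of_real t) = \<i> * of_real (- (real k * t))" by simp
    then show "of_real (g t) * exp (- (\<i> * of_int (int k) * of_real t))
      = complex_of_real (g t * cos (real k * t)) - \<i> * complex_of_real (g t * sin (real k * t))"
      by (simp only: cis_conv_exp[symmetric]) (simp add: complex_eq_iff)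
  qed
  then have "(LINT t|period_measure. of_real (g t) * exp (- (\<i> * of_int (int k) * of_real t)))
     = (LINT t|period_measure. complex_of_real (g t * cos (real k * t)) - \<i> * complex_of_real (g t * sin (real k * t)))"
    by simp
  also have "\<dots> = (LINT t|period_measure. complex_of_real (g t * cos (real k * t)))
      - (LINT t|period_measure. \<i> * complex_of_real (g t * sin (real k * t)))"
    by (intro Bochner_Integration.integral_diff integrable_mult_right integrable_of_real ic isn)
  also have "\<dots> = of_real (LINT t|period_measure. g t * cos (real k * t))
      - \<i> * of_real (LINT t|period_measure. g t * sin (real k * t))"
    by (simp only: integral_mult_right_zero integral_complex_of_real)
  finally have "of_real (LINT t|period_measure. g t * cos (real k * t))
      - \<i> * of_real (LINT t|period_measure. g t * sin (real k * t)) = 2 * of_real pi * (of_real c :: complex)"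
    using c by (simp add: fourier_coeff_def field_simps)
  then show "(LINT t|period_measure. g t * cos (real k * t)) = 2 * pi * c"
    "(LINT t|period_measure. g t * sin (real k * t)) = 0"
    by (simp_all add: complex_eq_iff)
qed

text \<open>Because the coefficient is real, the sine integral of \<open>g\<close> vanishes, so
  convolution with \<open>g\<close> rescales a cosine of any phase without turning it.\<close>

lemma fourier_coeff_cos_shift:
  assumes g: "integrable period_measure g" and c: "fourier_coeff g (int k) = of_real c"
  shows "(LINT s|period_measure. g s * cos (real k * (x - s) - \<theta>)) = 2 * pi * (c * cos (real k * x - \<theta>))"
proof -
  have ic: "integrable period_measure (\<lambda>t. g t * cos (real k * t))"
    and isn: "integrable period_measure (\<lambda>t. g t * sin (real k * t))"
    by (auto intro!: integrable_period_mult_bounded[OF g, where B=1] borel_measurable_period)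
  have "g s * cos (real k * (x - s) - \<theta>)
      = cos (real k * x - \<theta>) * (g s * cos (real k * s)) + sin (real k * x - \<theta>) * (g s * sin (real k * s))" for s
  proof -
    have "real k * (x - s) - \<theta> = (real k * x - \<theta>) - real k * s" by (simp add: algebra_simps)
    then have "cos (real k * (x - s) - \<theta>)
        = cos (real k * x - \<theta>) * cos (real k * s) + sin (real k * x - \<theta>) * sin (real k * s)"
      by (simp only: cos_diff[of "real k * x - \<theta>"])
    then show ?thesis by (simp only: distrib_left mult.left_commute)
  qed
  then have "(LINT s|period_measure. g s * cos (real k * (x - s) - \<theta>))
    = cos (real k * x - \<theta>) * (LINT s|period_measure. g s * cos (real k * s))
      + sin (real k * x - \<theta>) * (LINT s|period_measure. g s * sin (real k * s))"
    using ic isn by simp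
  then show ?thesis using fourier_coeff_real[OF assms] by simp
qed

text \<open>Pointwise convergence with uniformly bounded partial sums is weaker than absolute
  convergence of the coefficients and admits the sawtooth. Indices are shifted by one:
  \<open>a k\<close> and \<open>F k\<close> belong to the frequency \<open>Suc k\<close>.\<close>

locale bounded_trig_kernel =
  fixes g \<psi> :: "real \<Rightarrow> real" and F a :: "nat \<Rightarrow> real" and \<theta> M :: real
  assumes g: "integrable period_measure g"
    and F: "\<And>k. fourier_coeff g (int (Suc k)) = of_real (F k)"
    and lim: "\<And>t. (\<lambda>n. \<Sum>k<n. a k * cos (real (Suc k) * t - \<theta>)) \<longlonglongrightarrow> \<psi> t"
    and bound: "\<And>n t. \<bar>\<Sum>k<n. a k * cos (real (Suc k) * t - \<theta>)\<bar> \<le> M"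
begin

definition error_kernel :: "real \<Rightarrow> real" where
  "error_kernel t = \<psi> t - 1 / (2 * pi) * (LINT s|period_measure. g s * \<psi> (t - s))"

lemma kernel_borel: "\<psi> \<in> borel_measurable borel"
  by (rule borel_measurable_LIMSEQ_real[OF lim]) simp

lemma kernel_bound: "\<bar>\<psi> t\<bar> \<le> M"
proof (rule LIMSEQ_le_const2)
  show "(\<lambda>n. \<bar>\<Sum>k<n. a k * cos (real (Suc k) * t - \<theta>)\<bar>) \<longlonglongrightarrow> \<bar>\<psi> t\<bar>"
    by (intro tendsto_intros lim)
qed (use bound in auto)

lemma cos_Suc_periodic: "cos (real (Suc k) * (t + 2 * pi) - \<theta>) = cos (real (Suc k) * t - \<theta>)"
proof -
  have eq: "real (Suc k) * (t + 2 * pi) - \<theta> = (real (Suc k) * t - \<theta>) + 2 * pi * real (Suc k)" by (simp add: algebra_simps)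
  show ?thesis unfolding eq using periodic_add_int[of cos "real (Suc k) * t - \<theta>" "int (Suc k)"] by (simp del: of_nat_Suc)
qed

lemma kernel_periodic: "\<psi> (t + 2 * pi) = \<psi> t"
  using lim[of "t + 2 * pi"] lim[of t] unfolding cos_Suc_periodic by (rule LIMSEQ_unique)

lemma error_kernel_partial:
  "(\<Sum>k<n. a k * (1 - F k) * cos (real (Suc k) * t - \<theta>))
    = (\<Sum>k<n. a k * cos (real (Suc k) * t - \<theta>))
      - 1 / (2 * pi) * (LINT s|period_measure. g s * (\<Sum>k<n. a k * cos (real (Suc k) * (t - s) - \<theta>)))"
proof -
  have "(LINT s|period_measure. g s * (\<Sum>k<n. a k * cos (real (Suc k) * (t - s) - \<theta>)))
      = (LINT s|period_measure. (\<Sum>k<n. a k * (g s * cos (real (Suc k) * (t - s) - \<theta>))))"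
    by (simp only: sum_distrib_left mult.left_commute[of "g _"])
  also have "\<dots> = (\<Sum>k<n. (LINT s|period_measure. a k * (g s * cos (real (Suc k) * (t - s) - \<theta>))))"
    by (intro Bochner_Integration.integral_sum integrable_mult_right integrable_period_mult_bounded[OF g, where B=1] borel_measurable_period)
       auto
  also have "\<dots> = (\<Sum>k<n. a k * (2 * pi * (F k * cos (real (Suc k) * t - \<theta>))))"
    by (simp only: fourier_coeff_cos_shift[OF g F] integral_mult_right_zero)
  also have "1 / (2 * pi) * \<dots> = (\<Sum>k<n. a k * F k * cos (real (Suc k) * t - \<theta>))"
    by (simp add: sum_distrib_left mult_ac del: of_nat_Suc)
  finally show ?thesis by (simp add: right_diff_distrib left_diff_distrib sum_subtractf mult.assoc del: of_nat_Suc)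
qed

lemma error_kernel_lim:
  "(\<lambda>n. \<Sum>k<n. a k * (1 - F k) * cos (real (Suc k) * t - \<theta>)) \<longlonglongrightarrow> error_kernel t"
  unfolding error_kernel_partial error_kernel_def
proof (intro tendsto_intros lim bounded_convergence_period[OF g, where B=M])
  show "(\<lambda>s. \<Sum>k<n. a k * cos (real (Suc k) * (t - s) - \<theta>)) \<in> borel_measurable period_measure" for n
    by (rule borel_measurable_period) simp
  show "(\<lambda>s. \<psi> (t - s)) \<in> borel_measurable period_measure"
    by (rule borel_measurable_period, rule measurable_compose[OF _ kernel_borel]) simp
  show "AE s in period_measure. (\<lambda>n. \<Sum>k<n. a k * cos (real (Suc k) * (t - s) - \<theta>)) \<longlonglongrightarrow> \<psi> (t - s)"
    using lim by simp
qed (rule bound)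

lemma error_kernel_partial_bound:
  "\<bar>\<Sum>k<n. a k * (1 - F k) * cos (real (Suc k) * t - \<theta>)\<bar> \<le> M + 1 / (2 * pi) * (LINT s|period_measure. M * \<bar>g s\<bar>)"
proof -
  have "\<bar>LINT s|period_measure. g s * (\<Sum>k<n. a k * cos (real (Suc k) * (t - s) - \<theta>))\<bar>
      \<le> (LINT s|period_measure. \<bar>g s * (\<Sum>k<n. a k * cos (real (Suc k) * (t - s) - \<theta>))\<bar>)"
    by (rule integral_abs_bound)
  also have "\<dots> \<le> (LINT s|period_measure. M * \<bar>g s\<bar>)"
  proof (rule integral_mono)
    show "integrable period_measure (\<lambda>s. \<bar>g s * (\<Sum>k<n. a k * cos (real (Suc k) * (t - s) - \<theta>))\<bar>)"
      by (intro integrable_abs integrable_period_mult_bounded[OF g, where B=M] borel_measurable_period bound) simp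
    show "integrable period_measure (\<lambda>s. M * \<bar>g s\<bar>)" using g by simp
    show "\<bar>g s * (\<Sum>k<n. a k * cos (real (Suc k) * (t - s) - \<theta>))\<bar> \<le> M * \<bar>g s\<bar>" for s
      unfolding abs_mult using mult_right_mono[OF bound[of "t - s" n], of "\<bar>g s\<bar>"] by (simp add: mult.commute)
  qed
  finally have "1 / (2 * pi) * \<bar>LINT s|period_measure. g s * (\<Sum>k<n. a k * cos (real (Suc k) * (t - s) - \<theta>))\<bar>
     \<le> 1 / (2 * pi) * (LINT s|period_measure. M * \<bar>g s\<bar>)" by (rule mult_left_mono) simp
  moreover have "\<bar>1 / (2 * pi) * (LINT s|period_measure. g s * (\<Sum>k<n. a k * cos (real (Suc k) * (t - s) - \<theta>)))\<bar>
     = 1 / (2 * pi) * \<bar>LINT s|period_measure. g s * (\<Sum>k<n. a k * cos (real (Suc k) * (t - s) - \<theta>))\<bar>"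
    by (simp add: abs_mult)
  ultimately show ?thesis
    unfolding error_kernel_partial using bound[of t n] by linarith
qed

lemma error_kernel_bound: "\<bar>error_kernel t\<bar> \<le> M + 1 / (2 * pi) * (LINT s|period_measure. M * \<bar>g s\<bar>)"
proof (rule LIMSEQ_le_const2)
  show "(\<lambda>n. \<bar>\<Sum>k<n. a k * (1 - F k) * cos (real (Suc k) * t - \<theta>)\<bar>) \<longlonglongrightarrow> \<bar>error_kernel t\<bar>"
    by (intro tendsto_intros error_kernel_lim)
qed (use error_kernel_partial_bound in blast)

lemma error_kernel_borel: "error_kernel \<in> borel_measurable borel"
  by (rule borel_measurable_LIMSEQ_real[OF error_kernel_lim]) simp

lemma error_kernel_periodic: "error_kernel (t + 2 * pi) = error_kernel t"
proof -
  have "\<psi> (t + 2 * pi - s) = \<psi> (t - s)" for s using kernel_periodic[of "t - s"] by (simp add: algebra_simps)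
  then show ?thesis by (simp add: error_kernel_def kernel_periodic)
qed

text \<open>The kernel is defined and bounded at every point, so the identity holds for every x. The
  double convolution is rearranged by Fubini with inner argument x - t - y.\<close>

lemma convolution_error:
  assumes \<phi>: "integrable period_measure \<phi>" and per: "\<And>x. \<phi> (x + 2 * pi) = \<phi> x"
  shows "convolution \<phi> \<psi> x - convolution (convolution \<phi> \<psi>) g x
    = 1 / (2 * pi) * (LINT y|period_measure. \<phi> y * error_kernel (x - y))"
proof -
  have int: "integrable period_measure (\<lambda>y. \<phi> y * \<psi> (z - y))" for z
    by (intro integrable_period_mult_bounded[OF \<phi>, where B=M] borel_measurable_period kernel_bound
        measurable_compose[OF _ kernel_borel]) simp
  have f: "convolution \<phi> \<psi> z = 1 / (2 * pi) * (LINT y|period_measure. \<phi> y * \<psi> (z - y))" for z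
    by (rule convolution_eq[OF per kernel_periodic int])
  have "(\<lambda>y. \<psi> (x - y) - error_kernel (x - y)) \<in> borel_measurable period_measure"
    by (intro borel_measurable_period borel_measurable_diff measurable_compose[OF _ kernel_borel]
        measurable_compose[OF _ error_kernel_borel]) simp_all
  moreover have "\<bar>\<psi> (x - y) - error_kernel (x - y)\<bar> \<le> M + (M + 1 / (2 * pi) * (LINT s|period_measure. M * \<bar>g s\<bar>))" for y
    using kernel_bound[of "x - y"] error_kernel_bound[of "x - y"] by linarith
  ultimately have int2: "integrable period_measure (\<lambda>y. \<phi> y * (\<psi> (x - y) - error_kernel (x - y)))"
    by (rule integrable_period_mult_bounded[OF \<phi>])
  have "convolution (convolution \<phi> \<psi>) g x
    = 1 / (2 * pi) * (1 / (2 * pi) * (LINT t|period_measure. g t * (LINT y|period_measure. \<phi> y * \<psi> (x - t - y))))"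
    by (simp add: convolution_def[of _ g] f mult.commute)
  also have "(LINT t|period_measure. g t * (LINT y|period_measure. \<phi> y * \<psi> (x - t - y)))
    = (LINT y|period_measure. \<phi> y * (LINT t|period_measure. g t * \<psi> (x - t - y)))"
    using period_integral_swap[OF g \<phi> kernel_borel kernel_bound, of x "-1"] by simp
  also have "1 / (2 * pi) * \<dots> = (LINT y|period_measure. \<phi> y * (\<psi> (x - y) - error_kernel (x - y)))"
  proof -
    have "error_kernel (x - y) = \<psi> (x - y) - 1 / (2 * pi) * (LINT t|period_measure. g t * \<psi> (x - t - y))" for y
      by (simp add: error_kernel_def algebra_simps)
    then show ?thesis by simp
  qed
  finally have "convolution \<phi> \<psi> x - convolution (convolution \<phi> \<psi>) g x
    = 1 / (2 * pi) * (LINT y|period_measure. \<phi> y * \<psi> (x - y))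
        - 1 / (2 * pi) * (LINT y|period_measure. \<phi> y * (\<psi> (x - y) - error_kernel (x - y)))"
    by (simp only: f[of x])
  also have "\<dots> = 1 / (2 * pi) * ((LINT y|period_measure. \<phi> y * \<psi> (x - y))
        - (LINT y|period_measure. \<phi> y * (\<psi> (x - y) - error_kernel (x - y))))"
    by (simp only: right_diff_distrib)
  also have "\<dots> = 1 / (2 * pi) * (LINT y|period_measure. \<phi> y * \<psi> (x - y) - \<phi> y * (\<psi> (x - y) - error_kernel (x - y)))"
    using int int2 by simp
  finally show ?thesis by (simp add: algebra_simps)
qed

text \<open>Uniformly bounded partial sums allow termwise integration of the error kernel against
  \<open>v\<close>. Hence \<open>E\<close> only has to be identified as a limit of sums over the
  Fourier coefficients of the square wave.\<close>

lemma approx_error_eq: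
  assumes p: "p = 1 \<or> p = \<infinity>" and v: "v \<in> borel_measurable borel" "\<And>t. \<bar>v t\<bar> \<le> 1" "\<And>t. v (t + pi) = - v t"
      "countable {t. \<not> isCont v t}"
    and sign: "AE t in period_measure. \<bar>error_kernel t - c\<bar> = v t * (error_kernel t - c)"
    and E: "(\<lambda>n. \<Sum>k<n. a k * (1 - F k) * (LINT t|period_measure. v t * cos (real (Suc k) * t - \<theta>))) \<longlonglongrightarrow> 2 * pi * E"
  shows "approx_error {convolution \<phi> \<psi> | \<phi>. \<phi> \<in> H1_class p} (\<lambda>f. convolution f g) p = ereal E"
proof -
  have v_int: "integrable period_measure v" 
    by (rule integrable_period_bounded[OF borel_measurable_period[OF v(1)] v(2)])
  have "(\<lambda>n. LINT t|period_measure. v t * (\<Sum>k<n. a k * (1 - F k) * cos (real (Suc k) * t - \<theta>)))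
    \<longlonglongrightarrow> (LINT t|period_measure. v t * error_kernel t)"
    by (intro bounded_convergence_period[OF v_int _ borel_measurable_period[OF error_kernel_borel], OF _ error_kernel_partial_bound]
        borel_measurable_period) (auto intro!: error_kernel_lim simp del: of_nat_Suc)
  moreover have "(LINT t|period_measure. v t * (\<Sum>k<n. a k * (1 - F k) * cos (real (Suc k) * t - \<theta>)))
    = (\<Sum>k<n. a k * (1 - F k) * (LINT t|period_measure. v t * cos (real (Suc k) * t - \<theta>)))" for n
  proof -
    have "(LINT t|period_measure. v t * (\<Sum>k<n. a k * (1 - F k) * cos (real (Suc k) * t - \<theta>)))
      = (LINT t|period_measure. (\<Sum>k<n. a k * (1 - F k) * (v t * cos (real (Suc k) * t - \<theta>))))"
      by (simp only: sum_distrib_left mult.left_commute[of "v _"])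
    also have "\<dots> = (\<Sum>k<n. (LINT t|period_measure. a k * (1 - F k) * (v t * cos (real (Suc k) * t - \<theta>))))"
      by (intro Bochner_Integration.integral_sum integrable_mult_right integrable_period_mult_bounded[OF v_int, where B=1] borel_measurable_period)
         auto
    finally show ?thesis by simp
  qed
  ultimately have "(LINT t|period_measure. error_kernel t * v t) = 2 * pi * E"
    using LIMSEQ_unique[OF _ E] by (simp add: mult.commute)
  from extremal_SUP[OF error_kernel_borel error_kernel_bound error_kernel_periodic v sign this p]
  have "(SUP \<phi>\<in>H1_class p. Lp_norm p (\<lambda>x. 1 / (2 * pi) * (LINT y|period_measure. \<phi> y * error_kernel (x - y)))) = ereal E" .
  moreover have "{convolution \<phi> \<psi> | \<phi>. \<phi> \<in> H1_class p} = (\<lambda>\<phi>. convolution \<phi> \<psi>) ` H1_class p" by auto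
  moreover have "(SUP \<phi>\<in>H1_class p. Lp_norm p (\<lambda>x. convolution \<phi> \<psi> x - convolution (convolution \<phi> \<psi>) g x))
     = (SUP \<phi>\<in>H1_class p. Lp_norm p (\<lambda>x. 1 / (2 * pi) * (LINT y|period_measure. \<phi> y * error_kernel (x - y))))"
    by (intro SUP_cong refl arg_cong[where f="Lp_norm p"] ext convolution_error H1_classD[OF _ p])
  ultimately show ?thesis by (simp add: approx_error_def image_image)
qed

end

section \<open>The sawtooth series\<close>

lemma sin_sum_deriv:
  "((\<lambda>x. \<Sum>k<n. 2 * sin (real (Suc k) * x) / real (Suc k)) has_real_derivative (\<Sum>k<n. 2 * cos (real (Suc k) * x))) (at x)"
  by (auto intro!: derivative_eq_intros simp: mult.commute simp del: of_nat_Suc)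

text \<open>The Dirichlet kernel without its constant term, by telescoping. The factor sin(x/2) is
  kept on the left so that the identity also holds at its zeros.\<close>

lemma cos_sum_closed:
  "(\<Sum>k<n. 2 * cos (real (Suc k) * x)) * sin (x / 2) = sin ((real n + 1 / 2) * x) - sin (x / 2)"
proof (induction n)
  case (Suc n)
  have "2 * cos (real (Suc n) * x) * sin (x / 2) = sin (real (Suc n) * x + x / 2) - sin (real (Suc n) * x - x / 2)"
    by (simp add: sin_add sin_diff del: of_nat_Suc)
  moreover have "real (Suc n) * x + x / 2 = (real (Suc n) + 1 / 2) * x" "real (Suc n) * x - x / 2 = (real n + 1 / 2) * x"
    by (simp_all add: algebra_simps)
  ultimately have "2 * cos (real (Suc n) * x) * sin (x / 2) = sin ((real (Suc n) + 1 / 2) * x) - sin ((real n + 1 / 2) * x)"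
    by simp
  then show ?case using Suc.IH unfolding sum.lessThan_Suc distrib_right[of _ _ "sin (x / 2)"] by linarith
qed simp

text \<open>Jordan's inequality: on [0, pi] the concave function sin(x/2) lies above its
  chord.\<close>

lemma sin_half_ge:
  assumes "0 \<le> t" "t \<le> pi"
  shows "t / pi \<le> sin (t / 2)"
proof -
  have "convex_on {0..pi} (\<lambda>x. - sin (x / 2))"
  proof (rule convex_on_realI[where f'="\<lambda>x. - (cos (x / 2) / 2)"])
    show "((\<lambda>x. - sin (x / 2)) has_real_derivative - (cos (x / 2) / 2)) (at x)" for x
      by (auto intro!: derivative_eq_intros)
    show "- (cos (x / 2) / 2) \<le> - (cos (y / 2) / 2)" if "x \<in> {0..pi}" "y \<in> {0..pi}" "x \<le> y" for x y
      using that cos_mono_le_eq[of "y / 2" "x / 2"] by auto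
  qed simp
  from convex_onD_Icc'[OF this, of t] show ?thesis using assms by (simp add: field_simps)
qed

text \<open>For fixed t the bound tends to 0, which gives convergence; where n t stays away from 0
  it is bounded independently of n and t, which gives uniform boundedness of the partial
  sums.\<close>

lemma saw_remainder:
  assumes "0 < t" "t \<le> pi"
  shows "\<bar>(\<Sum>k<n. 2 * sin (real (Suc k) * t) / real (Suc k)) - (pi - t)\<bar> \<le> 2 / ((real n + 1 / 2) * sin (t / 2))"
proof -
  define m where "m = real n + 1 / 2"
  have m: "0 < m" by (simp add: m_def)
  define P where "P x = (\<Sum>k<n. 2 * sin (real (Suc k) * x) / real (Suc k))" for x
  \<comment> \<open>The last summand is the boundary term of one partial integration of the Dirichlet kernel;
    the derivative of the rest is dominated by that of $1/(m\sin(x/2))$.\<close>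
  define R where "R x = P x - (pi - x) + cos (m * x) / (m * sin (x / 2))" for x
  have s: "0 < sin (x / 2)" if "t \<le> x" "x \<le> pi" for x
    using assms that by (intro sin_gt_zero) auto
  have R': "(R has_real_derivative - (cos (m * x) * cos (x / 2) / (2 * m * (sin (x / 2))\<^sup>2))) (at x)"
    if x: "t \<le> x" "x \<le> pi" for x
  proof -
    have P': "(P has_real_derivative (\<Sum>k<n. 2 * cos (real (Suc k) * x))) (at x)"
      unfolding P_def by (rule sin_sum_deriv)
    have C': "((\<lambda>x. cos (m * x) / (m * sin (x / 2))) has_real_derivative
        ((- sin (m * x) * m) * (m * sin (x / 2)) - cos (m * x) * (m * (cos (x / 2) * (1 / 2)))) / (m * sin (x / 2))\<^sup>2) (at x)"
      using s[OF x] m by (auto intro!: derivative_eq_intros simp: power2_eq_square)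
    have "((\<lambda>x. pi - x) has_real_derivative - 1) (at x)" by (auto intro!: derivative_eq_intros)
    from DERIV_add[OF DERIV_diff[OF P' this] C']
    have "(R has_real_derivative (\<Sum>k<n. 2 * cos (real (Suc k) * x)) + 1
        + ((- sin (m * x) * m) * (m * sin (x / 2)) - cos (m * x) * (m * (cos (x / 2) * (1 / 2)))) / (m * sin (x / 2))\<^sup>2) (at x)"
      unfolding R_def by simp
    moreover have "(\<Sum>k<n. 2 * cos (real (Suc k) * x)) = sin (m * x) / sin (x / 2) - 1"
      using cos_sum_closed[of x n] s[OF x] by (simp add: m_def field_simps del: of_nat_Suc)
    moreover have "sin (m * x) / sin (x / 2) - 1 + 1
        + ((- sin (m * x) * m) * (m * sin (x / 2)) - cos (m * x) * (m * (cos (x / 2) * (1 / 2)))) / (m * sin (x / 2))\<^sup>2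
      = - (cos (m * x) * cos (x / 2) / (2 * m * (sin (x / 2))\<^sup>2))"
      using s[OF x] m by (simp add: divide_simps power2_eq_square)
    ultimately show ?thesis by simp
  qed
  have q': "((\<lambda>x. 1 / (m * sin (x / 2))) has_real_derivative - (cos (x / 2) / (2 * m * (sin (x / 2))\<^sup>2))) (at x)"
    if x: "t \<le> x" "x \<le> pi" for x
    using s[OF x] m by (auto intro!: derivative_eq_intros simp: power2_eq_square divide_simps)
  have "sin ((real n + 1 / 2) * pi) = (- 1) ^ n" "cos (m * pi) = 0"
    by (simp_all add: m_def distrib_right sin_add cos_add)
  then have Rpi: "R pi = 0" by (simp add: R_def P_def del: of_nat_Suc)
  \<comment> \<open>Both signs are treated together: 1 / (m sin(x/2)) - \<sigma> R(x) is
    nonincreasing on [t, pi], and at pi it is positive, because R vanishes there thanks to the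
    half-integer m.\<close>
  have *: "\<sigma> * R t \<le> 1 / (m * sin (t / 2))" if \<sigma>: "\<bar>\<sigma>\<bar> = 1" for \<sigma> :: real
  proof -
    have "1 / (m * sin (pi / 2)) - \<sigma> * R pi \<le> 1 / (m * sin (t / 2)) - \<sigma> * R t"
    proof (rule DERIV_nonpos_imp_nonincreasing[OF assms(2)])
      fix x assume x: "t \<le> x" "x \<le> pi"
      let ?q = "cos (x / 2) / (2 * m * (sin (x / 2))\<^sup>2)"
      have "((\<lambda>x. 1 / (m * sin (x / 2)) - \<sigma> * R x) has_real_derivative
          - ?q - \<sigma> * - (cos (m * x) * cos (x / 2) / (2 * m * (sin (x / 2))\<^sup>2))) (at x)"
        by (intro DERIV_diff q' DERIV_cmult R' x)
      moreover have "- ?q - \<sigma> * - (cos (m * x) * cos (x / 2) / (2 * m * (sin (x / 2))\<^sup>2)) = - (?q * (1 - \<sigma> * cos (m * x)))"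
        by (simp add: algebra_simps diff_divide_distrib)
      moreover have "0 \<le> ?q * (1 - \<sigma> * cos (m * x))"
      proof (intro mult_nonneg_nonneg divide_nonneg_nonneg)
        show "0 \<le> cos (x / 2)" using x assms by (intro cos_ge_zero) auto
        have "\<bar>\<sigma> * cos (m * x)\<bar> \<le> 1" using \<sigma> by (simp add: abs_mult)
        then show "0 \<le> 1 - \<sigma> * cos (m * x)" by linarith
      qed (use m in auto)
      ultimately show "\<exists>y. ((\<lambda>x. 1 / (m * sin (x / 2)) - \<sigma> * R x) has_real_derivative y) (at x) \<and> y \<le> 0"
        by fastforce
    qed
    moreover have "0 < 1 / (m * sin (pi / 2))" using m by simp
    ultimately show ?thesis unfolding Rpi by linarith
  qed
  have "\<bar>R t\<bar> \<le> 1 / (m * sin (t / 2))" using *[of 1] *[of "-1"] by auto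
  moreover have "\<bar>cos (m * t) / (m * sin (t / 2))\<bar> \<le> 1 / (m * sin (t / 2))"
    using s[of t] assms m by (simp add: abs_mult divide_right_mono)
  moreover have "\<bar>A\<bar> \<le> e + e" if "\<bar>A + C\<bar> \<le> e" "\<bar>C\<bar> \<le> e" for A C e :: real
    using that by linarith
  ultimately have "\<bar>P t - (pi - t)\<bar> \<le> 1 / (m * sin (t / 2)) + 1 / (m * sin (t / 2))"
    unfolding R_def by blast
  also have "1 / (m * sin (t / 2)) + 1 / (m * sin (t / 2)) = 2 / (m * sin (t / 2))" by simp
  finally show ?thesis unfolding P_def m_def .
qed

lemma saw_lim_pos:
  assumes "0 < t" "t \<le> pi"
  shows "(\<lambda>n. \<Sum>k<n. 2 * sin (real (Suc k) * t) / real (Suc k)) \<longlonglongrightarrow> pi - t"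
proof (rule Lim_transform[OF tendsto_const])
  have "0 < sin (t / 2)" using assms by (intro sin_gt_zero) auto
  have "filterlim (\<lambda>n. real n + 1 / 2) at_top sequentially"
    by (rule filterlim_at_top_mono[OF filterlim_real_sequentially]) simp
  then have "(\<lambda>n. 2 / sin (t / 2) * inverse (real n + 1 / 2)) \<longlonglongrightarrow> 2 / sin (t / 2) * 0"
    by (intro tendsto_mult tendsto_const tendsto_inverse_0_at_top)
  then have lim: "(\<lambda>n. 2 / ((real n + 1 / 2) * sin (t / 2))) \<longlonglongrightarrow> 0"
    by (simp only: divide_inverse inverse_mult_distrib mult_zero_right mult_zero_left mult.assoc mult.left_commute mult.commute)
  show "(\<lambda>n. (\<Sum>k<n. 2 * sin (real (Suc k) * t) / real (Suc k)) - (pi - t)) \<longlonglongrightarrow> 0"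
    by (rule Lim_null_comparison[OF _ lim]) (use saw_remainder[OF assms] in \<open>auto simp del: of_nat_Suc\<close>)
qed

text \<open>For n t <= 1 every term is at most 2 t, so the sum is at most 2. For n t > 1 Jordan's
  inequality bounds the remainder by 2 pi, and pi - t adds at most pi. The constant is the sum of
  the bounds in the two cases.\<close>

lemma saw_bound_pos:
  assumes "0 < t" "t \<le> pi"
  shows "\<bar>\<Sum>k<n. 2 * sin (real (Suc k) * t) / real (Suc k)\<bar> \<le> 3 * pi + 2"
proof (cases "real n * t \<le> 1")
  case True
  have "\<bar>\<Sum>k<n. 2 * sin (real (Suc k) * t) / real (Suc k)\<bar> \<le> (\<Sum>k<n. \<bar>2 * sin (real (Suc k) * t) / real (Suc k)\<bar>)"
    by (rule sum_abs)
  also have "\<dots> \<le> (\<Sum>k<n. 2 * t)"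
  proof (rule sum_mono)
    fix k
    have "\<bar>sin (real (Suc k) * t)\<bar> \<le> real (Suc k) * t" using abs_sin_x_le_abs_x[of "real (Suc k) * t"] assms by simp
    then show "\<bar>2 * sin (real (Suc k) * t) / real (Suc k)\<bar> \<le> 2 * t" by (simp add: abs_mult field_simps)
  qed
  finally have "\<bar>\<Sum>k<n. 2 * sin (real (Suc k) * t) / real (Suc k)\<bar> \<le> 2 * (real n * t)" by (simp add: mult_ac del: of_nat_Suc)
  moreover have "0 < pi" by simp
  ultimately show ?thesis using True by linarith
next
  case False
  have "1 / pi \<le> (real n + 1 / 2) * (t / pi)"
    using False assms by (simp add: divide_right_mono distrib_right)
  also have "\<dots> \<le> (real n + 1 / 2) * sin (t / 2)"
    using sin_half_ge[of t] assms by (intro mult_left_mono) auto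
  finally have "2 / ((real n + 1 / 2) * sin (t / 2)) \<le> 2 / (1 / pi)"
    by (intro divide_left_mono mult_pos_pos) (use assms in \<open>auto intro!: sin_gt_zero\<close>)
  then show ?thesis using saw_remainder[OF assms, of n] assms by (simp del: of_nat_Suc)
qed

lemma sin_Suc_shift: "sin (real (Suc k) * (t + 2 * pi * of_int m)) = sin (real (Suc k) * t)"
  and cos_Suc_shift: "cos (real (Suc k) * (t + 2 * pi * of_int m)) = cos (real (Suc k) * t)"
proof -
  have eq: "real (Suc k) * (t + 2 * pi * of_int m) = real (Suc k) * t + 2 * pi * of_int (int (Suc k) * m)"
    by (simp add: algebra_simps)
  show "sin (real (Suc k) * (t + 2 * pi * of_int m)) = sin (real (Suc k) * t)"
    unfolding eq by (rule periodic_add_int) simp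
  show "cos (real (Suc k) * (t + 2 * pi * of_int m)) = cos (real (Suc k) * t)"
    unfolding eq by (rule periodic_add_int) simp
qed

lemma period_representative:
  obtains s :: real and m :: int where "t = s + 2 * pi * of_int m" "- pi < s" "s \<le> pi"
proof -
  define m where "m = \<lceil>(t - pi) / (2 * pi)\<rceil>"
  have "(t - pi) / (2 * pi) \<le> m" "of_int m < (t - pi) / (2 * pi) + 1"
    unfolding m_def by linarith+
  then have "- pi < t - 2 * pi * of_int m" "t - 2 * pi * of_int m \<le> pi" by (simp_all add: field_simps)
  then show ?thesis by (intro that[of "t - 2 * pi * of_int m" m]) auto
qed

text \<open>The limit of the series, not the formula pi - t: at multiples of 2 pi it has the value 0
  to which the partial sums converge, which keeps the function odd and the convergence valid
  everywhere.\<close>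

definition saw :: "real \<Rightarrow> real" where
  "saw t = lim (\<lambda>n. \<Sum>k<n. 2 * sin (real (Suc k) * t) / real (Suc k))"

lemma sin_Suc_minus: "(\<Sum>k<n. 2 * sin (real (Suc k) * (- t)) / real (Suc k)) = - (\<Sum>k<n. 2 * sin (real (Suc k) * t) / real (Suc k))"
  by (simp add: sum_negf del: of_nat_Suc)

lemma saw_facts:
  shows saw_lim: "(\<lambda>n. \<Sum>k<n. 2 * sin (real (Suc k) * t) / real (Suc k)) \<longlonglongrightarrow> saw t"
    and saw_bound: "\<bar>\<Sum>k<n. 2 * sin (real (Suc k) * t) / real (Suc k)\<bar> \<le> 3 * pi + 2"
proof -
  obtain s m where t: "t = s + 2 * pi * of_int m" and s: "- pi < s" "s \<le> pi"
    by (rule period_representative)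
  have "(\<exists>l. (\<lambda>n. \<Sum>k<n. 2 * sin (real (Suc k) * s) / real (Suc k)) \<longlonglongrightarrow> l) \<and>
    \<bar>\<Sum>k<n. 2 * sin (real (Suc k) * s) / real (Suc k)\<bar> \<le> 3 * pi + 2"
  proof -
    consider "s = 0" | "0 < s" | "s < 0" by linarith
    then show ?thesis
    proof cases
      case 1 then show ?thesis by auto
    next
      case 2 then show ?thesis using saw_lim_pos s saw_bound_pos by blast
    next
      case 3
      then have "0 < - s" "- s \<le> pi" using s by auto
      from tendsto_minus[OF saw_lim_pos[OF this]] saw_bound_pos[OF this, of n] show ?thesis
        unfolding sin_Suc_minus by auto
    qed
  qed
  then show "(\<lambda>n. \<Sum>k<n. 2 * sin (real (Suc k) * t) / real (Suc k)) \<longlonglongrightarrow> saw t"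
    "\<bar>\<Sum>k<n. 2 * sin (real (Suc k) * t) / real (Suc k)\<bar> \<le> 3 * pi + 2"
    unfolding saw_def t sin_Suc_shift by (auto simp: convergent_def convergent_LIMSEQ_iff[symmetric])
qed

lemma saw_eq:
  assumes "0 < t" "t < 2 * pi"
  shows "saw t = pi - t"
proof (cases "t \<le> pi")
  case True then show ?thesis using assms saw_lim_pos saw_lim LIMSEQ_unique by blast
next
  case False
  have eq: "- (2 * pi - t) + 2 * pi * of_int 1 = t" by simp
  have "(\<lambda>n. \<Sum>k<n. 2 * sin (real (Suc k) * (2 * pi - t)) / real (Suc k)) \<longlonglongrightarrow> pi - (2 * pi - t)"
    using False assms by (intro saw_lim_pos) auto
  from tendsto_minus[OF this]
  have "(\<lambda>n. \<Sum>k<n. 2 * sin (real (Suc k) * (- (2 * pi - t))) / real (Suc k)) \<longlonglongrightarrow> pi - t"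
    unfolding sin_Suc_minus by simp
  then have "(\<lambda>n. \<Sum>k<n. 2 * sin (real (Suc k) * t) / real (Suc k)) \<longlonglongrightarrow> pi - t"
    using sin_Suc_shift[of _ "- (2 * pi - t)" 1] unfolding eq by simp
  then show ?thesis using saw_lim LIMSEQ_unique by blast
qed

lemma saw_minus: "saw (- t) = - saw t"
proof -
  have "(\<lambda>n. \<Sum>k<n. 2 * sin (real (Suc k) * (- t)) / real (Suc k)) \<longlonglongrightarrow> - saw t"
    unfolding sin_Suc_minus by (rule tendsto_minus[OF saw_lim])
  then show ?thesis using saw_lim LIMSEQ_unique by blast
qed

lemma saw_shift: "saw (t + 2 * pi * of_int m) = saw t"
  unfolding saw_def sin_Suc_shift ..

lemma saw_0: "saw 0 = 0"
  using saw_minus[of 0] by simp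

lemma saw_isCont:
  assumes "sin (t / 2) \<noteq> 0"
  shows "isCont saw t"
proof -
  define m where "m = \<lfloor>t / (2 * pi)\<rfloor>"
  define s where "s = t - 2 * pi * of_int m"
  have s: "0 \<le> s" "s < 2 * pi"
    using floor_divide_lower[of "2 * pi" t] floor_divide_upper[of "2 * pi" t]
    by (auto simp: s_def m_def algebra_simps)
  have "s \<noteq> 0"
  proof
    assume "s = 0"
    then have "t / 2 = of_int m * pi" by (simp add: s_def)
    then have "sin (t / 2) = 0" by (metis sin_zero_iff_int2)
    then show False using assms by simp
  qed
  then have "s \<in> {0<..<2 * pi}" using s by auto
  then have "eventually (\<lambda>x. saw x = pi - x) (nhds s)"
    unfolding eventually_nhds using saw_eq by (intro exI[of _ "{0<..<2 * pi}"]) auto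
  then have "isCont saw s \<longleftrightarrow> isCont (\<lambda>x. pi - x) s" by (rule isCont_cong)
  then have "isCont saw s" by simp
  then have "isCont (\<lambda>x. saw (x - 2 * pi * of_int m)) t"
    by (intro isCont_o2[where f="\<lambda>x. x - 2 * pi * of_int m" and g=saw] continuous_intros) (simp add: s_def)
  moreover have "saw (x - 2 * pi * of_int m) = saw x" for x
    using saw_shift[of "x - 2 * pi * of_int m" m] by simp
  ultimately show ?thesis by simp
qed

lemma saw_countable: "countable {t. \<not> isCont saw t}"
proof (rule countable_subset)
  show "{t. \<not> isCont saw t} \<subseteq> (\<lambda>m::int. 2 * pi * of_int m) ` UNIV"
  proof
    fix t assume "t \<in> {t. \<not> isCont saw t}"
    then have "sin (t / 2) = 0" using saw_isCont by blast
    then obtain m :: int where "t / 2 = of_int m * pi" by (auto simp: sin_zero_iff_int2)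
    then show "t \<in> (\<lambda>m::int. 2 * pi * of_int m) ` UNIV" by (auto intro!: image_eqI[where x=m])
  qed
qed simp

text \<open>Termwise integration raises the exponent of the coefficients by one and replaces sines
  by differences of cosines. It is the bridge from the sawtooth to exponent 2, and from sine series
  with exponent r - 1 to cosine series with exponent r.\<close>

lemma integral_bounded_sin_series:
  fixes c :: "nat \<Rightarrow> real"
  assumes lim: "\<And>t. (\<lambda>n. \<Sum>k<n. c k * sin (real (Suc k) * t)) \<longlonglongrightarrow> L t"
    and bound: "\<And>n t. \<bar>\<Sum>k<n. c k * sin (real (Suc k) * t)\<bar> \<le> M" and "x \<le> y"
  shows "L absolutely_integrable_on {x..y}"
    and "(\<lambda>n. \<Sum>k<n. c k / real (Suc k) * (cos (real (Suc k) * x) - cos (real (Suc k) * y))) \<longlonglongrightarrow> integral {x..y} L"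
proof -
  let ?P = "\<lambda>n t. \<Sum>k<n. c k * sin (real (Suc k) * t)"
  have P_int: "?P n absolutely_integrable_on {x..y}" for n
    by (rule absolutely_integrable_continuous_real) (intro continuous_intros)
  have L_meas: "L \<in> borel_measurable borel"
    by (rule borel_measurable_LIMSEQ_real[OF lim]) simp
  have L_bound: "\<bar>L t\<bar> \<le> M" for t
  proof (rule LIMSEQ_le_const2)
    show "(\<lambda>n. \<bar>?P n t\<bar>) \<longlonglongrightarrow> \<bar>L t\<bar>" by (intro tendsto_intros lim)
  qed (use bound in auto)
  show "L absolutely_integrable_on {x..y}"
  proof (rule measurable_bounded_by_integrable_imp_absolutely_integrable[where g="\<lambda>_. M"])
    have "L \<in> borel_measurable lebesgue" using L_meas by (simp add: measurable_completion)
    then show "L \<in> borel_measurable (lebesgue_on {x..y})" by (rule measurable_restrict_space1)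
  qed (use L_bound in auto)
  have "(\<lambda>n. integral {x..y} (?P n)) \<longlonglongrightarrow> integral {x..y} L"
  proof (rule dominated_convergence(2)[where h="\<lambda>_. M"])
    show "?P n integrable_on {x..y}" for n
      using P_int absolutely_integrable_on_def by blast
  qed (use bound lim in auto)
  moreover have "integral {x..y} (?P n) = (\<Sum>k<n. c k / real (Suc k) * (cos (real (Suc k) * x) - cos (real (Suc k) * y)))" for n
  proof (rule integral_unique)
    let ?A = "\<lambda>t. \<Sum>k<n. - (c k / real (Suc k) * cos (real (Suc k) * t))"
    have "(?P n has_integral ?A y - ?A x) {x..y}"
      using \<open>x \<le> y\<close>
      by (intro fundamental_theorem_of_calculus)
         (auto intro!: derivative_eq_intros simp: has_real_derivative_iff_has_vector_derivative[symmetric] mult.commute simp del: of_nat_Suc)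
    then show "(?P n has_integral (\<Sum>k<n. c k / real (Suc k) * (cos (real (Suc k) * x) - cos (real (Suc k) * y)))) {x..y}"
      by (simp add: sum_subtractf[symmetric] right_diff_distrib sum_negf del: of_nat_Suc)
  qed
  ultimately show "(\<lambda>n. \<Sum>k<n. c k / real (Suc k) * (cos (real (Suc k) * x) - cos (real (Suc k) * y))) \<longlonglongrightarrow> integral {x..y} L"
    by simp
qed

section \<open>Positive definite multipliers and concave sine series\<close>

lemma integral_cos_nat: "(LINT t|period_measure. cos (real m * t)) = (if m = 0 then 2 * pi else 0)"
proof (cases "m = 0")
  case True
  then show ?thesis by (simp add: measure_restrict_space)
next
  case False
  have int: "integrable period_measure (\<lambda>t. cos (real m * t))"
    by (rule integrable_period_bounded[where B=1]) (auto intro!: borel_measurable_period)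
  have per: "cos (real m * (t + 2 * pi)) = cos (real m * t)" for t
  proof -
    have eq: "real m * (t + 2 * pi) = real m * t + 2 * pi * of_int (int m)" by (simp add: algebra_simps)
    show ?thesis unfolding eq by (rule periodic_add_int) simp
  qed
  have "cos (real m * (t + pi / real m)) = - cos (real m * t)" for t
    using False by (simp add: distrib_left)
  with period_integral_translate[OF per int, of "pi / real m"] show ?thesis
    using False by (simp add: has_bochner_integral_iff)
qed

lemma integrable_cos: "integrable period_measure (\<lambda>t. cos (c * t))"
  by (rule integrable_period_bounded[where B=1]) (auto intro!: borel_measurable_period)

lemma integrable_cos_cos: "integrable period_measure (\<lambda>t. cos (c * t) * cos (d * t))"
  by (rule integrable_period_mult_bounded[OF integrable_cos, where B=1]) (auto intro!: borel_measurable_period)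

lemma integral_cos_cos:
  "(LINT t|period_measure. cos (real (Suc i) * t) * cos (real (Suc j) * t)) = (if i = j then pi else 0)"
proof -
  define l where "l = (if i \<le> j then j - i else i - j)"
  have "cos (real (Suc i) * t) * cos (real (Suc j) * t) = (cos (real l * t) + cos (real (i + j + 2) * t)) / 2" for t
  proof (cases "i \<le> j")
    case True
    then have "real (Suc j) * t = real l * t + real (Suc i) * t" by (simp add: l_def of_nat_diff algebra_simps)
    then have l: "real l * t = real (Suc j) * t - real (Suc i) * t" by simp
    have "real (i + j + 2) * t = real (Suc j) * t + real (Suc i) * t" by (simp add: algebra_simps)
    then show ?thesis unfolding l by (simp only: cos_add cos_diff) simp
  next
    case False
    then have "real (Suc i) * t = real l * t + real (Suc j) * t" by (simp add: l_def of_nat_diff algebra_simps)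
    then have l: "real l * t = real (Suc i) * t - real (Suc j) * t" by simp
    have "real (i + j + 2) * t = real (Suc i) * t + real (Suc j) * t" by (simp add: algebra_simps)
    then show ?thesis unfolding l by (simp only: cos_add cos_diff) simp
  qed
  then have "(LINT t|period_measure. cos (real (Suc i) * t) * cos (real (Suc j) * t))
    = (LINT t|period_measure. (cos (real l * t) + cos (real (i + j + 2) * t)) / 2)" by (simp only:)
  also have "\<dots> = ((LINT t|period_measure. cos (real l * t)) + (LINT t|period_measure. cos (real (i + j + 2) * t))) / 2"
    using integrable_cos by simp
  also have "\<dots> = (if l = 0 then pi else 0)" unfolding integral_cos_nat by simp
  finally show ?thesis by (auto simp: l_def)
qed

text \<open>Passing from N to N + 1 adds a row and a column that agree by symmetry and run through
  the distances 1 to N once each, besides the diagonal entry. Thus the Toeplitz sum is N times a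
  Fejer mean of the cosine series of \<Phi>.\<close>

lemma toeplitz_cos_sum:
  fixes \<Phi> :: "nat \<Rightarrow> real"
  shows "(\<Sum>k<N. \<Sum>j<N. \<Phi> (nat \<bar>int k - int j\<bar>) * cos ((real k - real j) * s))
    = (\<Sum>n<N. \<Phi> 0 + 2 * (\<Sum>m<n. \<Phi> (Suc m) * cos (real (Suc m) * s)))"
proof (induction N)
  case (Suc N)
  let ?f = "\<lambda>k j. \<Phi> (nat \<bar>int k - int j\<bar>) * cos ((real k - real j) * s)"
  let ?e = "\<Sum>m<N. \<Phi> (Suc m) * cos (real (Suc m) * s)"
  have r1: "(\<Sum>k<N. ?f k N) = ?e"
  proof -
    have "(\<Sum>k<N. ?f k N) = (\<Sum>k<N. (\<lambda>m. \<Phi> (Suc m) * cos (real (Suc m) * s)) (N - Suc k))"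
    proof (rule sum.cong[OF refl])
      fix k assume "k \<in> {..<N}"
      then have k: "k < N" by simp
      then have "Suc (N - Suc k) = N - k" "nat \<bar>int k - int N\<bar> = N - k" by auto
      moreover have "(real k - real N) * s = - (real (N - k) * s)" using k by (simp add: of_nat_diff algebra_simps)
      ultimately show "?f k N = (\<lambda>m. \<Phi> (Suc m) * cos (real (Suc m) * s)) (N - Suc k)"
        by (simp del: of_nat_Suc)
    qed
    also have "\<dots> = ?e" by (rule sum.nat_diff_reindex)
    finally show ?thesis .
  qed
  have sym: "?f k j = ?f j k" for k j
  proof -
    have "(real k - real j) * s = - ((real j - real k) * s)" by (simp add: algebra_simps)
    then show ?thesis by (simp add: abs_minus_commute)
  qed
  have "(\<Sum>j<N. ?f N j) = (\<Sum>j<N. ?f j N)" by (intro sum.cong refl sym)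
  then have r2: "(\<Sum>j<N. ?f N j) = ?e" using r1 by (simp only:)
  have "(\<Sum>k<Suc N. \<Sum>j<Suc N. ?f k j) = (\<Sum>k<N. (\<Sum>j<N. ?f k j) + ?f k N) + ((\<Sum>j<N. ?f N j) + ?f N N)"
    by (simp only: sum.lessThan_Suc)
  also have "\<dots> = (\<Sum>k<N. \<Sum>j<N. ?f k j) + ?e + (?e + \<Phi> 0)"
    unfolding sum.distrib r1 r2 by simp
  finally show ?case unfolding Suc.IH sum.lessThan_Suc by linarith
qed simp

text \<open>A negative limit would make the sums decrease to minus infinity at a linear rate. This
  is how nonnegative averages yield a nonnegative limit although single members of the sequence may
  be negative.\<close>

lemma limit_nonneg_of_partial_sums:
  fixes x :: "nat \<Rightarrow> real"
  assumes lim: "x \<longlonglongrightarrow> l" and nonneg: "\<And>N. 0 \<le> (\<Sum>n<N. x n)"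
  shows "0 \<le> l"
proof (rule ccontr)
  assume "\<not> 0 \<le> l"
  then have "l < l / 2" "l < 0" by auto
  from order_tendstoD(2)[OF lim this(1)] obtain n0 where n0: "\<And>n. n \<ge> n0 \<Longrightarrow> x n < l / 2"
    by (auto simp: eventually_sequentially)
  have le: "(\<Sum>n<n0 + d. x n) \<le> (\<Sum>n<n0. x n) + real d * (l / 2)" for d
  proof (induction d)
    case (Suc d)
    have "x (n0 + d) \<le> l / 2" using n0[of "n0 + d"] by simp
    moreover have "real (Suc d) * (l / 2) = real d * (l / 2) + l / 2" by (simp add: distrib_right)
    ultimately show ?case using Suc unfolding add_Suc_right sum.lessThan_Suc by linarith
  qed simp
  obtain d where "(\<Sum>n<n0. x n) / - (l / 2) < real d" using reals_Archimedean2 by blast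
  then have "(\<Sum>n<n0. x n) + real d * (l / 2) < 0" using \<open>l < 0\<close> by (simp add: divide_less_eq field_simps)
  then show False using le[of d] nonneg[of "n0 + d"] by linarith
qed

text \<open>\<open>pd\<close> is positive definiteness of the Toeplitz matrix tested on the vectors
  with entries e^(iks); these suffice to make the Fejer means nonnegative.\<close>

locale positive_definite_sequence =
  fixes \<Phi> :: "nat \<Rightarrow> real" and C :: real
  assumes pd: "\<And>N s. 0 \<le> (\<Sum>k<N. \<Sum>j<N. \<Phi> (nat \<bar>int k - int j\<bar>) * cos ((real k - real j) * s))"
    and \<Phi>_bound: "\<And>k. \<bar>\<Phi> k\<bar> \<le> C"
    and \<Phi>_0: "\<Phi> 0 \<le> 1"
begin

text \<open>The symmetric partial sum of the Fourier series with even coefficients \<Phi>, written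
  with cosines.\<close>

definition dirichlet_part :: "nat \<Rightarrow> real \<Rightarrow> real" where
  "dirichlet_part n s = \<Phi> 0 + 2 * (\<Sum>m<n. \<Phi> (Suc m) * cos (real (Suc m) * s))"

lemma integrable_dirichlet_part: "integrable period_measure (dirichlet_part n)"
  unfolding dirichlet_part_def
  by (intro Bochner_Integration.integrable_add period.integrable_const integrable_mult_right Bochner_Integration.integrable_sum integrable_cos)

lemma integral_dirichlet_part:
  "(LINT s|period_measure. dirichlet_part n s * (1 - cos (real (Suc i) * s)))
    = 2 * pi * (\<Phi> 0 - (if i < n then \<Phi> (Suc i) else 0))"
proof -
  have 1: "(LINT s|period_measure. dirichlet_part n s) = 2 * pi * \<Phi> 0"
  proof -
    have "(LINT s|period_measure. dirichlet_part n s) = (LINT s|period_measure. \<Phi> 0)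
       + (LINT s|period_measure. 2 * (\<Sum>m<n. \<Phi> (Suc m) * cos (real (Suc m) * s)))"
      unfolding dirichlet_part_def
      by (intro Bochner_Integration.integral_add period.integrable_const integrable_mult_right Bochner_Integration.integrable_sum integrable_cos)
    also have "(LINT s|period_measure. 2 * (\<Sum>m<n. \<Phi> (Suc m) * cos (real (Suc m) * s)))
       = 2 * (\<Sum>m<n. (LINT s|period_measure. \<Phi> (Suc m) * cos (real (Suc m) * s)))"
      by (subst integral_mult_right_zero, subst Bochner_Integration.integral_sum) (intro integrable_mult_right integrable_cos refl)+
    also have "\<dots> = 0" by (simp only: integral_mult_right_zero integral_cos_nat) simp
    finally show ?thesis by (simp add: measure_restrict_space)
  qed
  have int: "integrable period_measure (\<lambda>s. \<Phi> (Suc m) * (cos (real (Suc m) * s) * cos (real (Suc i) * s)))" for m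
    by (intro integrable_mult_right integrable_cos_cos)
  have "(\<lambda>s. dirichlet_part n s * cos (real (Suc i) * s)) =
     (\<lambda>s. \<Phi> 0 * cos (real (Suc i) * s) + 2 * (\<Sum>m<n. \<Phi> (Suc m) * (cos (real (Suc m) * s) * cos (real (Suc i) * s))))"
    by (simp add: dirichlet_part_def distrib_right sum_distrib_right mult.assoc del: of_nat_Suc)
  then have "(LINT s|period_measure. dirichlet_part n s * cos (real (Suc i) * s)) =
     (LINT s|period_measure. \<Phi> 0 * cos (real (Suc i) * s) + 2 * (\<Sum>m<n. \<Phi> (Suc m) * (cos (real (Suc m) * s) * cos (real (Suc i) * s))))"
    by simp
  also have "\<dots> = (LINT s|period_measure. \<Phi> 0 * cos (real (Suc i) * s))
      + (LINT s|period_measure. 2 * (\<Sum>m<n. \<Phi> (Suc m) * (cos (real (Suc m) * s) * cos (real (Suc i) * s))))"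
    by (intro Bochner_Integration.integral_add integrable_mult_right Bochner_Integration.integrable_sum integrable_cos integrable_cos_cos)
  also have "(LINT s|period_measure. \<Phi> 0 * cos (real (Suc i) * s)) = 0"
    by (simp only: integral_mult_right_zero integral_cos_nat) simp
  also have "(LINT s|period_measure. 2 * (\<Sum>m<n. \<Phi> (Suc m) * (cos (real (Suc m) * s) * cos (real (Suc i) * s))))
      = 2 * (\<Sum>m<n. (LINT s|period_measure. \<Phi> (Suc m) * (cos (real (Suc m) * s) * cos (real (Suc i) * s))))"
    by (subst integral_mult_right_zero, subst Bochner_Integration.integral_sum) (intro int refl)+
  also have "\<dots> = 2 * (\<Sum>m<n. \<Phi> (Suc m) * (if m = i then pi else 0))"
    by (simp only: integral_mult_right_zero integral_cos_cos)
  also have "\<dots> = 2 * pi * (if i < n then \<Phi> (Suc i) else 0)"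
    by (simp add: if_distrib[of "\<lambda>x. _ * x"] cong: if_cong)
  finally have 2: "(LINT s|period_measure. dirichlet_part n s * cos (real (Suc i) * s)) = 2 * pi * (if i < n then \<Phi> (Suc i) else 0)"
    by simp
  have "integrable period_measure (\<lambda>s. dirichlet_part n s * cos (real (Suc i) * s))"
    by (rule integrable_period_mult_bounded[OF integrable_dirichlet_part, where B=1]) (auto intro!: borel_measurable_period)
  then have "(LINT s|period_measure. dirichlet_part n s * (1 - cos (real (Suc i) * s)))
    = (LINT s|period_measure. dirichlet_part n s) - (LINT s|period_measure. dirichlet_part n s * cos (real (Suc i) * s))"
    using integrable_dirichlet_part by (simp add: right_diff_distrib del: of_nat_Suc)
  then show ?thesis unfolding 1 2 by (simp add: right_diff_distrib)
qed

text \<open>Let U(s) be the sum of b_k (1 - cos ks), k being the frequency. By orthogonality the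
  integral of the n-th partial sum of the series of \<Phi> against U is 2 pi times
  \<open>\<Phi> 0\<close> sum b_k minus a partial sum of b_k \<Phi>(k). Nonnegativity is known only
  after summing over n < N, so the Cesaro lemma takes the limit. Absolute summability of b justifies
  every interchange.\<close>

lemma pd_series_le:
  assumes sb: "summable (\<lambda>k. \<bar>b k\<bar>)" and u: "\<And>s. 0 \<le> (\<Sum>k. b k * (1 - cos (real (Suc k) * s)))"
  shows "summable (\<lambda>k. b k * \<Phi> (Suc k))" "(\<Sum>k. b k * \<Phi> (Suc k)) \<le> \<Phi> 0 * (\<Sum>k. b k)"
proof -
  have sb': "summable b" using sb by (rule summable_rabs_cancel)
  have sbc: "summable (\<lambda>k. \<bar>b k\<bar> * c)" for c using sb by (rule summable_mult2)
  have "norm (b k * \<Phi> (Suc k)) \<le> \<bar>b k\<bar> * C" for k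
    using \<Phi>_bound[of "Suc k"] by (simp add: abs_mult mult_left_mono)
  then show sQ: "summable (\<lambda>k. b k * \<Phi> (Suc k))"
    by (intro summable_comparison_test'[OF sbc]) auto
  have trm: "\<bar>b k * (1 - cos (real (Suc k) * s))\<bar> \<le> \<bar>b k\<bar> * 2" for k s
  proof -
    have "\<bar>1 - cos (real (Suc k) * s)\<bar> \<le> 2" using cos_ge_minus_one[of "real (Suc k) * s"] cos_le_one[of "real (Suc k) * s"] by linarith
    then show ?thesis unfolding abs_mult by (rule mult_left_mono) simp
  qed
  have su: "summable (\<lambda>k. b k * (1 - cos (real (Suc k) * s)))" for s
    by (rule summable_comparison_test'[OF sbc[of 2]]) (use trm in auto)
  define up where "up n s = (\<Sum>k<n. b k * (1 - cos (real (Suc k) * s)))" for n s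
  define U where "U s = (\<Sum>k. b k * (1 - cos (real (Suc k) * s)))" for s
  have up_lim: "(\<lambda>n. up n s) \<longlonglongrightarrow> U s" for s
    unfolding up_def U_def using su by (rule summable_LIMSEQ)
  have up_bound: "\<bar>up n s\<bar> \<le> (\<Sum>k. \<bar>b k\<bar> * 2)" for n s
  proof -
    have "\<bar>up n s\<bar> \<le> (\<Sum>k<n. \<bar>b k * (1 - cos (real (Suc k) * s))\<bar>)" unfolding up_def by (rule sum_abs)
    also have "\<dots> \<le> (\<Sum>k<n. \<bar>b k\<bar> * 2)" by (rule sum_mono) (rule trm)
    also have "\<dots> \<le> (\<Sum>k. \<bar>b k\<bar> * 2)" by (rule sum_le_suminf[OF sbc]) auto
    finally show ?thesis .
  qed
  have up_meas: "up n \<in> borel_measurable borel" for n unfolding up_def by measurable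
  have U_meas: "U \<in> borel_measurable borel" by (rule borel_measurable_LIMSEQ_real[OF up_lim up_meas])
  have U_bound: "\<bar>U s\<bar> \<le> (\<Sum>k. \<bar>b k\<bar> * 2)" for s
  proof (rule LIMSEQ_le_const2)
    show "(\<lambda>n. \<bar>up n s\<bar>) \<longlonglongrightarrow> \<bar>U s\<bar>" by (intro tendsto_intros up_lim)
  qed (use up_bound in auto)
  have dU_int: "integrable period_measure (\<lambda>s. dirichlet_part n s * U s)" for n
    by (rule integrable_period_mult_bounded[OF integrable_dirichlet_part borel_measurable_period[OF U_meas] U_bound])
  have dU: "(LINT s|period_measure. dirichlet_part n s * U s) = 2 * pi * (\<Phi> 0 * (\<Sum>k. b k) - (\<Sum>i<n. b i * \<Phi> (Suc i)))" for n
  proof -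
    have "(\<lambda>n'. LINT s|period_measure. dirichlet_part n s * up n' s) \<longlonglongrightarrow> (LINT s|period_measure. dirichlet_part n s * U s)"
      by (intro bounded_convergence_period[OF integrable_dirichlet_part _ _ up_bound] borel_measurable_period up_meas U_meas)
         (use up_lim in simp)
    moreover have "(LINT s|period_measure. dirichlet_part n s * up n' s)
        = 2 * pi * (\<Sum>i<n'. b i * \<Phi> 0 - (if i < n then b i * \<Phi> (Suc i) else 0))" for n'
    proof -
      have "(LINT s|period_measure. dirichlet_part n s * up n' s)
        = (LINT s|period_measure. (\<Sum>i<n'. b i * (dirichlet_part n s * (1 - cos (real (Suc i) * s)))))"
        unfolding up_def by (simp only: sum_distrib_left mult.left_commute[of "dirichlet_part n _"])
      also have "\<dots> = (\<Sum>i<n'. (LINT s|period_measure. b i * (dirichlet_part n s * (1 - cos (real (Suc i) * s)))))"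
      proof (intro Bochner_Integration.integral_sum integrable_mult_right integrable_period_mult_bounded[OF integrable_dirichlet_part, where B=2] borel_measurable_period)
        show "\<bar>1 - cos (real (Suc i) * t)\<bar> \<le> 2" for i t
          using cos_ge_minus_one[of "real (Suc i) * t"] cos_le_one[of "real (Suc i) * t"] by linarith
      qed measurable
      also have "\<dots> = (\<Sum>i<n'. 2 * pi * (b i * \<Phi> 0 - (if i < n then b i * \<Phi> (Suc i) else 0)))"
        unfolding integral_mult_right_zero integral_dirichlet_part
        by (intro sum.cong refl) (simp add: right_diff_distrib mult_ac)
      finally show ?thesis by (simp only: sum_distrib_left)
    qed
    moreover have "(\<lambda>n'. 2 * pi * (\<Sum>i<n'. b i * \<Phi> 0 - (if i < n then b i * \<Phi> (Suc i) else 0)))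
        \<longlonglongrightarrow> 2 * pi * ((\<Sum>k. b k) * \<Phi> 0 - (\<Sum>i<n. b i * \<Phi> (Suc i)))"
    proof (rule tendsto_mult_left)
      have "(\<lambda>i. if i \<in> {..<n} then b i * \<Phi> (Suc i) else 0) sums (\<Sum>i\<in>{..<n}. b i * \<Phi> (Suc i))"
        by (rule sums_If_finite_set) simp
      from sums_diff[OF sums_mult2[OF summable_sums[OF sb'], of "\<Phi> 0"] this]
      show "(\<lambda>n'. \<Sum>i<n'. b i * \<Phi> 0 - (if i < n then b i * \<Phi> (Suc i) else 0))
        \<longlonglongrightarrow> (\<Sum>k. b k) * \<Phi> 0 - (\<Sum>i<n. b i * \<Phi> (Suc i))"
        by (simp add: sums_def)
    qed
    ultimately show ?thesis using LIMSEQ_unique by (metis (no_types, lifting) LIMSEQ_unique mult.commute ext)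
  qed
  have "0 \<le> \<Phi> 0 * (\<Sum>k. b k) - (\<Sum>k. b k * \<Phi> (Suc k))"
  proof (rule limit_nonneg_of_partial_sums)
    show "(\<lambda>n. \<Phi> 0 * (\<Sum>k. b k) - (\<Sum>i<n. b i * \<Phi> (Suc i))) \<longlonglongrightarrow> \<Phi> 0 * (\<Sum>k. b k) - (\<Sum>k. b k * \<Phi> (Suc k))"
      by (intro tendsto_diff tendsto_const summable_LIMSEQ sQ)
    fix N
    have "0 \<le> (LINT s|period_measure. (\<Sum>n<N. dirichlet_part n s * U s))"
    proof (intro Bochner_Integration.integral_nonneg)
      fix s
      have "0 \<le> (\<Sum>n<N. dirichlet_part n s)"
        using pd[of s N] unfolding toeplitz_cos_sum dirichlet_part_def .
      moreover have "0 \<le> U s" using u by (simp add: U_def)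
      ultimately show "0 \<le> (\<Sum>n<N. dirichlet_part n s * U s)" by (simp add: sum_distrib_right[symmetric])
    qed
    also have "\<dots> = (\<Sum>n<N. (LINT s|period_measure. dirichlet_part n s * U s))"
      using dU_int by (intro Bochner_Integration.integral_sum)
    also have "\<dots> = 2 * pi * (\<Sum>n<N. \<Phi> 0 * (\<Sum>k. b k) - (\<Sum>i<n. b i * \<Phi> (Suc i)))"
      unfolding dU by (simp only: sum_distrib_left)
    finally show "0 \<le> (\<Sum>n<N. \<Phi> 0 * (\<Sum>k. b k) - (\<Sum>i<n. b i * \<Phi> (Suc i)))"
      using pi_gt_zero by (auto simp: zero_le_mult_iff)
  qed
  then show "(\<Sum>k. b k * \<Phi> (Suc k)) \<le> \<Phi> 0 * (\<Sum>k. b k)" by simp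
qed

text \<open>Replacing \<open>\<Phi> 0\<close> by 1 enlarges the bound because the sum of
  \<open>b\<close> is nonnegative; this is where the normalisation h(0) <= 1 enters.\<close>

lemma pd_series_nonneg:
  assumes sb: "summable (\<lambda>k. \<bar>b k\<bar>)" and u: "\<And>s. 0 \<le> (\<Sum>k. b k * (1 - cos (real (Suc k) * s)))"
    and b0: "0 \<le> (\<Sum>k. b k)"
  shows "0 \<le> (\<Sum>k. b k * (1 - \<Phi> (Suc k)))"
proof -
  have "(\<Sum>k. b k * (1 - \<Phi> (Suc k))) = (\<Sum>k. b k) - (\<Sum>k. b k * \<Phi> (Suc k))"
    using suminf_diff[OF summable_rabs_cancel[OF sb] pd_series_le(1)[OF sb u]] by (simp add: right_diff_distrib)
  moreover have "\<Phi> 0 * (\<Sum>k. b k) \<le> 1 * (\<Sum>k. b k)" using \<Phi>_0 b0 by (intro mult_right_mono)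
  ultimately show ?thesis using pd_series_le(2)[OF sb u] by linarith
qed

end

section \<open>Symmetric second differences of odd concave functions\<close>

lemma concave_on_subadditive:
  fixes f :: "real \<Rightarrow> real"
  assumes f: "concave_on {0..L} f" "f 0 = 0" and xy: "0 \<le> x" "0 \<le> y" "x + y \<le> L"
  shows "f (x + y) \<le> f x + f y"
proof (cases "x + y = 0")
  case True
  then have "x = 0" "y = 0" using xy by linarith+
  then show ?thesis using f by simp
next
  case False
  have *: "z / (x + y) * f (x + y) \<le> f z" if "0 \<le> z" "z \<le> x + y" for z
  proof -
    have "(1 - z / (x + y)) * f 0 + z / (x + y) * f (x + y)
      \<le> f ((1 - z / (x + y)) *\<^sub>R 0 + (z / (x + y)) *\<^sub>R (x + y))"
      using xy that False by (intro concave_onD[OF f(1)]) (auto simp: divide_simps)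
    then show ?thesis using False f(2) by simp
  qed
  have "f (x + y) = x / (x + y) * f (x + y) + y / (x + y) * f (x + y)"
    using False by (simp add: add_divide_distrib[symmetric] distrib_right[symmetric])
  then show ?thesis using *[of x] *[of y] xy by linarith
qed

text \<open>S is odd about 0 and, by periodicity, about pi. If t - s and t + s both lie in [0, pi],
  the claim is midpoint concavity. If exactly one of them leaves, oddness about that end point
  reflects it back and subadditivity from there applies. If both leave, the left side is nonpositive
  while S(t) is nonnegative.\<close>

lemma odd_concave_three_point:
  fixes S :: "real \<Rightarrow> real"
  assumes odd: "\<And>x. S (- x) = - S x" and per: "\<And>x. S (x + 2 * pi) = S x"
    and conc: "concave_on {0..pi} S" and t: "0 \<le> t" "t \<le> pi"
  shows "S (t + s) + S (t - s) \<le> 2 * S t"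
proof -
  have S0: "S 0 = 0" using odd[of 0] by simp
  have Spi: "S pi = 0" using odd[of pi] per[of "- pi"] by simp
  have pos: "0 \<le> S x" if "0 \<le> x" "x \<le> pi" for x
    using concave_on_ge_min[OF conc, of x] that S0 Spi by simp
  have refl_odd: "S (2 * pi - x) = - S x" for x using odd[of x] per[of "- x"] by simp
  \<comment> \<open>Reflection in pi/2 moves the end point pi to 0, where subadditivity of concave
    functions is available.\<close>
  have conc': "concave_on {0..pi} (\<lambda>x. S (pi - x))"
    unfolding concave_on_iff
  proof (intro conjI ballI allI impI)
    fix x y u v :: real
    assume xy: "x \<in> {0..pi}" "y \<in> {0..pi}" and uv: "0 \<le> u" "0 \<le> v" "u + v = 1"
    have "u * S (pi - x) + v * S (pi - y) \<le> S (u *\<^sub>R (pi - x) + v *\<^sub>R (pi - y))"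
      using conc xy uv unfolding concave_on_iff by auto
    moreover have "u *\<^sub>R (pi - x) + v *\<^sub>R (pi - y) = (u + v) * pi - (u *\<^sub>R x + v *\<^sub>R y)"
      by (simp add: algebra_simps)
    then have "u *\<^sub>R (pi - x) + v *\<^sub>R (pi - y) = pi - (u *\<^sub>R x + v *\<^sub>R y)"
      unfolding uv(3) by simp
    ultimately show "u * S (pi - x) + v * S (pi - y) \<le> S (pi - (u *\<^sub>R x + v *\<^sub>R y))" by simp
  qed simp
  have main: "S (t + s) + S (t - s) \<le> 2 * S t" if s: "0 \<le> s" "s \<le> pi" for s
  proof (cases "s \<le> t"; cases "t + s \<le> pi")
    assume c: "s \<le> t" "t + s \<le> pi"
    have "(1 - 1 / 2) * S (t + s) + 1 / 2 * S (t - s) \<le> S ((1 - 1 / 2) *\<^sub>R (t + s) + (1 / 2) *\<^sub>R (t - s))"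
      using c t s by (intro concave_onD[OF conc]) auto
    moreover have "(1 - 1 / 2) *\<^sub>R (t + s) + (1 / 2) *\<^sub>R (t - s) = t" by (simp add: field_simps)
    ultimately show ?thesis by simp
  next
    assume c: "\<not> s \<le> t" "t + s \<le> pi"
    have "S ((s - t) + (t + t)) \<le> S (s - t) + S (t + t)"
      using c t by (intro concave_on_subadditive[OF conc S0]) auto
    moreover have "S (t + t) \<le> S t + S t" using c t by (intro concave_on_subadditive[OF conc S0]) auto
    moreover have "S (t - s) = - S (s - t)" using odd[of "s - t"] by simp
    moreover have "(s - t) + (t + t) = t + s" by simp
    ultimately show ?thesis by simp
  next
    assume c: "s \<le> t" "\<not> t + s \<le> pi"
    let ?t = "pi - t"
    have c': "concave_on {0..pi} (\<lambda>x. S (pi - x))" "S (pi - 0) = 0" using conc' Spi by auto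
    have "S (pi - ((s - ?t) + (?t + ?t))) \<le> S (pi - (s - ?t)) + S (pi - (?t + ?t))"
      using c t s by (intro concave_on_subadditive[of pi "\<lambda>x. S (pi - x)", OF c']) auto
    moreover have "S (pi - (?t + ?t)) \<le> S (pi - ?t) + S (pi - ?t)"
      using c t s by (intro concave_on_subadditive[of pi "\<lambda>x. S (pi - x)", OF c']) auto
    moreover have "S (t + s) = - S (pi - (s - ?t))" using refl_odd[of "t + s"] by (simp add: algebra_simps)
    moreover have "pi - ((s - ?t) + (?t + ?t)) = t - s" "pi - ?t = t" by auto
    ultimately show ?thesis by simp
  next
    assume c: "\<not> s \<le> t" "\<not> t + s \<le> pi"
    have "S (t - s) = - S (s - t)" using odd[of "s - t"] by simp
    moreover have "0 \<le> S (s - t)" using c s t by (intro pos) auto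
    moreover have "S (t + s) = - S (2 * pi - (t + s))" using refl_odd[of "t + s"] by simp
    moreover have "0 \<le> S (2 * pi - (t + s))" using c s t by (intro pos) auto
    moreover have "0 \<le> S t" using pos t by simp
    ultimately show ?thesis by linarith
  qed
  obtain s' m where s: "s = s' + 2 * pi * of_int m" "- pi < s'" "s' \<le> pi" by (rule period_representative)
  have "S (t + s) = S (t + s')" "S (t - s) = S (t - s')"
    using periodic_add_int[of S "t + s'" m] periodic_add_int[of S "t - s'" "- m"] per
    by (simp_all add: s algebra_simps)
  moreover have "S (t + s') + S (t - s') \<le> 2 * S t"
  proof (cases "0 \<le> s'")
    case True then show ?thesis using main s by simp
  next
    case False then show ?thesis using main[of "- s'"] s by simp
  qed
  ultimately show ?thesis by simp
qed

text \<open>On (0, pi] the function is linear, and at 0 its value 0 lies below the value pi of that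
  line; a drop at an end point preserves concavity.\<close>

lemma saw_concave: "concave_on {0..pi} saw"
proof -
  have le: "saw t \<le> pi - t" if "t \<in> {0..pi}" for t
    using that saw_eq[of t] saw_0 by (cases "t = 0") auto
  show ?thesis
    unfolding concave_on_iff
  proof (intro conjI ballI allI impI)
    fix x y u v :: real
    assume xy: "x \<in> {0..pi}" "y \<in> {0..pi}" and uv: "0 \<le> u" "0 \<le> v" "u + v = 1"
    let ?z = "u *\<^sub>R x + v *\<^sub>R y"
    show "u * saw x + v * saw y \<le> saw ?z"
    proof (cases "?z = 0")
      case True
      then have "u * x = 0" "v * y = 0" using xy uv by (auto simp: add_nonneg_eq_0_iff)
      then have z: "u * saw x = 0" "v * saw y = 0" using saw_0 by auto
      show ?thesis unfolding z True saw_0 by simp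
    next
      case False
      have z: "0 \<le> ?z" "?z \<le> pi" using xy uv convex_bound_le[of x pi y u v] by auto
      have "u * saw x + v * saw y \<le> u * (pi - x) + v * (pi - y)"
        using le xy uv by (intro add_mono mult_left_mono) auto
      also have "\<dots> = (u + v) * pi - ?z" by (simp add: algebra_simps)
      also have "\<dots> = pi - ?z" unfolding uv(3) by simp
      also have "\<dots> = saw ?z" using z False pi_gt_zero by (intro saw_eq[symmetric]) linarith+
      finally show ?thesis .
    qed
  qed simp
qed

lemma saw_three_point:
  assumes "0 \<le> t" "t \<le> pi"
  shows "saw (t + s) + saw (t - s) \<le> 2 * saw t"
  using odd_concave_three_point[OF saw_minus _ saw_concave assms] saw_shift[of _ 1] by simp

section \<open>Concavity of sine series with convex coefficients\<close>

lemma abs_sin_nat_le: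
  assumes "0 \<le> t" "t \<le> pi"
  shows "\<bar>sin (real n * t)\<bar> \<le> real n * sin t"
proof (induction n)
  case (Suc n)
  have s: "0 \<le> sin t" using assms by (rule sin_ge_zero)
  have "real (Suc n) * t = real n * t + t" by (simp add: algebra_simps)
  then have "\<bar>sin (real (Suc n) * t)\<bar> \<le> \<bar>sin (real n * t)\<bar> * \<bar>cos t\<bar> + \<bar>cos (real n * t)\<bar> * \<bar>sin t\<bar>"
    by (simp only: sin_add abs_mult[symmetric] abs_triangle_ineq)
  also have "\<dots> \<le> \<bar>sin (real n * t)\<bar> * 1 + 1 * \<bar>sin t\<bar>"
    by (intro add_mono mult_left_mono mult_right_mono) auto
  also have "\<dots> \<le> real (Suc n) * sin t" using Suc s by (simp add: algebra_simps)
  finally show ?case .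
qed simp

text \<open>Multiplication by 2 (1 - cos t) is minus the second difference on sin(mt). It collapses
  the sum to (n + 1) sin t - sin((n + 1) t), which is nonnegative on [0, pi].\<close>

lemma fejer_sine_nonneg:
  assumes "0 \<le> t" "t \<le> pi"
  shows "0 \<le> (\<Sum>k<n. (real n - real k) * sin (real (Suc k) * t))"
proof (cases "t = 0")
  case False
  have step: "2 * (1 - cos t) * sin (real (Suc m) * t)
     = 2 * sin (real (Suc m) * t) - sin (real (Suc (Suc m)) * t) - sin (real m * t)" for m
  proof -
    have e: "real (Suc (Suc m)) * t = real (Suc m) * t + t" "real m * t = real (Suc m) * t - t"
      by (simp_all add: algebra_simps)
    show ?thesis unfolding e by (simp add: sin_add sin_diff algebra_simps del: of_nat_Suc)
  qed
  have D: "2 * (1 - cos t) * (\<Sum>k<m. sin (real (Suc k) * t)) = sin t - sin (real (Suc m) * t) + sin (real m * t)" for m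
  proof (induction m)
    case (Suc m)
    then show ?case using step[of m] unfolding sum.lessThan_Suc distrib_left by linarith
  qed simp
  have A: "2 * (1 - cos t) * (\<Sum>k<n. (real n - real k) * sin (real (Suc k) * t)) = real (Suc n) * sin t - sin (real (Suc n) * t)"
  proof (induction n)
    case (Suc n)
    have "(\<Sum>k<Suc n. (real (Suc n) - real k) * sin (real (Suc k) * t))
       = (\<Sum>k<n. (real n - real k) * sin (real (Suc k) * t) + sin (real (Suc k) * t)) + sin (real (Suc n) * t)"
      by (simp add: algebra_simps del: of_nat_Suc) (simp add: algebra_simps)
    also have "\<dots> = (\<Sum>k<n. (real n - real k) * sin (real (Suc k) * t)) + (\<Sum>k<Suc n. sin (real (Suc k) * t))"
      by (simp add: sum.distrib)
    finally have "2 * (1 - cos t) * (\<Sum>k<Suc n. (real (Suc n) - real k) * sin (real (Suc k) * t))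
       = (real (Suc n) * sin t - sin (real (Suc n) * t)) + (sin t - sin (real (Suc (Suc n)) * t) + sin (real (Suc n) * t))"
      by (simp only: distrib_left Suc.IH D)
    also have "\<dots> = real (Suc (Suc n)) * sin t - sin (real (Suc (Suc n)) * t)" by (simp add: algebra_simps)
    finally show ?case .
  qed simp
  have "cos t < 1"
    using assms False cos_monotone_0_pi[of 0 t] by simp
  moreover have "0 \<le> real (Suc n) * sin t - sin (real (Suc n) * t)" using abs_sin_nat_le[OF assms, of "Suc n"] by linarith
  then have "0 \<le> 2 * (1 - cos t) * (\<Sum>k<n. (real n - real k) * sin (real (Suc k) * t))" unfolding A .
  ultimately show ?thesis by (simp add: zero_le_mult_iff)
qed simp

lemma summation_by_parts:
  fixes \<mu> x :: "nat \<Rightarrow> real"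
  shows "(\<Sum>k<N. \<mu> k * x k) = \<mu> N * (\<Sum>k<N. x k) + (\<Sum>k<N. (\<mu> k - \<mu> (Suc k)) * (\<Sum>j<Suc k. x j))"
proof (induction N)
  case (Suc N)
  then show ?case by (simp add: algebra_simps)
qed simp

text \<open>Two summations by parts express the sum through second differences of \<mu> and the
  Fejer sine sums, all nonnegative. The end conditions deal with the boundary terms:
  \<open>\<mu> N = 0\<close> removes the first, and with \<open>\<mu> (Suc N) \<le> 0\<close> the
  second is nonnegative.\<close>

lemma convex_sine_sum_nonneg:
  fixes \<mu> :: "nat \<Rightarrow> real"
  assumes t: "0 \<le> t" "t \<le> pi" and end0: "\<mu> N = 0" "\<mu> (Suc N) \<le> 0"
    and conv: "\<And>k. k < N \<Longrightarrow> 0 \<le> \<mu> k - 2 * \<mu> (Suc k) + \<mu> (Suc (Suc k))"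
  shows "0 \<le> (\<Sum>k<N. \<mu> k * sin (real (Suc k) * t))"
proof -
  define X where "X n = (\<Sum>k<n. sin (real (Suc k) * t))" for n
  define Y where "Y n = (\<Sum>k<n. X (Suc k))" for n
  have "Y n = (\<Sum>k<n. (real n - real k) * sin (real (Suc k) * t))" for n
  proof (induction n)
    case (Suc n)
    have "Y (Suc n) = (\<Sum>k<n. (real n - real k) * sin (real (Suc k) * t)) + (\<Sum>k<Suc n. sin (real (Suc k) * t))"
      using Suc by (simp add: Y_def X_def)
    also have "\<dots> = (\<Sum>k<n. (real n - real k) * sin (real (Suc k) * t) + sin (real (Suc k) * t)) + sin (real (Suc n) * t)"
      by (simp add: sum.distrib)
    also have "\<dots> = (\<Sum>k<Suc n. (real (Suc n) - real k) * sin (real (Suc k) * t))"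
      by (simp add: algebra_simps del: of_nat_Suc) (simp add: algebra_simps)
    finally show ?case .
  qed (simp add: Y_def)
  then have Y: "0 \<le> Y n" for n using fejer_sine_nonneg[OF t] by simp
  have "(\<Sum>k<N. \<mu> k * sin (real (Suc k) * t)) = (\<Sum>k<N. (\<mu> k - \<mu> (Suc k)) * X (Suc k))"
    unfolding summation_by_parts[of \<mu>] X_def end0 by simp
  also have "\<dots> = (\<mu> N - \<mu> (Suc N)) * Y N
      + (\<Sum>k<N. ((\<mu> k - \<mu> (Suc k)) - (\<mu> (Suc k) - \<mu> (Suc (Suc k)))) * Y (Suc k))"
    unfolding summation_by_parts[of "\<lambda>k. \<mu> k - \<mu> (Suc k)"] Y_def ..
  also have "0 \<le> \<dots>"
    using Y end0 conv by (intro add_nonneg_nonneg mult_nonneg_nonneg sum_nonneg) (auto simp: algebra_simps)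
  finally show ?thesis .
qed

text \<open>Midpoint convexity from two inequalities: (x - 1)(x + 1) <= x^2 compares the middle
  value with a geometric mean, which is at most the arithmetic mean.\<close>

lemma powr_minus_convex:
  assumes "0 \<le> q" "1 < x"
  shows "2 * x powr - q \<le> (x - 1) powr - q + (x + 1) powr - (q::real)"
proof -
  define y where "y = (x - 1) powr (- q / 2)"
  define z where "z = (x + 1) powr (- q / 2)"
  have "x powr - q = (x * x) powr (- q / 2)" using assms by (simp add: powr_mult powr_add[symmetric])
  also have "\<dots> \<le> ((x - 1) * (x + 1)) powr (- q / 2)"
    using assms by (intro powr_mono2') (auto simp: algebra_simps less_1_mult)
  also have "\<dots> = y * z" using assms by (simp add: powr_mult y_def z_def)
  finally have "2 * x powr - q \<le> 2 * y * z" by simp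
  also have "\<dots> \<le> y * y + z * z" using sum_squares_bound[of y z] by (simp add: power2_eq_square)
  also have "\<dots> = (x - 1) powr - q + (x + 1) powr - q"
    by (simp add: y_def z_def powr_add[symmetric])
  finally show ?thesis .
qed

text \<open>The Fejer factor keeps the weights convex while making the sum finite; two summations by parts
  then reduce the second derivative to nonnegative Fejer sine sums.\<close>
lemma sine_series_concave_partial:
  assumes q: "0 \<le> q"
  shows "concave_on {0..pi} (\<lambda>t. \<Sum>k<N. max 0 (1 - real k / real N) * real (Suc k) powr - q * (2 * sin (real (Suc k) * t) / (real (Suc k))\<^sup>2))"
proof (cases "N = 0")
  case False
  define p where "p k = max 0 (1 - real k / real N)" for k
  define l where "l k = real (Suc k) powr - q" for k
  define \<mu> where "\<mu> k = p k * l k" for k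
  have p: "0 \<le> p k" "p (Suc k) \<le> p k" "p (Suc k) - p (Suc (Suc k)) \<le> p k - p (Suc k)" for k
    using False by (auto simp: p_def max_def divide_simps)
  have l: "0 \<le> l k" "l (Suc k) \<le> l k" "2 * l (Suc k) \<le> l k + l (Suc (Suc k))" for k
  proof -
    show "0 \<le> l k" by (simp add: l_def)
    show "l (Suc k) \<le> l k" unfolding l_def using q by (intro powr_mono2') auto
    show "2 * l (Suc k) \<le> l k + l (Suc (Suc k))"
      using powr_minus_convex[OF q, of "real (Suc (Suc k))"] by (simp add: l_def add_ac)
  qed
  have \<mu>_N: "\<mu> k = 0" if "N \<le> k" for k using False that by (simp add: \<mu>_def p_def)
  have \<mu>_conv: "0 \<le> \<mu> k - 2 * \<mu> (Suc k) + \<mu> (Suc (Suc k))" for k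
  proof -
    \<comment> \<open>The second difference of the product p l is p(k+1) times the second difference
      of l, plus (p(k) - p(k+1)) l(k) - (p(k+1) - p(k+2)) l(k+2). The difference of the last two
      products is nonnegative since the decrements of p and the values of l are
      nonincreasing.\<close>
    have "0 \<le> p (Suc k) * (l k + l (Suc (Suc k)) - 2 * l (Suc k))" using p l by (intro mult_nonneg_nonneg) auto
    moreover have "(p (Suc k) - p (Suc (Suc k))) * l (Suc (Suc k)) \<le> (p k - p (Suc k)) * l k"
      using p l order_trans[OF l(2) l(2)] by (intro mult_mono) auto
    ultimately show ?thesis unfolding \<mu>_def by (simp add: algebra_simps)
  qed
  let ?f = "\<lambda>t. - (\<Sum>k<N. \<mu> k * (2 * sin (real (Suc k) * t) / (real (Suc k))\<^sup>2))"
  let ?f' = "\<lambda>t. - (\<Sum>k<N. \<mu> k * (2 * cos (real (Suc k) * t) / real (Suc k)))"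
  have "convex_on {0..pi} ?f"
  proof (rule convex_on_realI[where f'="?f'"])
    have "((\<lambda>t. \<mu> k * (2 * sin (real (Suc k) * t) / (real (Suc k))\<^sup>2)) has_real_derivative
        \<mu> k * (2 * cos (real (Suc k) * t) / real (Suc k))) (at t)" for k t
      by (auto intro!: derivative_eq_intros simp: power2_eq_square mult_ac simp del: of_nat_Suc)
    then show "(?f has_real_derivative ?f' t) (at t)" for t
      by (intro DERIV_minus DERIV_sum)
    fix x y assume xy: "x \<in> {0..pi}" "y \<in> {0..pi}" "x \<le> y"
    show "?f' x \<le> ?f' y"
    proof (rule DERIV_nonneg_imp_nondecreasing[OF xy(3)])
      fix t assume t: "x \<le> t" "t \<le> y"
      have "((\<lambda>t. \<mu> k * (2 * cos (real (Suc k) * t) / real (Suc k))) has_real_derivative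
        - (2 * (\<mu> k * sin (real (Suc k) * t)))) (at t)" for k
        by (auto intro!: derivative_eq_intros simp: mult_ac simp del: of_nat_Suc)
      then have "(?f' has_real_derivative - (\<Sum>k<N. - (2 * (\<mu> k * sin (real (Suc k) * t))))) (at t)"
        by (intro DERIV_minus DERIV_sum)
      moreover have "0 \<le> (\<Sum>k<N. \<mu> k * sin (real (Suc k) * t))"
        using xy t \<mu>_N \<mu>_conv by (intro convex_sine_sum_nonneg) auto
      then have "0 \<le> - (\<Sum>k<N. - (2 * (\<mu> k * sin (real (Suc k) * t))))"
        by (simp add: sum_negf sum_distrib_left[symmetric] del: of_nat_Suc)
      ultimately show "\<exists>y. (?f' has_real_derivative y) (at t) \<and> 0 \<le> y" by blast
    qed
  qed simp
  then show ?thesis unfolding concave_on_def \<mu>_def p_def l_def .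
qed (simp add: concave_on_const)

lemma summable_Suc_powr:
  assumes "1 < r"
  shows "summable (\<lambda>k. c / real (Suc k) powr r)"
proof -
  have "summable (\<lambda>k. real (Suc k) powr - r)"
    using assms summable_Suc_iff[of "\<lambda>k. real k powr - r"] summable_real_powr_iff[of "- r"] by simp
  then show ?thesis using summable_mult[of "\<lambda>k. real (Suc k) powr - r" c] by (simp add: powr_minus divide_inverse)
qed

lemma concave_on_pointwise_limit:
  fixes f :: "nat \<Rightarrow> real \<Rightarrow> real"
  assumes "\<And>n. concave_on A (f n)" "\<And>x. (\<lambda>n. f n x) \<longlonglongrightarrow> g x"
  shows "concave_on A g"
  unfolding concave_on_iff
proof (intro conjI ballI allI impI)
  show "convex A" using assms(1) by (rule concave_on_imp_convex)
  fix x y u v assume *: "x \<in> A" "y \<in> A" "(0::real) \<le> u" "0 \<le> v" "u + v = 1"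
  show "u * g x + v * g y \<le> g (u *\<^sub>R x + v *\<^sub>R y)"
  proof (rule LIMSEQ_le)
    show "(\<lambda>n. u * f n x + v * f n y) \<longlonglongrightarrow> u * g x + v * g y" by (intro tendsto_intros assms)
    show "(\<lambda>n. f n (u *\<^sub>R x + v *\<^sub>R y)) \<longlonglongrightarrow> g (u *\<^sub>R x + v *\<^sub>R y)" by (rule assms)
    show "\<exists>N. \<forall>n\<ge>N. u * f n x + v * f n y \<le> f n (u *\<^sub>R x + v *\<^sub>R y)"
      using assms(1) * unfolding concave_on_iff by auto
  qed
qed

definition sine_series :: "real \<Rightarrow> real \<Rightarrow> real" where
  "sine_series r t = (\<Sum>k. 2 / real (Suc k) powr r * sin (real (Suc k) * t))"

lemma summable_mult_bounded:
  fixes c d :: "nat \<Rightarrow> real"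
  assumes "summable (\<lambda>k. \<bar>c k\<bar>)" "\<And>k. \<bar>d k\<bar> \<le> B"
  shows "summable (\<lambda>k. \<bar>c k * d k\<bar>)"
proof (rule summable_comparison_test'[OF summable_mult2[OF assms(1), of B]])
  show "norm \<bar>c k * d k\<bar> \<le> \<bar>c k\<bar> * B" for k using assms(2)[of k] by (simp add: abs_mult mult_left_mono)
qed

lemma summable_trig:
  assumes "1 < r" "\<And>k. \<bar>d k\<bar> \<le> B"
  shows "summable (\<lambda>k. \<bar>2 / real (Suc k) powr r * d k\<bar>)"
  using summable_Suc_powr[OF assms(1), of 2] by (intro summable_mult_bounded[OF _ assms(2)]) (simp del: of_nat_Suc)

text \<open>The exponent is split as (r - 2) + 2: the square is used up by two derivatives, and r >=
  2 makes the remaining weights nonincreasing and convex. The Fejer weights tend to 1 and stay in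
  [0, 1], so Tannery's theorem transfers concavity from the finite sums.\<close>

lemma sine_series_concave:
  assumes "2 \<le> r"
  shows "concave_on {0..pi} (sine_series r)"
proof (rule concave_on_pointwise_limit)
  have q: "0 \<le> r - 2" using assms by simp
  show "concave_on {0..pi} (\<lambda>t. \<Sum>k<Suc N. max 0 (1 - real k / real (Suc N)) * real (Suc k) powr - (r - 2) * (2 * sin (real (Suc k) * t) / (real (Suc k))\<^sup>2))" for N
    by (rule sine_series_concave_partial[OF q])
  fix t
  define d where "d k = 2 / real (Suc k) powr r * sin (real (Suc k) * t)" for k
  have eq: "real (Suc k) powr - (r - 2) * (2 * sin (real (Suc k) * t) / (real (Suc k))\<^sup>2) = d k" for k
  proof -
    have "real (Suc k) powr - (r - 2) = (real (Suc k))\<^sup>2 / real (Suc k) powr r"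
      by (simp add: powr_diff powr_numeral del: of_nat_Suc)
    then show ?thesis by (simp add: d_def field_simps del: of_nat_Suc)
  qed
  have sd: "summable (\<lambda>k. \<bar>d k\<bar>)" unfolding d_def using assms by (intro summable_trig[where B=1]) auto
  let ?a = "\<lambda>k N. max 0 (1 - real k / real (Suc N)) * d k"
  have "((\<lambda>N. \<Sum>k. ?a k N) \<longlongrightarrow> suminf d) sequentially"
  proof (rule tannerys_theorem[THEN conjunct2, THEN conjunct2])
    show "summable (\<lambda>k. \<bar>d k\<bar>)" by (rule sd)
    fix k
    have "filterlim (\<lambda>N. real (Suc N)) at_top sequentially"
      by (rule filterlim_compose[OF filterlim_real_sequentially filterlim_Suc])
    then have "(\<lambda>N. real k / real (Suc N)) \<longlonglongrightarrow> 0" by (rule real_tendsto_divide_at_top[OF tendsto_const])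
    then have "(\<lambda>N. max 0 (1 - real k / real (Suc N)) * d k) \<longlonglongrightarrow> max 0 (1 - 0) * d k" by (intro tendsto_intros)
    then show "(\<lambda>N. ?a k N) \<longlonglongrightarrow> d k" by simp
  next
    have "norm (?a k N) \<le> \<bar>d k\<bar>" for k N
      by (simp add: abs_mult mult_left_le_one_le)
    then show "\<forall>\<^sub>F (k, N) in sequentially \<times>\<^sub>F sequentially. norm (?a k N) \<le> \<bar>d k\<bar>"
      by (intro always_eventually) auto
  qed simp
  moreover have "(\<Sum>k. ?a k N) = (\<Sum>k<Suc N. ?a k N)" for N
    by (rule suminf_finite) (auto simp: max_def divide_simps)
  ultimately show "(\<lambda>N. \<Sum>k<Suc N. max 0 (1 - real k / real (Suc N)) * real (Suc k) powr - (r - 2) * (2 * sin (real (Suc k) * t) / (real (Suc k))\<^sup>2)) \<longlonglongrightarrow> sine_series r t"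
    unfolding mult.assoc eq sine_series_def d_def by simp
qed

lemma sine_series_three_point:
  assumes r: "2 \<le> r" and t: "0 \<le> t" "t \<le> pi"
  shows "sine_series r (t + s) + sine_series r (t - s) \<le> 2 * sine_series r t"
proof (rule odd_concave_three_point[OF _ _ sine_series_concave[OF r] t])
  fix x
  have "summable (\<lambda>k. 2 / real (Suc k) powr r * sin (real (Suc k) * x))"
    using r by (intro summable_rabs_cancel[OF summable_trig[where B=1]]) auto
  from suminf_minus[OF this] show "sine_series r (- x) = - sine_series r x"
    by (simp add: sine_series_def del: of_nat_Suc)
  show "sine_series r (x + 2 * pi) = sine_series r x"
    using sin_Suc_shift[of _ x 1] by (simp add: sine_series_def del: of_nat_Suc)
qed

lemma sine_series_0: "sine_series r 0 = 0" "sine_series r pi = 0"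
  by (simp_all add: sine_series_def del: of_nat_Suc)

section \<open>Sign of sine and cosine series with multiplier 1 - \<Phi>\<close>

context positive_definite_sequence
begin

lemma pd_sine_series_nonneg:
  assumes r: "2 \<le> r" and t: "0 \<le> t" "t \<le> pi"
  shows "0 \<le> (\<Sum>k. 2 / real (Suc k) powr r * sin (real (Suc k) * t) * (1 - \<Phi> (Suc k)))"
proof (rule pd_series_nonneg)
  have s: "summable (\<lambda>k. \<bar>2 / real (Suc k) powr r * sin (real (Suc k) * x)\<bar>)" for x
    using r by (intro summable_trig[where B=1]) auto
  note s' = summable_rabs_cancel[OF s]
  show "summable (\<lambda>k. \<bar>2 / real (Suc k) powr r * sin (real (Suc k) * t)\<bar>)" by (rule s)
  have "0 \<le> sine_series r t"
    using concave_on_ge_min[OF sine_series_concave[OF r], of t] t sine_series_0[of r] by simp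
  then show "0 \<le> (\<Sum>k. 2 / real (Suc k) powr r * sin (real (Suc k) * t))" by (simp add: sine_series_def)
  fix x
  have "2 / real (Suc k) powr r * sin (real (Suc k) * t) * (1 - cos (real (Suc k) * x))
    = 2 / real (Suc k) powr r * sin (real (Suc k) * t)
     - 1 / 2 * (2 / real (Suc k) powr r * sin (real (Suc k) * (t + x)) + 2 / real (Suc k) powr r * sin (real (Suc k) * (t - x)))" for k
    by (simp add: distrib_left right_diff_distrib sin_add sin_diff del: of_nat_Suc)
  then have "(\<Sum>k. 2 / real (Suc k) powr r * sin (real (Suc k) * t) * (1 - cos (real (Suc k) * x)))
    = sine_series r t - 1 / 2 * (sine_series r (t + x) + sine_series r (t - x))"
    unfolding sine_series_def
    by (simp only: suminf_diff[OF s' summable_mult[OF summable_add[OF s' s']], symmetric] suminf_mult[OF summable_add[OF s' s']] suminf_add[OF s' s'])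
  then show "0 \<le> (\<Sum>k. 2 / real (Suc k) powr r * sin (real (Suc k) * t) * (1 - cos (real (Suc k) * x)))"
    using sine_series_three_point[OF r t, of x] by simp
qed

text \<open>Integrating the sawtooth over [a, b] gives cosine differences with coefficients 2 / k^2,
  which converge absolutely, so the positivity lemma applies. The result serves twice: as the
  integrated form of the sine kernel with r = 1, and as monotonicity of the cosine kernel with r =
  2.\<close>

lemma pd_cosine_series_2_decreasing:
  assumes ab: "0 \<le> a" "a \<le> b" "b \<le> pi"
  shows "0 \<le> (\<Sum>k. 2 / real (Suc k) powr 2 * (cos (real (Suc k) * a) - cos (real (Suc k) * b)) * (1 - \<Phi> (Suc k)))"
proof (rule pd_series_nonneg)
  let ?c = "\<lambda>k x y. 2 / real (Suc k) powr 2 * (cos (real (Suc k) * x) - cos (real (Suc k) * y))"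
  have cb: "\<bar>cos u - cos v\<bar> \<le> 2" for u v :: real
    using cos_ge_minus_one[of u] cos_le_one[of u] cos_ge_minus_one[of v] cos_le_one[of v] by linarith
  have s: "summable (\<lambda>k. \<bar>?c k x y\<bar>)" for x y by (intro summable_trig[where B=2] cb) simp
  note s' = summable_rabs_cancel[OF s]
  show "summable (\<lambda>k. \<bar>?c k a b\<bar>)" by (rule s)
  have saw_series: "(\<lambda>n. \<Sum>k<n. 2 / real (Suc k) * sin (real (Suc k) * t)) \<longlonglongrightarrow> saw t"
    "\<bar>\<Sum>k<n. 2 / real (Suc k) * sin (real (Suc k) * t)\<bar> \<le> 3 * pi + 2" for n t
    using saw_lim[of t] saw_bound[of t n] by (simp_all del: of_nat_Suc)
  have saw_int: "saw integrable_on {x..y}" if "x \<le> y" for x y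
    using integral_bounded_sin_series(1)[OF saw_series that] absolutely_integrable_on_def by blast
  have saw_integral: "(\<Sum>k. ?c k x y) = integral {x..y} saw" if "x \<le> y" for x y
  proof -
    have "(\<lambda>n. \<Sum>k<n. ?c k x y) \<longlonglongrightarrow> integral {x..y} saw"
      using integral_bounded_sin_series(2)[OF saw_series that] by (simp add: powr_numeral power2_eq_square del: of_nat_Suc)
    then have "(\<lambda>k. ?c k x y) sums integral {x..y} saw" unfolding sums_def .
    then show ?thesis by (rule sums_unique[symmetric])
  qed
  show "0 \<le> (\<Sum>k. ?c k a b)"
    unfolding saw_integral[OF ab(2)]
  proof (rule integral_nonneg[OF saw_int[OF ab(2)]])
    fix x assume "x \<in> {a..b}"
    then show "0 \<le> saw x" using ab saw_eq[of x] saw_0 pi_gt_zero by (cases "x = 0") auto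
  qed
  fix s
  have "?c k a b * (1 - cos (real (Suc k) * s)) = ?c k a b - 1 / 2 * (?c k (a + s) (b + s) + ?c k (a - s) (b - s))" for k
    by (simp add: distrib_left right_diff_distrib cos_add cos_diff left_diff_distrib del: of_nat_Suc)
  then have "(\<Sum>k. ?c k a b * (1 - cos (real (Suc k) * s)))
     = (\<Sum>k. ?c k a b) - 1 / 2 * ((\<Sum>k. ?c k (a + s) (b + s)) + (\<Sum>k. ?c k (a - s) (b - s)))"
    by (simp only: suminf_diff[OF s' summable_mult[OF summable_add[OF s' s']], symmetric] suminf_mult[OF summable_add[OF s' s']] suminf_add[OF s' s'])
  also have "\<dots> = integral {a..b} saw - 1 / 2 * (integral {a + s..b + s} saw + integral {a - s..b - s} saw)"
    using ab by (simp only: saw_integral add_right_mono diff_right_mono)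
  \<comment> \<open>Translating both shifted integrals back to [a, b] puts the three-point
    inequality of \<open>saw\<close> under a single integral.\<close>
  also have "integral {a + s..b + s} saw = integral {a..b} (\<lambda>x. saw (x + s))"
    using integral_shift_real_ivl[of "a + s" s "b + s" saw] by simp
  also have "integral {a - s..b - s} saw = integral {a..b} (\<lambda>x. saw (x - s))"
    using integral_shift_real_ivl[of "a - s" "- s" "b - s" saw] by simp
  also have "0 \<le> integral {a..b} saw - 1 / 2 * (integral {a..b} (\<lambda>x. saw (x + s)) + integral {a..b} (\<lambda>x. saw (x - s)))"
  proof -
    have i1: "(\<lambda>x. saw (x + s)) integrable_on {a..b}"
      using integrable_shift_real_ivl[OF saw_int[of "a + s" "b + s"], of s] ab by simp
    have i2: "(\<lambda>x. saw (x - s)) integrable_on {a..b}"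
      using integrable_shift_real_ivl[OF saw_int[of "a - s" "b - s"], of "- s"] ab by simp
    have "integral {a..b} (\<lambda>x. saw (x + s)) + integral {a..b} (\<lambda>x. saw (x - s)) = integral {a..b} (\<lambda>x. saw (x + s) + saw (x - s))"
      using i1 i2 by (simp add: Henstock_Kurzweil_Integration.integral_add)
    also have "\<dots> \<le> integral {a..b} (\<lambda>x. 2 * saw x)"
      using i1 i2 saw_int[OF ab(2)] ab
      by (intro integral_le integrable_add integrable_on_mult_right saw_three_point) auto
    finally show ?thesis by simp
  qed
  finally show "0 \<le> (\<Sum>k. ?c k a b * (1 - cos (real (Suc k) * s)))" .
qed

end

section \<open>Evaluation of the approximation error\<close>

lemma sgn_sin_facts:
  shows "(\<lambda>t::real. sgn (sin t)) \<in> borel_measurable borel" "countable {t. \<not> isCont (\<lambda>t::real. sgn (sin t)) t}"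
proof -
  show "(\<lambda>t::real. sgn (sin t)) \<in> borel_measurable borel" by measurable
  show "countable {t. \<not> isCont (\<lambda>t::real. sgn (sin t)) t}"
  proof (rule countable_subset)
    have "isCont (\<lambda>t. sgn (sin t)) t" if "sin t \<noteq> 0" for t :: real
      unfolding isCont_def using that by (intro tendsto_sgn tendsto_intros)
    then show "{t. \<not> isCont (\<lambda>t::real. sgn (sin t)) t} \<subseteq> (\<lambda>m::int. of_int m * pi) ` UNIV"
      by (auto simp: sin_zero_iff_int2 image_iff)
  qed simp
qed

lemma sgn_cos_facts:
  shows "(\<lambda>t::real. sgn (cos t)) \<in> borel_measurable borel" "countable {t. \<not> isCont (\<lambda>t::real. sgn (cos t)) t}"
proof -
  show "(\<lambda>t::real. sgn (cos t)) \<in> borel_measurable borel" by measurable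
  show "countable {t. \<not> isCont (\<lambda>t::real. sgn (cos t)) t}"
  proof (rule countable_subset)
    have "isCont (\<lambda>t. sgn (cos t)) t" if "cos t \<noteq> 0" for t :: real
      unfolding isCont_def using that by (intro tendsto_sgn tendsto_intros)
    moreover have "t \<in> (\<lambda>m::int. of_int m * pi - pi / 2) ` UNIV" if "cos t = 0" for t
    proof -
      have "sin (t + pi / 2) = 0" using that by (simp add: sin_add)
      then obtain m :: int where "t + pi / 2 = of_int m * pi" by (auto simp: sin_zero_iff_int2)
      then show ?thesis by (auto intro!: image_eqI[where x=m])
    qed
    ultimately show "{t. \<not> isCont (\<lambda>t::real. sgn (cos t)) t} \<subseteq> (\<lambda>m::int. of_int m * pi - pi / 2) ` UNIV"
      by blast
  qed simp
qed

lemma integrable_sgn_sin_mult: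
  "integrable period_measure (\<lambda>t. sgn (sin t) * sin (c * t))"
  "integrable period_measure (\<lambda>t. sgn (sin t) * cos (c * t))"
proof -
  have i: "integrable period_measure (\<lambda>t. sgn (sin t))"
    by (rule integrable_period_bounded[where B=1]) (auto intro!: borel_measurable_period sgn_sin_facts simp: sgn_real_def)
  show "integrable period_measure (\<lambda>t. sgn (sin t) * sin (c * t))"
    "integrable period_measure (\<lambda>t. sgn (sin t) * cos (c * t))"
    by (auto intro!: integrable_period_mult_bounded[OF i, where B=1] borel_measurable_period)
qed

text \<open>A square wave contains only odd frequencies; as the frequency is \<open>Suc k\<close>,
  they occur at even \<open>k\<close>.\<close>

lemma integral_sgn_sin_sin:
  "(LINT t|period_measure. sgn (sin t) * sin (real (Suc k) * t)) = (if even k then 4 / real (Suc k) else 0)"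
proof -
  let ?m = "real (Suc k)"
  let ?I = "(1 - (- 1) ^ Suc k) / ?m"
  have sin_pi: "sin (?m * pi) = 0" by (rule sin_npi)
  have cos_pi: "cos (?m * pi) = (- 1) ^ Suc k" by (rule cos_npi)
  have "((\<lambda>t. sin (?m * t)) has_integral (- cos (?m * pi) / ?m - (- cos (?m * 0) / ?m))) {0..pi}"
    by (intro fundamental_theorem_of_calculus)
       (auto intro!: derivative_eq_intros simp: has_real_derivative_iff_has_vector_derivative[symmetric] simp del: of_nat_Suc)
  moreover have "- cos (?m * pi) / ?m - (- cos (?m * 0) / ?m) = ?I"
    unfolding cos_pi by (simp add: add_divide_distrib del: of_nat_Suc)
  moreover have "sgn (sin t) * sin (?m * t) = sin (?m * t)" if "t \<in> {0..pi}" for t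
  proof (cases "t = 0 \<or> t = pi")
    case True then show ?thesis using sin_pi by auto
  next
    case False
    then have "0 < sin t" using that by (intro sin_gt_zero) auto
    then show ?thesis by simp
  qed
  ultimately have 1: "((\<lambda>t. sgn (sin t) * sin (?m * t)) has_integral ?I) {0..pi}"
    using has_integral_cong[of "{0..pi}" "\<lambda>t. sgn (sin t) * sin (?m * t)" "\<lambda>t. sin (?m * t)"] by simp
  have "((\<lambda>t. sgn (sin (- t)) * sin (?m * (- t))) has_integral ?I) {- pi..- 0}"
    using has_integral_reflect_lemma_real[OF 1] .
  then have 2: "((\<lambda>t. sgn (sin t) * sin (?m * t)) has_integral ?I) {- pi..0}" by (simp add: sgn_minus del: of_nat_Suc)
  have "((\<lambda>t. sgn (sin t) * sin (?m * t)) has_integral ?I + ?I) {- pi..pi}"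
    by (rule has_integral_combine[OF _ _ 2 1]) auto
  then have "integral {- pi..pi} (\<lambda>t. sgn (sin t) * sin (?m * t)) = ?I + ?I" by (rule integral_unique)
  then have "(LINT t|period_measure. sgn (sin t) * sin (?m * t)) = ?I + ?I"
    using lebesgue_integral_eq_integral[OF integrable_sgn_sin_mult(1), of ?m] by simp
  then show ?thesis by (cases "even k") (simp_all del: of_nat_Suc)
qed

lemma integral_sgn_sin_cos: "(LINT t|period_measure. sgn (sin t) * cos (c * t)) = 0"
proof -
  have "(LINT t|period_measure. sgn (sin (- t)) * cos (c * (- t))) = (LINT t|period_measure. sgn (sin t) * cos (c * t))"
    using integral_reflect_real[of pi "- pi" "\<lambda>t. sgn (sin t) * cos (c * t)"] by simp
  then show ?thesis by (simp add: sgn_minus)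
qed

text \<open>Translation by pi/2 reduces this to the square wave of sine. The alternating sign is
  sin((k + 1) pi / 2) for even k.\<close>

lemma integral_sgn_cos_cos:
  "(LINT t|period_measure. sgn (cos t) * cos (real (Suc k) * t)) = (if even k then 4 / real (Suc k) * (- 1) ^ (k div 2) else 0)"
proof -
  let ?m = "real (Suc k)"
  let ?F = "\<lambda>t. sgn (sin t) * cos (?m * (t - pi / 2))"
  have expand: "?F t = cos (?m * pi / 2) * (sgn (sin t) * cos (?m * t)) + sin (?m * pi / 2) * (sgn (sin t) * sin (?m * t))" for t
  proof -
    have "?m * (t - pi / 2) = ?m * t - ?m * pi / 2" by (simp add: right_diff_distrib)
    then show ?thesis by (simp only: cos_diff distrib_left mult_ac)
  qed
  have int: "integrable period_measure ?F"
    unfolding expand by (intro Bochner_Integration.integrable_add integrable_mult_right integrable_sgn_sin_mult)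
  have per: "?F (t + 2 * pi) = ?F t" for t
  proof -
    have "?m * (t + 2 * pi - pi / 2) = ?m * (t - pi / 2 + 2 * pi * of_int 1)" by simp
    then show ?thesis by (simp only: cos_Suc_shift sin_periodic)
  qed
  have "?F (t + pi / 2) = sgn (cos t) * cos (?m * t)" for t by (simp add: sin_add)
  then have "(LINT t|period_measure. sgn (cos t) * cos (?m * t)) = (LINT t|period_measure. ?F t)"
    using period_integral_translate[OF per int, of "pi / 2"] by (simp only: has_bochner_integral_iff)
  also have "\<dots> = cos (?m * pi / 2) * (LINT t|period_measure. sgn (sin t) * cos (?m * t))
       + sin (?m * pi / 2) * (LINT t|period_measure. sgn (sin t) * sin (?m * t))"
    unfolding expand using integrable_sgn_sin_mult by simp
  also have "\<dots> = sin (?m * pi / 2) * (if even k then 4 / ?m else 0)"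
    unfolding integral_sgn_sin_cos integral_sgn_sin_sin by simp
  also have "\<dots> = (if even k then 4 / ?m * (- 1) ^ (k div 2) else 0)"
  proof (cases "even k")
    case True
    then obtain j where j: "k = 2 * j" by auto
    have "?m * pi / 2 = real j * pi + pi / 2" by (simp add: j field_simps)
    then have "sin (?m * pi / 2) = sin (real j * pi + pi / 2)" by (simp only:)
    then have "sin (?m * pi / 2) = (- 1) ^ j" by (simp add: sin_add)
    then show ?thesis using j by simp
  qed simp
  finally show ?thesis .
qed

text \<open>For an integer \<beta> the phase shift \<beta> pi / 2 turns cosine into plus or minus
  sine or cosine. The sign is cos(pi m) with m = \<beta> div 2, and since \<open>div\<close> rounds
  downwards this also covers negative \<beta>.\<close>

definition phase_sign :: "int \<Rightarrow> real" where
  "phase_sign \<beta> = (if even (\<beta> div 2) then 1 else - 1)"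

lemma phase_sign_mult: "phase_sign \<beta> * phase_sign \<beta> = 1" "\<bar>phase_sign \<beta>\<bar> = 1"
  by (auto simp: phase_sign_def)

lemma cos_phase_odd:
  assumes "odd \<beta>"
  shows "cos (x - of_int \<beta> * pi / 2) = phase_sign \<beta> * sin x"
proof -
  obtain m where \<beta>: "\<beta> = 2 * m + 1" using assms by (auto elim: oddE)
  have "x - of_int \<beta> * pi / 2 = (x - pi / 2) - pi * of_int m" by (simp add: \<beta> field_simps)
  moreover have "cos (pi * of_int m) = phase_sign \<beta>" by (simp add: phase_sign_def \<beta>)
  ultimately have "cos (x - of_int \<beta> * pi / 2) = cos (x - pi / 2) * phase_sign \<beta> + sin (x - pi / 2) * sin (pi * of_int m)"
    by (simp only: cos_diff[of "x - pi / 2"])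
  then show ?thesis by (simp add: cos_diff)
qed

lemma cos_phase_even:
  assumes "even \<beta>"
  shows "cos (x - of_int \<beta> * pi / 2) = phase_sign \<beta> * cos x"
proof -
  obtain m where \<beta>: "\<beta> = 2 * m" using assms by auto
  have "x - of_int \<beta> * pi / 2 = x - pi * of_int m" by (simp add: \<beta> field_simps)
  moreover have "cos (pi * of_int m) = phase_sign \<beta>" by (simp add: phase_sign_def \<beta>)
  ultimately have "cos (x - of_int \<beta> * pi / 2) = cos x * phase_sign \<beta> + sin x * sin (pi * of_int m)"
    by (simp only: cos_diff)
  then show ?thesis by simp
qed

lemma sums_even_index:
  fixes f :: "nat \<Rightarrow> real"
  assumes "(\<lambda>j. f (2 * j)) sums c"
  shows "(\<lambda>k. if even k then f k else 0) sums c"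
proof -
  have "strict_mono (\<lambda>j::nat. 2 * j)" by (auto simp: strict_mono_def)
  moreover have "(if even n then f n else 0) = 0" if "n \<notin> range (\<lambda>j::nat. 2 * j)" for n
    using that by (auto elim!: evenE)
  ultimately show ?thesis
    using sums_mono_reindex[of "\<lambda>j. 2 * j" "\<lambda>k. if even k then f k else 0" c] assms by simp
qed

section \<open>The kernels psi and their approximation errors\<close>

locale positive_definite_multiplier = positive_definite_sequence +
  fixes g :: "real \<Rightarrow> real"
  assumes g_int: "integrable period_measure g"
    and g_coeff: "\<And>k. fourier_coeff g (int k) = of_real (\<Phi> k)"
begin

lemma psi_kernel_gt_1:
  assumes r: "1 < r"
  shows "bounded_trig_kernel g (psi r \<beta>) (\<lambda>k. \<Phi> (Suc k)) (\<lambda>k. 2 / real (Suc k) powr r) (\<beta> * pi / 2) (\<Sum>k. 2 / real (Suc k) powr r)"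
proof
  let ?t = "\<lambda>k t. 2 / real (Suc k) powr r * cos (real (Suc k) * t - \<beta> * pi / 2)"
  have "summable (\<lambda>k. \<bar>?t k t\<bar>)" for t using r by (intro summable_trig[where B=1]) auto
  then have s: "summable (\<lambda>k. ?t k t)" for t by (rule summable_rabs_cancel)
  show "(\<lambda>n. \<Sum>k<n. ?t k t) \<longlonglongrightarrow> psi r \<beta> t" for t
    using summable_LIMSEQ[OF s[of t]] by (simp add: psi_def del: of_nat_Suc)
  fix n t
  have "\<bar>\<Sum>k<n. ?t k t\<bar> \<le> (\<Sum>k<n. \<bar>?t k t\<bar>)" by (rule sum_abs)
  also have "\<dots> \<le> (\<Sum>k<n. 2 / real (Suc k) powr r)"
    by (intro sum_mono) (simp add: abs_mult divide_right_mono del: of_nat_Suc)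
  also have "\<dots> \<le> (\<Sum>k. 2 / real (Suc k) powr r)"
    by (rule sum_le_suminf[OF summable_Suc_powr[OF r]]) auto
  finally show "\<bar>\<Sum>k<n. ?t k t\<bar> \<le> (\<Sum>k. 2 / real (Suc k) powr r)" .
qed (rule g_int, rule g_coeff)

lemma psi_1_partial:
  assumes "odd \<beta>"
  shows "(\<Sum>k<n. 2 / real (Suc k) powr 1 * cos (real (Suc k) * t - of_int \<beta> * pi / 2))
    = phase_sign \<beta> * (\<Sum>k<n. 2 * sin (real (Suc k) * t) / real (Suc k))"
  unfolding cos_phase_odd[OF assms] by (simp add: sum_distrib_left mult_ac del: of_nat_Suc)

lemma psi_1_lim:
  assumes "odd \<beta>"
  shows "(\<lambda>n. \<Sum>k<n. 2 / real (Suc k) powr 1 * cos (real (Suc k) * t - of_int \<beta> * pi / 2)) \<longlonglongrightarrow> phase_sign \<beta> * saw t"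
  unfolding psi_1_partial[OF assms] by (intro tendsto_mult_left saw_lim)

lemma psi_1_eq:
  assumes "odd \<beta>"
  shows "psi 1 (of_int \<beta>) t = phase_sign \<beta> * saw t"
proof -
  have "(\<lambda>k. 2 / real (Suc k) powr 1 * cos (real (Suc k) * t - of_int \<beta> * pi / 2)) sums (phase_sign \<beta> * saw t)"
    using psi_1_lim[OF assms] unfolding sums_def .
  then have "phase_sign \<beta> * saw t = (\<Sum>k. 2 / real (Suc k) powr 1 * cos (real (Suc k) * t - of_int \<beta> * pi / 2))"
    by (rule sums_unique)
  then show ?thesis by (simp add: psi_def del: of_nat_Suc)
qed

lemma psi_kernel_1:
  assumes "odd \<beta>"
  shows "bounded_trig_kernel g (psi 1 (of_int \<beta>)) (\<lambda>k. \<Phi> (Suc k)) (\<lambda>k. 2 / real (Suc k) powr 1) (of_int \<beta> * pi / 2) (3 * pi + 2)"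
proof
  show "(\<lambda>n. \<Sum>k<n. 2 / real (Suc k) powr 1 * cos (real (Suc k) * t - of_int \<beta> * pi / 2)) \<longlonglongrightarrow> psi 1 (of_int \<beta>) t" for t
    unfolding psi_1_eq[OF assms] by (rule psi_1_lim[OF assms])
  show "\<bar>\<Sum>k<n. 2 / real (Suc k) powr 1 * cos (real (Suc k) * t - of_int \<beta> * pi / 2)\<bar> \<le> 3 * pi + 2" for n t
    unfolding psi_1_partial[OF assms] abs_mult phase_sign_mult using saw_bound[of t n] by (simp del: of_nat_Suc)
qed (rule g_int, rule g_coeff)

lemma summable_multiplier:
  assumes "0 < r" "\<And>k. \<bar>d k\<bar> \<le> 1"
  shows "summable (\<lambda>j. (1 - \<Phi> (2 * j + 1)) / real (2 * j + 1) powr (r + 1) * d j)"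
proof (rule summable_comparison_test'[OF summable_Suc_powr[of "r + 1" "1 + C"]])
  show "1 < r + 1" using assms by simp
  fix j
  have "\<bar>1 - \<Phi> (2 * j + 1)\<bar> \<le> 1 + C" using \<Phi>_bound[of "2 * j + 1"] by linarith
  moreover have "real (Suc j) powr (r + 1) \<le> real (2 * j + 1) powr (r + 1)"
    using assms by (intro powr_mono2) auto
  ultimately have "\<bar>1 - \<Phi> (2 * j + 1)\<bar> / real (2 * j + 1) powr (r + 1) \<le> (1 + C) / real (Suc j) powr (r + 1)"
    by (intro frac_le) auto
  then have "\<bar>1 - \<Phi> (2 * j + 1)\<bar> / real (2 * j + 1) powr (r + 1) * \<bar>d j\<bar> \<le> (1 + C) / real (Suc j) powr (r + 1) * 1"
    using assms(2)[of j] \<Phi>_bound[of 0] by (intro mult_mono) auto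
  then show "norm ((1 - \<Phi> (2 * j + 1)) / real (2 * j + 1) powr (r + 1) * d j) \<le> (1 + C) / real (Suc j) powr (r + 1)"
    by (simp add: abs_mult)
qed

text \<open>The coefficient 2 of psi times the coefficient 4 of the square wave gives 8 = 2 pi * (4
  / pi), the source of the constant 4 / pi. The factor \<open>d\<close> is constantly 1 for sine and
  alternating for cosine.\<close>

lemma square_wave_coefficients_lim:
  assumes r: "0 < r" and d: "\<And>k. \<bar>d k\<bar> \<le> 1"
  shows "(\<lambda>n. \<Sum>k<n. 2 / real (Suc k) powr r * (1 - \<Phi> (Suc k)) * (if even k then 4 / real (Suc k) * d (k div 2) else 0))
    \<longlonglongrightarrow> 2 * pi * (4 / pi * (\<Sum>j. (1 - \<Phi> (2 * j + 1)) / real (2 * j + 1) powr (r + 1) * d j))"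
proof -
  let ?f = "\<lambda>k. 8 * ((1 - \<Phi> (Suc k)) / real (Suc k) powr (r + 1) * d (k div 2))"
  have "(\<lambda>j. ?f (2 * j)) sums (8 * (\<Sum>j. (1 - \<Phi> (2 * j + 1)) / real (2 * j + 1) powr (r + 1) * d j))"
    using sums_mult[OF summable_sums[OF summable_multiplier[OF r d]], of 8] by simp
  from sums_even_index[OF this]
  have "(\<lambda>k. if even k then ?f k else 0) sums (8 * (\<Sum>j. (1 - \<Phi> (2 * j + 1)) / real (2 * j + 1) powr (r + 1) * d j))" .
  moreover have "2 / real (Suc k) powr r * (1 - \<Phi> (Suc k)) * (if even k then 4 / real (Suc k) * d (k div 2) else 0)
     = (if even k then ?f k else 0)" for k
    by (auto simp: powr_add field_simps simp del: of_nat_Suc)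
  ultimately show ?thesis by (simp add: sums_def)
qed

text \<open>The kernel is continuous inside $(0, \pi)$, and its integrals are differences of the decreasing
  cosine series with $r = 2$.\<close>
lemma sine_kernel_nonneg_1:
  assumes \<beta>: "odd \<beta>" and t: "0 < t" "t < pi"
  shows "0 \<le> phase_sign \<beta> * bounded_trig_kernel.error_kernel g (psi 1 (of_int \<beta>)) t"
proof -
  interpret K: bounded_trig_kernel g "psi 1 (of_int \<beta>)" "\<lambda>k. \<Phi> (Suc k)" "\<lambda>k. 2 / real (Suc k) powr 1" "of_int \<beta> * pi / 2" "3 * pi + 2"
    using psi_kernel_1[OF \<beta>] .
  define L where "L t = phase_sign \<beta> * K.error_kernel t" for t
  define B where "B = 3 * pi + 2 + 1 / (2 * pi) * (LINT s|period_measure. (3 * pi + 2) * \<bar>g s\<bar>)"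
  have part: "(\<Sum>k<n. 2 / real (Suc k) * (1 - \<Phi> (Suc k)) * sin (real (Suc k) * t))
     = phase_sign \<beta> * (\<Sum>k<n. 2 / real (Suc k) powr 1 * (1 - \<Phi> (Suc k)) * cos (real (Suc k) * t - of_int \<beta> * pi / 2))" for n t
    unfolding cos_phase_odd[OF \<beta>] sum_distrib_left
    by (intro sum.cong refl) (simp add: mult.left_commute[of _ "phase_sign \<beta>"] mult.assoc[symmetric] phase_sign_mult del: of_nat_Suc)
  have L_lim: "(\<lambda>n. \<Sum>k<n. 2 / real (Suc k) * (1 - \<Phi> (Suc k)) * sin (real (Suc k) * t)) \<longlonglongrightarrow> L t" for t
    unfolding part L_def by (intro tendsto_mult_left K.error_kernel_lim)
  have L_bound: "\<bar>\<Sum>k<n. 2 / real (Suc k) * (1 - \<Phi> (Suc k)) * sin (real (Suc k) * t)\<bar> \<le> B" for n t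
    unfolding part abs_mult[of "phase_sign \<beta>"] phase_sign_mult B_def using K.error_kernel_partial_bound[of t n] by simp
  have L_int: "0 \<le> integral {x..y} L" if xy: "0 \<le> x" "x \<le> y" "y \<le> pi" for x y
  proof -
    have L_lim_int: "(\<lambda>n. \<Sum>k<n. 2 / real (Suc k) * (1 - \<Phi> (Suc k)) / real (Suc k) * (cos (real (Suc k) * x) - cos (real (Suc k) * y)))
        \<longlonglongrightarrow> integral {x..y} L"
      by (rule integral_bounded_sin_series(2)[OF L_lim L_bound xy(2)])
    let ?c = "\<lambda>k. 2 / real (Suc k) powr 2 * (cos (real (Suc k) * x) - cos (real (Suc k) * y)) * (1 - \<Phi> (Suc k))"
    have cb: "\<bar>(cos u - cos v) * (1 - \<Phi> k)\<bar> \<le> 2 * (1 + C)" for u v :: real and k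
    proof -
      have "\<bar>cos u - cos v\<bar> \<le> 2"
        using cos_ge_minus_one[of u] cos_le_one[of u] cos_ge_minus_one[of v] cos_le_one[of v] by linarith
      moreover have "\<bar>1 - \<Phi> k\<bar> \<le> 1 + C" using \<Phi>_bound[of k] by linarith
      ultimately show ?thesis unfolding abs_mult by (intro mult_mono) auto
    qed
    have "summable (\<lambda>k. \<bar>2 / real (Suc k) powr 2 * ((cos (real (Suc k) * x) - cos (real (Suc k) * y)) * (1 - \<Phi> (Suc k)))\<bar>)"
      by (intro summable_trig[OF _ cb]) simp
    then have "summable ?c" unfolding mult.assoc by (rule summable_rabs_cancel)
    then have c_lim: "(\<lambda>n. \<Sum>k<n. ?c k) \<longlonglongrightarrow> (\<Sum>k. ?c k)" by (rule summable_LIMSEQ)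
    have coeff: "2 / m powr 2 * u * w = 2 / m * w / m * u" if "0 < m" for m u w :: real
      using that by (simp add: powr_numeral power2_eq_square)
    have "?c k = 2 / real (Suc k) * (1 - \<Phi> (Suc k)) / real (Suc k) * (cos (real (Suc k) * x) - cos (real (Suc k) * y))" for k
      by (rule coeff) simp
    then have "(\<lambda>n. \<Sum>k<n. ?c k) = (\<lambda>n. \<Sum>k<n. 2 / real (Suc k) * (1 - \<Phi> (Suc k)) / real (Suc k) * (cos (real (Suc k) * x) - cos (real (Suc k) * y)))"
      by (simp only:)
    then have "integral {x..y} L = (\<Sum>k. ?c k)" using LIMSEQ_unique[OF L_lim_int] c_lim by (simp only:)
    then show ?thesis using pd_cosine_series_2_decreasing[OF xy] by (simp only:)
  qed
  have "isCont L t"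
  proof -
    have "sin (t / 2) \<noteq> 0" using t sin_gt_zero[of "t / 2"] by auto
    then have "isCont saw t" by (rule saw_isCont)
    then have 1: "isCont (psi 1 (of_int \<beta>)) t" unfolding psi_1_eq[OF \<beta>, abs_def] by (intro continuous_intros)
    \<comment> \<open>The convolution part of the kernel is continuous everywhere because the jumps
      of the sawtooth are countable; only psi itself restricts t to the open interval.\<close>
    have "{t. \<not> isCont (psi 1 (of_int \<beta>)) t} \<subseteq> {t. \<not> isCont saw t}"
      unfolding psi_1_eq[OF \<beta>, abs_def] by (auto intro: continuous_intros)
    then have "countable {t. \<not> isCont (psi 1 (of_int \<beta>)) t}" using saw_countable countable_subset by blast
    from continuous_period_conv[OF g_int K.kernel_borel K.kernel_bound this, of "- 1" t]
    have 2: "isCont (\<lambda>x. LINT s|period_measure. g s * psi 1 (of_int \<beta>) (x - s)) t" by simp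
    have "isCont (\<lambda>x. phase_sign \<beta> * (psi 1 (of_int \<beta>) x - 1 / (2 * pi) * (LINT s|period_measure. g s * psi 1 (of_int \<beta>) (x - s)))) t"
      by (intro continuous_intros 1 2)
    then show ?thesis unfolding L_def K.error_kernel_def .
  qed
  have "0 \<le> L t"
  proof (rule ccontr)
    assume neg: "\<not> 0 \<le> L t"
    then have "L t < L t / 2" by simp
    with \<open>isCont L t\<close> have "eventually (\<lambda>x. L x < L t / 2) (nhds t)"
      by (intro order_tendstoD(2)) (auto simp: isCont_def tendsto_at_iff_tendsto_nhds)
    then obtain d where d: "0 < d" "\<And>x. \<bar>x - t\<bar> < d \<Longrightarrow> L x < L t / 2"
      by (auto simp: eventually_nhds_metric dist_real_def)
    \<comment> \<open>Half of d keeps the closed interval around t inside the region where L is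
      below half of its negative value, and the other two bounds keep it inside [0, pi]. The
      integral over it would be negative.\<close>
    define e where "e = Min {d / 2, t, pi - t}"
    have e: "0 < e" "e < d" "e \<le> t" "e \<le> pi - t"
      using d(1) t by (auto simp: e_def min_def)
    have "integral {t - e..t + e} L \<le> integral {t - e..t + e} (\<lambda>_. L t / 2)"
    proof (rule integral_le)
      show "L integrable_on {t - e..t + e}"
        using integral_bounded_sin_series(1)[OF L_lim L_bound, of "t - e" "t + e"] e absolutely_integrable_on_def by auto
      fix x assume "x \<in> {t - e..t + e}"
      then have "\<bar>x - t\<bar> < d" using e by (auto simp: abs_le_iff)
      then show "L x \<le> L t / 2" using d(2)[of x] by simp
    qed auto
    also have "\<dots> = e * L t" using e by simp
    also have "\<dots> < 0" using e(1) neg by (simp add: mult_pos_neg)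
    finally show False using L_int[of "t - e" "t + e"] e by simp
  qed
  then show ?thesis by (simp add: L_def)
qed

lemma sine_kernel_nonneg:
  assumes \<beta>: "odd \<beta>" and r: "2 \<le> r" and t: "0 \<le> t" "t \<le> pi"
  shows "0 \<le> phase_sign \<beta> * bounded_trig_kernel.error_kernel g (psi r (of_int \<beta>)) t"
proof -
  interpret K: bounded_trig_kernel g "psi r (of_int \<beta>)" "\<lambda>k. \<Phi> (Suc k)" "\<lambda>k. 2 / real (Suc k) powr r" "of_int \<beta> * pi / 2" "\<Sum>k. 2 / real (Suc k) powr r"
    using r by (intro psi_kernel_gt_1) simp
  let ?c = "\<lambda>k. 2 / real (Suc k) powr r * sin (real (Suc k) * t) * (1 - \<Phi> (Suc k))"
  have b: "\<bar>sin u * (1 - \<Phi> k)\<bar> \<le> 1 * (1 + C)" for u k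
    unfolding abs_mult using \<Phi>_bound[of k] by (intro mult_mono) auto
  have "summable (\<lambda>k. \<bar>2 / real (Suc k) powr r * (sin (real (Suc k) * t) * (1 - \<Phi> (Suc k)))\<bar>)"
    using r by (intro summable_trig[OF _ b]) simp
  then have "summable ?c" unfolding mult.assoc by (rule summable_rabs_cancel)
  then have "(\<lambda>n. \<Sum>k<n. ?c k) \<longlonglongrightarrow> (\<Sum>k. ?c k)" by (rule summable_LIMSEQ)
  moreover have "(\<Sum>k<n. ?c k) = phase_sign \<beta> * (\<Sum>k<n. 2 / real (Suc k) powr r * (1 - \<Phi> (Suc k)) * cos (real (Suc k) * t - of_int \<beta> * pi / 2))" for n
    unfolding cos_phase_odd[OF \<beta>] sum_distrib_left
  proof (intro sum.cong refl)
    fix k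
    have "phase_sign \<beta> * (2 / real (Suc k) powr r * (1 - \<Phi> (Suc k)) * (phase_sign \<beta> * sin (real (Suc k) * t)))
       = (phase_sign \<beta> * phase_sign \<beta>) * ?c k" by (simp only: mult_ac)
    then show "?c k = phase_sign \<beta> * (2 / real (Suc k) powr r * (1 - \<Phi> (Suc k)) * (phase_sign \<beta> * sin (real (Suc k) * t)))"
      unfolding phase_sign_mult by simp
  qed
  moreover have "(\<lambda>n. phase_sign \<beta> * (\<Sum>k<n. 2 / real (Suc k) powr r * (1 - \<Phi> (Suc k)) * cos (real (Suc k) * t - of_int \<beta> * pi / 2)))
     \<longlonglongrightarrow> phase_sign \<beta> * K.error_kernel t"
    by (intro tendsto_mult_left K.error_kernel_lim)
  ultimately have "phase_sign \<beta> * K.error_kernel t = (\<Sum>k. ?c k)" using LIMSEQ_unique by simp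
  then show ?thesis using pd_sine_series_nonneg[OF r t] by simp
qed

text \<open>The kernel is odd, and up to the phase sign it is nonnegative on (0, pi), so it has the
  sign of sine and no constant is subtracted. At 0 and at plus or minus pi it vanishes by oddness
  and periodicity, in agreement with the zeros of the square wave.\<close>

lemma approx_error_odd:
  assumes \<beta>: "odd \<beta>" and r: "r = 1 \<or> 2 \<le> r" and p: "p = 1 \<or> p = \<infinity>"
  shows "approx_error (W_class r (of_int \<beta>) p) (\<lambda>f. convolution f g) p
    = ereal (4 / pi * (\<Sum>j. (1 - \<Phi> (2 * j + 1)) / real (2 * j + 1) powr (r + 1)))"
proof -
  obtain M where "bounded_trig_kernel g (psi r (of_int \<beta>)) (\<lambda>k. \<Phi> (Suc k)) (\<lambda>k. 2 / real (Suc k) powr r) (of_int \<beta> * pi / 2) M"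
    using psi_kernel_1[OF \<beta>] psi_kernel_gt_1[of r "of_int \<beta>"] r by fastforce
  then interpret K: bounded_trig_kernel g "psi r (of_int \<beta>)" "\<lambda>k. \<Phi> (Suc k)" "\<lambda>k. 2 / real (Suc k) powr r" "of_int \<beta> * pi / 2" M .
  let ?\<sigma> = "phase_sign \<beta>"
  define v where "v t = ?\<sigma> * sgn (sin t)" for t
  have odd: "K.error_kernel (- t) = - K.error_kernel t" for t
  proof (rule LIMSEQ_unique[OF K.error_kernel_lim])
    have "(\<Sum>k<n. 2 / real (Suc k) powr r * (1 - \<Phi> (Suc k)) * cos (real (Suc k) * (- t) - of_int \<beta> * pi / 2))
      = - (\<Sum>k<n. 2 / real (Suc k) powr r * (1 - \<Phi> (Suc k)) * cos (real (Suc k) * t - of_int \<beta> * pi / 2))" for n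
      unfolding cos_phase_odd[OF \<beta>] by (simp add: sum_negf[symmetric] del: of_nat_Suc)
    then show "(\<lambda>n. \<Sum>k<n. 2 / real (Suc k) powr r * (1 - \<Phi> (Suc k)) * cos (real (Suc k) * (- t) - of_int \<beta> * pi / 2))
       \<longlonglongrightarrow> - K.error_kernel t"
      by (simp only: tendsto_minus[OF K.error_kernel_lim])
  qed
  have pos: "0 \<le> ?\<sigma> * K.error_kernel t" if "0 < t" "t < pi" for t
    using r sine_kernel_nonneg_1[OF \<beta> that] sine_kernel_nonneg[OF \<beta>, of r t] that by auto
  have zero: "K.error_kernel 0 = 0" "K.error_kernel pi = 0"
  proof -
    show "K.error_kernel 0 = 0" using odd[of 0] by simp
    show "K.error_kernel pi = 0" using odd[of pi] K.error_kernel_periodic[of "- pi"] by simp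
  qed
  have v_eq: "\<bar>K.error_kernel t - 0\<bar> = v t * (K.error_kernel t - 0)" if "t \<in> {-pi..pi}" for t
  proof -
    have abs_eq: "\<bar>x\<bar> = ?\<sigma> * x" if "0 \<le> ?\<sigma> * x" for x
      using that phase_sign_mult(2)[of \<beta>] by (metis abs_mult abs_of_nonneg mult_1)
    have "- pi \<le> t" "t \<le> pi" using that by auto
    then consider "t = 0" | "t = pi" | "t = - pi" | "0 < t" "t < pi" | "- pi < t" "t < 0"
      by linarith
    then show ?thesis
    proof cases
      case 4
      then have "0 < sin t" by (intro sin_gt_zero)
      then show ?thesis using abs_eq[OF pos[OF 4]] by (simp add: v_def)
    next
      case 5
      then have "0 < sin (- t)" by (intro sin_gt_zero) auto
      then show ?thesis using abs_eq[OF pos[of "- t"]] 5 by (simp add: v_def odd)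
    qed (use zero odd[of pi] in auto)
  qed
  have v: "v \<in> borel_measurable borel" "\<bar>v t\<bar> \<le> 1" "v (t + pi) = - v t" "countable {t. \<not> isCont v t}" for t
  proof -
    show "v \<in> borel_measurable borel" unfolding v_def using sgn_sin_facts(1) by measurable
    show "\<bar>v t\<bar> \<le> 1" by (simp add: v_def abs_mult phase_sign_mult sgn_real_def)
    show "v (t + pi) = - v t" by (simp add: v_def sgn_minus)
    have "{t. \<not> isCont v t} \<subseteq> {t. \<not> isCont (\<lambda>t. sgn (sin t)) t}" unfolding v_def by (auto intro: continuous_intros)
    then show "countable {t. \<not> isCont v t}" using sgn_sin_facts(2) countable_subset by blast
  qed
  have v_coeff: "(LINT t|period_measure. v t * cos (real (Suc k) * t - of_int \<beta> * pi / 2)) = (if even k then 4 / real (Suc k) * 1 else 0)" for k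
  proof -
    have "v t * cos (real (Suc k) * t - of_int \<beta> * pi / 2) = (?\<sigma> * ?\<sigma>) * (sgn (sin t) * sin (real (Suc k) * t))" for t
      unfolding v_def cos_phase_odd[OF \<beta>] by (simp only: mult_ac)
    then show ?thesis unfolding phase_sign_mult by (simp add: integral_sgn_sin_sin del: of_nat_Suc)
  qed
  have "approx_error {convolution \<phi> (psi r (of_int \<beta>)) | \<phi>. \<phi> \<in> H1_class p} (\<lambda>f. convolution f g) p
    = ereal (4 / pi * (\<Sum>j. (1 - \<Phi> (2 * j + 1)) / real (2 * j + 1) powr (r + 1) * 1))"
  proof (rule K.approx_error_eq[OF p v])
    show "AE t in period_measure. \<bar>K.error_kernel t - 0\<bar> = v t * (K.error_kernel t - 0)"
      by (rule AE_I2) (use v_eq in simp)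
    show "(\<lambda>n. \<Sum>k<n. 2 / real (Suc k) powr r * (1 - \<Phi> (Suc k)) * (LINT t|period_measure. v t * cos (real (Suc k) * t - of_int \<beta> * pi / 2)))
      \<longlonglongrightarrow> 2 * pi * (4 / pi * (\<Sum>j. (1 - \<Phi> (2 * j + 1)) / real (2 * j + 1) powr (r + 1) * 1))"
      unfolding v_coeff using r by (intro square_wave_coefficients_lim[where d="\<lambda>_. 1"]) auto
  qed
  then show ?thesis by (simp add: W_class_def)
qed

text \<open>For r >= 3 the difference of values is the integral over [a, b] of the sine series with
  exponent r - 1 >= 2, which is nonnegative there. The case r = 2 rests on the sawtooth
  instead.\<close>

lemma cosine_series_decreasing:
  assumes r: "r = 2 \<or> 3 \<le> r" and ab: "0 \<le> a" "a \<le> b" "b \<le> pi"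
  shows "0 \<le> (\<Sum>k. 2 / real (Suc k) powr r * (cos (real (Suc k) * a) - cos (real (Suc k) * b)) * (1 - \<Phi> (Suc k)))"
proof (cases "r = 2")
  case True then show ?thesis using pd_cosine_series_2_decreasing[OF ab] by simp
next
  case False
  then have r2: "2 \<le> r - 1" using r by simp
  let ?s = "\<lambda>t k. 2 / real (Suc k) powr (r - 1) * sin (real (Suc k) * t) * (1 - \<Phi> (Suc k))"
  let ?t = "\<lambda>t k. 2 / real (Suc k) powr (r - 1) * (1 - \<Phi> (Suc k)) * sin (real (Suc k) * t)"
  have eq: "?t t k = ?s t k" for t k by (simp only: mult_ac)
  have bnd: "\<bar>sin u * (1 - \<Phi> k)\<bar> \<le> 1 * (1 + C)" for u k
    unfolding abs_mult using \<Phi>_bound[of k] by (intro mult_mono) auto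
  have sm: "summable (\<lambda>k. \<bar>?s t k\<bar>)" for t
    unfolding mult.assoc using r2 by (intro summable_trig[OF _ bnd]) simp
  have lim: "(\<lambda>n. \<Sum>k<n. ?t t k) \<longlonglongrightarrow> (\<Sum>k. ?s t k)" for t
    unfolding eq by (intro summable_LIMSEQ summable_rabs_cancel[OF sm])
  have bound: "\<bar>\<Sum>k<n. ?t t k\<bar> \<le> (\<Sum>k. 2 * (1 + C) / real (Suc k) powr (r - 1))" for n t
  proof -
    have "\<bar>\<Sum>k<n. ?t t k\<bar> \<le> (\<Sum>k<n. \<bar>?t t k\<bar>)" by (rule sum_abs)
    also have "\<dots> \<le> (\<Sum>k<n. 2 * (1 + C) / real (Suc k) powr (r - 1))"
    proof (rule sum_mono)
      fix k
      have "\<bar>?t t k\<bar> = 2 / real (Suc k) powr (r - 1) * \<bar>sin (real (Suc k) * t) * (1 - \<Phi> (Suc k))\<bar>"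
        unfolding eq mult.assoc by (simp add: abs_mult del: of_nat_Suc)
      also have "\<dots> \<le> 2 / real (Suc k) powr (r - 1) * (1 * (1 + C))" by (intro mult_left_mono bnd) simp
      finally show "\<bar>?t t k\<bar> \<le> 2 * (1 + C) / real (Suc k) powr (r - 1)" by simp
    qed
    also have "\<dots> \<le> (\<Sum>k. 2 * (1 + C) / real (Suc k) powr (r - 1))"
    proof (rule sum_le_suminf)
      have "0 \<le> C" using \<Phi>_bound[of 0] by linarith
      then show "0 \<le> 2 * (1 + C) / real (Suc k) powr (r - 1)" for k by simp
    qed (use r2 in \<open>auto intro!: summable_Suc_powr simp del: of_nat_Suc\<close>)
    finally show ?thesis .
  qed
  have "(\<lambda>n. \<Sum>k<n. 2 / real (Suc k) powr (r - 1) * (1 - \<Phi> (Suc k)) / real (Suc k) * (cos (real (Suc k) * a) - cos (real (Suc k) * b)))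
      \<longlonglongrightarrow> integral {a..b} (\<lambda>t. \<Sum>k. ?s t k)"
    by (rule integral_bounded_sin_series(2)[OF lim bound ab(2)])
  moreover have coeff: "2 / m powr (r - 1) * w / m * u = 2 / m powr r * u * w" if "0 < m" for m u w :: real
    using that by (simp add: powr_diff)
  have "2 / real (Suc k) powr (r - 1) * (1 - \<Phi> (Suc k)) / real (Suc k) * (cos (real (Suc k) * a) - cos (real (Suc k) * b))
     = 2 / real (Suc k) powr r * (cos (real (Suc k) * a) - cos (real (Suc k) * b)) * (1 - \<Phi> (Suc k))" for k
    by (rule coeff) simp
  ultimately have "(\<lambda>k. 2 / real (Suc k) powr r * (cos (real (Suc k) * a) - cos (real (Suc k) * b)) * (1 - \<Phi> (Suc k)))
      sums integral {a..b} (\<lambda>t. \<Sum>k. ?s t k)"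
    unfolding sums_def by simp
  then have "(\<Sum>k. 2 / real (Suc k) powr r * (cos (real (Suc k) * a) - cos (real (Suc k) * b)) * (1 - \<Phi> (Suc k)))
      = integral {a..b} (\<lambda>t. \<Sum>k. ?s t k)" by (rule sums_unique[symmetric])
  also have "0 \<le> \<dots>"
  proof (rule integral_nonneg)
    show "(\<lambda>t. \<Sum>k. ?s t k) integrable_on {a..b}"
      using integral_bounded_sin_series(1)[OF lim bound ab(2)] absolutely_integrable_on_def by blast
    show "0 \<le> (\<Sum>k. ?s t k)" if "t \<in> {a..b}" for t using that ab by (intro pd_sine_series_nonneg[OF r2]) auto
  qed
  finally show ?thesis .
qed

text \<open>Up to the phase sign the even kernel decreases on [0, pi]. Monotonicity, rather than
  positivity, is what produces the sign pattern of cosine.\<close>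

lemma approx_error_even:
  assumes \<beta>: "even \<beta>" and r: "r = 2 \<or> 3 \<le> r" and p: "p = 1 \<or> p = \<infinity>"
  shows "approx_error (W_class r (of_int \<beta>) p) (\<lambda>f. convolution f g) p
    = ereal (4 / pi * (\<Sum>j. (1 - \<Phi> (2 * j + 1)) / real (2 * j + 1) powr (r + 1) * (- 1) ^ j))"
proof -
  interpret K: bounded_trig_kernel g "psi r (of_int \<beta>)" "\<lambda>k. \<Phi> (Suc k)" "\<lambda>k. 2 / real (Suc k) powr r" "of_int \<beta> * pi / 2" "\<Sum>k. 2 / real (Suc k) powr r"
    using r by (intro psi_kernel_gt_1) auto
  let ?\<sigma> = "phase_sign \<beta>"
  let ?c = "\<lambda>a b k. 2 / real (Suc k) powr r * (cos (real (Suc k) * a) - cos (real (Suc k) * b)) * (1 - \<Phi> (Suc k))"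
  let ?P = "\<lambda>n t. \<Sum>k<n. 2 / real (Suc k) powr r * (1 - \<Phi> (Suc k)) * cos (real (Suc k) * t - of_int \<beta> * pi / 2)"
  define v where "v t = ?\<sigma> * sgn (cos t)" for t
  have even: "K.error_kernel (- t) = K.error_kernel t" for t
  proof (rule LIMSEQ_unique[OF K.error_kernel_lim])
    have "?P n (- t) = ?P n t" for n
      unfolding cos_phase_even[OF \<beta>] by (simp del: of_nat_Suc)
    then show "(\<lambda>n. ?P n (- t)) \<longlonglongrightarrow> K.error_kernel t"
      by (simp only: K.error_kernel_lim)
  qed
  have decr: "0 \<le> ?\<sigma> * (K.error_kernel a - K.error_kernel b)" if ab: "0 \<le> a" "a \<le> b" "b \<le> pi" for a b
  proof -
    have cb: "\<bar>(cos u - cos v) * (1 - \<Phi> k)\<bar> \<le> 2 * (1 + C)" for u v :: real and k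
    proof -
      have "\<bar>cos u - cos v\<bar> \<le> 2"
        using cos_ge_minus_one[of u] cos_le_one[of u] cos_ge_minus_one[of v] cos_le_one[of v] by linarith
      moreover have "\<bar>1 - \<Phi> k\<bar> \<le> 1 + C" using \<Phi>_bound[of k] by linarith
      ultimately show ?thesis unfolding abs_mult by (intro mult_mono) auto
    qed
    have "summable (\<lambda>k. \<bar>2 / real (Suc k) powr r * ((cos (real (Suc k) * a) - cos (real (Suc k) * b)) * (1 - \<Phi> (Suc k)))\<bar>)"
      using r by (intro summable_trig[OF _ cb]) auto
    then have "summable (?c a b)" unfolding mult.assoc by (rule summable_rabs_cancel)
    then have "(\<lambda>n. \<Sum>k<n. ?c a b k) \<longlonglongrightarrow> (\<Sum>k. ?c a b k)" by (rule summable_LIMSEQ)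
    moreover have "(\<Sum>k<n. ?c a b k) = ?\<sigma> * (?P n a - ?P n b)" for n
      unfolding cos_phase_even[OF \<beta>] sum_subtractf[symmetric] sum_distrib_left
    proof (intro sum.cong refl)
      fix k
      let ?w = "2 / real (Suc k) powr r * (1 - \<Phi> (Suc k))"
      have "?\<sigma> * (?w * (?\<sigma> * cos (real (Suc k) * a)) - ?w * (?\<sigma> * cos (real (Suc k) * b)))
        = (?\<sigma> * ?\<sigma>) * ?c a b k" by (simp only: right_diff_distrib left_diff_distrib mult_ac)
      then show "?c a b k = ?\<sigma> * (?w * (?\<sigma> * cos (real (Suc k) * a)) - ?w * (?\<sigma> * cos (real (Suc k) * b)))"
        unfolding phase_sign_mult by simp
    qed
    moreover have "(\<lambda>n. ?\<sigma> * (?P n a - ?P n b)) \<longlonglongrightarrow> ?\<sigma> * (K.error_kernel a - K.error_kernel b)"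
      by (intro tendsto_mult_left tendsto_diff K.error_kernel_lim)
    ultimately have "?\<sigma> * (K.error_kernel a - K.error_kernel b) = (\<Sum>k. ?c a b k)" using LIMSEQ_unique by simp
    then show ?thesis using cosine_series_decreasing[OF r ab] by simp
  qed
  \<comment> \<open>Subtracting the value at pi/2 places the sign change of the monotone kernel at
    the zero of cosine.\<close>
  define c where "c = K.error_kernel (pi / 2)"
  have v_eq: "\<bar>K.error_kernel t - c\<bar> = v t * (K.error_kernel t - c)" if t: "t \<in> {-pi..pi}" for t
  proof -
    have abs_eq: "\<bar>x\<bar> = ?\<sigma> * x" if "0 \<le> ?\<sigma> * x" for x
      using that phase_sign_mult(2)[of \<beta>] by (metis abs_mult abs_of_nonneg mult_1)
    have Kt: "K.error_kernel t = K.error_kernel \<bar>t\<bar>" using even[of t] by (auto simp: abs_if)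
    consider "\<bar>t\<bar> < pi / 2" | "\<bar>t\<bar> = pi / 2" | "pi / 2 < \<bar>t\<bar>" by linarith
    then show ?thesis
    proof cases
      case 1
      then have "0 < cos t" by (intro cos_gt_zero_pi) (auto simp: abs_less_iff)
      moreover have "0 \<le> ?\<sigma> * (K.error_kernel \<bar>t\<bar> - c)" unfolding c_def using 1 by (intro decr) auto
      ultimately show ?thesis using abs_eq by (simp add: v_def Kt)
    next
      case 2
      have "K.error_kernel t = c" using Kt unfolding 2 c_def .
      then show ?thesis by simp
    next
      case 3
      have "0 < cos (pi - \<bar>t\<bar>)" using 3 t by (intro cos_gt_zero_pi) auto
      then have "cos t < 0" by simp
      moreover have "0 \<le> ?\<sigma> * (c - K.error_kernel \<bar>t\<bar>)" unfolding c_def using 3 t by (intro decr) auto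
      then have "\<bar>c - K.error_kernel \<bar>t\<bar>\<bar> = ?\<sigma> * (c - K.error_kernel \<bar>t\<bar>)" by (rule abs_eq)
      ultimately show ?thesis by (simp add: v_def Kt abs_minus_commute algebra_simps)
    qed
  qed
  have v: "v \<in> borel_measurable borel" "\<bar>v t\<bar> \<le> 1" "v (t + pi) = - v t" "countable {t. \<not> isCont v t}" for t
  proof -
    show "v \<in> borel_measurable borel" unfolding v_def using sgn_cos_facts(1) by measurable
    show "\<bar>v t\<bar> \<le> 1" by (simp add: v_def abs_mult phase_sign_mult sgn_real_def)
    show "v (t + pi) = - v t" by (simp add: v_def sgn_minus)
    have "{t. \<not> isCont v t} \<subseteq> {t. \<not> isCont (\<lambda>t. sgn (cos t)) t}" unfolding v_def by (auto intro: continuous_intros)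
    then show "countable {t. \<not> isCont v t}" using sgn_cos_facts(2) countable_subset by blast
  qed
  have v_coeff: "(LINT t|period_measure. v t * cos (real (Suc k) * t - of_int \<beta> * pi / 2)) = (if even k then 4 / real (Suc k) * (- 1) ^ (k div 2) else 0)" for k
  proof -
    have "v t * cos (real (Suc k) * t - of_int \<beta> * pi / 2) = (?\<sigma> * ?\<sigma>) * (sgn (cos t) * cos (real (Suc k) * t))" for t
      unfolding v_def cos_phase_even[OF \<beta>] by (simp only: mult_ac)
    then show ?thesis unfolding phase_sign_mult by (simp add: integral_sgn_cos_cos del: of_nat_Suc)
  qed
  have "approx_error {convolution \<phi> (psi r (of_int \<beta>)) | \<phi>. \<phi> \<in> H1_class p} (\<lambda>f. convolution f g) p
    = ereal (4 / pi * (\<Sum>j. (1 - \<Phi> (2 * j + 1)) / real (2 * j + 1) powr (r + 1) * (- 1) ^ j))"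
  proof (rule K.approx_error_eq[OF p v])
    show "AE t in period_measure. \<bar>K.error_kernel t - c\<bar> = v t * (K.error_kernel t - c)"
      by (rule AE_I2) (use v_eq in simp)
    show "(\<lambda>n. \<Sum>k<n. 2 / real (Suc k) powr r * (1 - \<Phi> (Suc k)) * (LINT t|period_measure. v t * cos (real (Suc k) * t - of_int \<beta> * pi / 2)))
      \<longlonglongrightarrow> 2 * pi * (4 / pi * (\<Sum>j. (1 - \<Phi> (2 * j + 1)) / real (2 * j + 1) powr (r + 1) * (- 1) ^ j))"
      unfolding v_coeff using r by (intro square_wave_coefficients_lim) auto
  qed
  then show ?thesis by (simp add: W_class_def)
qed

end

text \<open>The test points are \<open>\<tau> * real k\<close> and the coefficients e^(iks); their
  products have real part cos((k - j) s). Evenness of F replaces the difference of points by the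
  distance of indices.\<close>

lemma positive_definite_cos_sum:
  assumes "positive_definite_on_reals (\<lambda>t. of_real (F t))" and even: "\<And>t. F (- t) = F t"
  shows "0 \<le> (\<Sum>k<N. \<Sum>j<N. F (\<tau> * real (nat \<bar>int k - int j\<bar>)) * cos ((real k - real j) * s))"
proof -
  have "(\<Sum>k<N. \<Sum>j<N. cis (real k * s) * cnj (cis (real j * s)) * of_real (F (\<tau> * real k - \<tau> * real j))) \<in> \<real>\<^sub>\<ge>\<^sub>0"
    using assms(1) unfolding positive_definite_on_reals_def by (elim allE)
  then have "0 \<le> Re (\<Sum>k<N. \<Sum>j<N. cis (real k * s) * cnj (cis (real j * s)) * of_real (F (\<tau> * real k - \<tau> * real j)))"
    by (simp add: complex_nonneg_Reals_iff)
  also have "\<dots> = (\<Sum>k<N. \<Sum>j<N. F (\<tau> * real (nat \<bar>int k - int j\<bar>)) * cos ((real k - real j) * s))"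
    unfolding Re_sum
  proof (intro sum.cong refl)
    fix k j
    have "real (nat \<bar>int k - int j\<bar>) = \<bar>real k - real j\<bar>" by simp
    then have "F (\<tau> * real k - \<tau> * real j) = F (\<tau> * real (nat \<bar>int k - int j\<bar>))"
      using even[of "\<tau> * real k - \<tau> * real j"] by (cases "k \<le> j") (simp_all add: right_diff_distrib)
    moreover have "Re (cis (real k * s) * cnj (cis (real j * s))) = cos ((real k - real j) * s)"
      by (simp add: left_diff_distrib cos_diff)
    ultimately show "Re (cis (real k * s) * cnj (cis (real j * s)) * of_real (F (\<tau> * real k - \<tau> * real j)))
      = F (\<tau> * real (nat \<bar>int k - int j\<bar>)) * cos ((real k - real j) * s)" by simp
  qed
  finally show ?thesis .
qed

theorem mainTheorem5:
  fixes h :: "real \<Rightarrow> real" and \<gamma> \<alpha> \<delta> :: real and g :: "real \<Rightarrow> real" and p :: ereal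
  assumes "\<alpha> > 0" and "\<delta> > 0"
    and "g \<in> Lp_space 1"
    and "is_fourier_series_of
           (\<lambda>k. of_real ((1 + \<bar>real_of_int k\<bar> powr \<alpha> * \<delta> * \<gamma>) * h (\<bar>real_of_int k\<bar> powr \<alpha> * \<delta>))) g"
    and "positive_definite_on_reals (\<lambda>t. of_real ((1 + \<gamma> * \<bar>t\<bar> powr \<alpha>) * h (\<bar>t\<bar> powr \<alpha>)))"
    and "continuous_on UNIV (\<lambda>t::real. (1 + \<gamma> * \<bar>t\<bar> powr \<alpha>) * h (\<bar>t\<bar> powr \<alpha>))"
    and "h 0 \<le> 1"
    and "p = 1 \<or> p = \<infinity>"
  defines "G \<equiv> (\<lambda>f. convolution f g)"
    and "a \<equiv> (\<lambda>(r::real) (k::nat).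
           (1 - (1 + real (2 * k + 1) powr \<alpha> * \<delta> * \<gamma>) * h (real (2 * k + 1) powr \<alpha> * \<delta>))
             / real (2 * k + 1) powr (r + 1))"
  shows "(\<forall>(r::real) (\<beta>::int). odd \<beta> \<and> (r = 1 \<or> r \<ge> 2) \<longrightarrow>
            summable (a r) \<and>
            approx_error (W_class r (of_int \<beta>) p) G p = ereal (4 / pi * (\<Sum>k. a r k)))
       \<and> (\<forall>(r::real) (\<beta>::int). even \<beta> \<and> (r = 2 \<or> r \<ge> 3) \<longrightarrow>
            summable (\<lambda>k. a r k * (-1) ^ k) \<and>
            approx_error (W_class r (of_int \<beta>) p) G p = ereal (4 / pi * (\<Sum>k. a r k * (-1) ^ k)))"
proof -
  define \<Phi> where "\<Phi> k = (1 + real k powr \<alpha> * \<delta> * \<gamma>) * h (real k powr \<alpha> * \<delta>)" for k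
  \<comment> \<open>The elementary bound for all Fourier coefficients of an integrable function by
    its mean modulus.\<close>
  define C where "C = 1 / (2 * pi) * (LINT t|period_measure. \<bar>g t\<bar>)"
  have g_int: "integrable period_measure g" using assms(3) by (rule Lp_space_1_integrable)
  have coeff: "fourier_coeff g (int k) = of_real (\<Phi> k)" for k
    using assms(4) by (simp add: is_fourier_series_of_def \<Phi>_def)
  define F where "F t = (1 + \<gamma> * \<bar>t\<bar> powr \<alpha>) * h (\<bar>t\<bar> powr \<alpha>)" for t
  \<comment> \<open>Chosen so that \<tau>^\<alpha> = \<delta>: the multiplier at the integers is
    then the positive definite function sampled with spacing \<tau>.\<close>
  define \<tau> where "\<tau> = \<delta> powr (1 / \<alpha>)"
  have F: "F (\<tau> * real k) = \<Phi> k" for k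
  proof -
    have "\<bar>\<tau> * real k\<bar> powr \<alpha> = real k powr \<alpha> * \<delta>"
      using assms(1,2) by (simp add: \<tau>_def abs_mult powr_mult powr_powr)
    then show ?thesis by (simp add: F_def \<Phi>_def mult_ac)
  qed
  interpret positive_definite_multiplier \<Phi> C g
  proof
    have "positive_definite_on_reals (\<lambda>t. of_real (F t))" using assms(5) unfolding F_def .
    moreover have "F (- t) = F t" for t by (simp add: F_def)
    ultimately have "0 \<le> (\<Sum>k<N. \<Sum>j<N. F (\<tau> * real (nat \<bar>int k - int j\<bar>)) * cos ((real k - real j) * s))" for N s
      by (rule positive_definite_cos_sum)
    then
    show "0 \<le> (\<Sum>k<N. \<Sum>j<N. \<Phi> (nat \<bar>int k - int j\<bar>) * cos ((real k - real j) * s))" for N s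
      unfolding F .
    show "\<bar>\<Phi> k\<bar> \<le> C" for k
    proof -
      have "2 * pi * \<bar>\<Phi> k\<bar> = \<bar>LINT t|period_measure. g t * cos (real k * t)\<bar>"
        unfolding fourier_coeff_real(1)[OF g_int coeff] by (simp add: abs_mult)
      also have "\<dots> \<le> (LINT t|period_measure. \<bar>g t * cos (real k * t)\<bar>)" by (rule integral_abs_bound)
      also have "\<dots> \<le> (LINT t|period_measure. \<bar>g t\<bar>)"
        by (intro integral_mono integrable_abs integrable_period_mult_bounded[OF g_int, where B=1] borel_measurable_period g_int)
           (auto simp: abs_mult mult_left_le)
      finally show ?thesis by (simp add: C_def field_simps)
    qed
    \<comment> \<open>The value of \<open>0 powr \<alpha>\<close> is 0, so \<open>\<Phi> 0\<close>
      is h(0).\<close>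
    show "\<Phi> 0 \<le> 1" using assms(1,7) by (simp add: \<Phi>_def)
  qed (use g_int coeff in auto)
  have a: "a r k = (1 - \<Phi> (2 * k + 1)) / real (2 * k + 1) powr (r + 1)" for r k
    by (simp add: a_def \<Phi>_def)
  have "summable (a r)" if "r = 1 \<or> 2 \<le> r" for r
    using summable_multiplier[of r "\<lambda>_. 1"] that by (auto simp: a[abs_def])
  moreover have "summable (\<lambda>k. a r k * (- 1) ^ k)" if "r = 2 \<or> 3 \<le> r" for r
    using summable_multiplier[of r "\<lambda>k. (- 1) ^ k"] that by (auto simp: a[abs_def])
  ultimately show ?thesis
    using approx_error_odd approx_error_even assms(8) by (auto simp: G_def a[abs_def])
qed

end
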